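(* Let $(e^{tA})_{t\ge0}$ be a real, uniformly eventually positive, and persistently irreducible $C_0$-semigroup on a complex Banach lattice $E$ such that $\sigma(A)\ne\varnothing$. If the spectral bound $s(A)$ is a pole of the resolvent $\mathcal R(\cdot,A)$, then there exists $\alpha\ge0$ such that $$\sigma_{\mathrm{per,pnt}}(A)=s(A)+i\alpha\mathbb Z.$$ Moreover, every pole of $\mathcal R(\cdot,A)$ in $\sigma_{\mathrm{per}}(A)$ is a simple pole.
   Context: $s(A):=\sup\{\operatorname{Re}\lambda:\lambda\in\sigma(A)\}$; $\sigma_{\mathrm{per}}(A):=\{\lambda\in\sigma(A):\operatorname{Re}\lambda=s(A)\}$; $\sigma_{\mathrm{pnt}}(A)$ is the point spectrum (set of eigenvalues); $\sigma_{\mathrm{per,pnt}}(A):=\sigma_{\mathrm{per}}(A)\cap\sigma_{\mathrm{pnt}}(A)$. A bounded operator on a complex Banach lattice is real if it maps the real part $E_{\mathbb R}$ into itself; a semigroup is real if each $e^{tA}$ is real. The semigroup is uniformly eventually positive if there is $t_0\ge0$ such that $e^{tA}f\ge0$ for all $t\ge t_0$ and all $0\le f\in E$. A (lattice) ideal of $E$ is a subspace $I$ such that $|y|\le|x|$, $x\in I$ implies $y\in I$. The semigroup is persistently irreducible if, whenever $I$ is a closed ideal of $E$ for which there exists $t_0\ge0$ with $e^{tA}I\subseteq I$ for all $t\ge t_0$, one has $I=\{0\}$ or $I=E$. *)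

theory Defs
  imports "HOL-Analysis.Analysis" "HOL-Library.Lattice_Algebras"
begin

section \<open>Complex normed spaces\<close>

class complex_vector = real_vector +
  fixes scaleC :: "complex \<Rightarrow> 'a \<Rightarrow> 'a"  (infixr \<open>*\<^sub>C\<close> 75)
  assumes scaleC_add_right: "c *\<^sub>C (x + y) = c *\<^sub>C x + c *\<^sub>C y"
    and scaleC_add_left: "(c + d) *\<^sub>C x = c *\<^sub>C x + d *\<^sub>C x"
    and scaleC_scaleC: "c *\<^sub>C (d *\<^sub>C x) = (c * d) *\<^sub>C x"
    and scaleC_one: "1 *\<^sub>C x = x"
    and scaleC_of_real: "complex_of_real r *\<^sub>C x = r *\<^sub>R x"

class complex_normed_vector = complex_vector + real_normed_vector +
  assumes norm_scaleC: "norm (c *\<^sub>C x) = cmod c * norm x"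

class complex_banach = complex_normed_vector + banach

lemma bounded_linear_scaleC: "bounded_linear (\<lambda>x::'a::complex_normed_vector. c *\<^sub>C x)"
proof (rule bounded_linear_intro[where K = "cmod c"])
  show "c *\<^sub>C (r *\<^sub>R x) = r *\<^sub>R (c *\<^sub>C x)" for r and x :: 'a
    by (metis scaleC_of_real scaleC_scaleC mult.commute)
qed (auto simp: scaleC_add_right norm_scaleC mult.commute)

text \<open>
  Bounded operators are represented by the library type \<open>'a \<Rightarrow>\<^sub>L 'b\<close>, whose elements are only
  real-linear. Complex linearity is imposed separately by the following predicate; the operator norm
  is the same over both scalar fields.
\<close>

definition complex_linear :: "('a::complex_vector \<Rightarrow> 'b::complex_vector) \<Rightarrow> bool"
  where "complex_linear f \<longleftrightarrow>
    (\<forall>x y. f (x + y) = f x + f y) \<and> (\<forall>c x. f (c *\<^sub>C x) = c *\<^sub>C f x)"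

instantiation blinfun :: (real_normed_vector, complex_normed_vector) complex_normed_vector
begin

lift_definition scaleC_blinfun :: "complex \<Rightarrow> 'a \<Rightarrow>\<^sub>L 'b \<Rightarrow> 'a \<Rightarrow>\<^sub>L 'b"
  is "\<lambda>c f x. c *\<^sub>C f x"
  using bounded_linear_compose bounded_linear_scaleC by blast

instance
proof
  fix c d :: complex and r :: real and f g :: "'a \<Rightarrow>\<^sub>L 'b"
  show "c *\<^sub>C (f + g) = c *\<^sub>C f + c *\<^sub>C g"
    by transfer (simp add: scaleC_add_right)
  show "(c + d) *\<^sub>C f = c *\<^sub>C f + d *\<^sub>C f"
    by transfer (simp add: scaleC_add_left)
  show "c *\<^sub>C (d *\<^sub>C f) = (c * d) *\<^sub>C f"
    by transfer (simp add: scaleC_scaleC)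
  show "1 *\<^sub>C f = f"
    by transfer (simp add: scaleC_one)
  show "complex_of_real r *\<^sub>C f = r *\<^sub>R f"
    by transfer (simp add: scaleC_of_real)
  have "norm (c *\<^sub>C f) = norm (cmod c *\<^sub>R f)"
    by transfer (simp add: onorm_def norm_scaleC)
  then show "norm (c *\<^sub>C f) = cmod c * norm f"
    by simp
qed

end


section \<open>Real Banach lattices\<close>

class banach_lattice = banach + lattice_ab_group_add_abs + ordered_real_vector +
  assumes norm_mono_abs: "\<bar>x\<bar> \<le> \<bar>y\<bar> \<Longrightarrow> norm x \<le> norm y"

lemma banach_lattice_norm_abs: "norm \<bar>x::'a::banach_lattice\<bar> = norm x"
  by (intro antisym norm_mono_abs) simp_all

lemma banach_lattice_norm_mono:
  "0 \<le> x \<Longrightarrow> x \<le> y \<Longrightarrow> norm x \<le> norm (y::'a::banach_lattice)"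
  by (rule norm_mono_abs) (metis abs_of_nonneg order_trans)

lemma banach_lattice_limit_nonneg:
  fixes X :: "nat \<Rightarrow> 'a::banach_lattice"
  assumes lim: "X \<longlonglongrightarrow> L" and nn: "\<And>n. n \<ge> 1 \<Longrightarrow> 0 \<le> X n"
  shows "0 \<le> L"
proof -
  have b: "norm (pprt (- L)) \<le> norm (X n - L)" if "n \<ge> 1" for n
  proof -
    have "- L \<le> X n - L" using nn[OF that] by simp
    also have "\<dots> \<le> \<bar>X n - L\<bar>" by (rule abs_ge_self)
    finally have "pprt (- L) \<le> \<bar>X n - L\<bar>"
      by (simp add: pprt_def)
    then have "norm (pprt (- L)) \<le> norm \<bar>X n - L\<bar>"
      by (intro banach_lattice_norm_mono) auto
    then show ?thesis by (simp add: banach_lattice_norm_abs)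
  qed
  have "(\<lambda>n. norm (X n - L)) \<longlonglongrightarrow> 0"
    using lim by (simp add: LIM_zero tendsto_norm_zero)
  then have "norm (pprt (- L)) \<le> 0"
    by (rule LIMSEQ_le_const) (use b in blast)
  then have "pprt (- L) = 0" by simp
  then show ?thesis by (simp add: le_zero_iff_zero_pprt[symmetric])
qed

lemma banach_lattice_limit_le:
  fixes X Y :: "nat \<Rightarrow> 'a::banach_lattice"
  assumes "X \<longlonglongrightarrow> L" "Y \<longlonglongrightarrow> M" "\<And>n. n \<ge> 1 \<Longrightarrow> X n \<le> Y n"
  shows "L \<le> M"
  using banach_lattice_limit_nonneg[OF tendsto_diff[OF assms(2,1)]] assms(3) by simp

lemma banach_lattice_scaleR_le: "r *\<^sub>R x \<le> \<bar>r\<bar> *\<^sub>R \<bar>x::'a::banach_lattice\<bar>"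
proof (cases "r \<ge> 0")
  case True
  then show ?thesis using scaleR_left_mono[OF abs_ge_self True] by simp
next
  case False
  have "(- r) *\<^sub>R (- x) \<le> (- r) *\<^sub>R \<bar>x\<bar>"
    using False by (intro scaleR_left_mono) (auto simp: abs_ge_minus_self)
  then show ?thesis using False by simp
qed

section \<open>The complexification of a Banach lattice\<close>

text \<open>
  A complex Banach lattice is the complexification \<open>E = E\<^sub>R \<oplus> i E\<^sub>R\<close> of a real Banach lattice \<open>E\<^sub>R\<close>,
  with modulus \<open>|x + i y| = sup {(cos \<theta>) x + (sin \<theta>) y | \<theta>}\<close> and norm \<open>\<parallel>z\<parallel> = \<parallel> |z| \<parallel>\<close>.
\<close>

datatype 'a complexification = Cplx (re: 'a) (im: 'a)

definition rotated :: "'a::banach_lattice complexification \<Rightarrow> real \<Rightarrow> 'a"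
  where "rotated z \<theta> = cos \<theta> *\<^sub>R re z + sin \<theta> *\<^sub>R im z"

definition modulus :: "'a::banach_lattice complexification \<Rightarrow> 'a"
  where "modulus z = (THE m. (\<forall>\<theta>. rotated z \<theta> \<le> m) \<and> (\<forall>b. (\<forall>\<theta>. rotated z \<theta> \<le> b) \<longrightarrow> m \<le> b))"

lemma rotated_lipschitz:
  "rotated z s \<le> rotated z t + \<bar>s - t\<bar> *\<^sub>R (\<bar>re z\<bar> + \<bar>im z\<bar>)"
proof -
  have c: "\<bar>cos s - cos t\<bar> \<le> \<bar>s - t\<bar>"
    using field_differentiable_bound[of UNIV cos "\<lambda>x. - sin x" 1 s t]
    by (auto intro!: derivative_eq_intros)
  have d: "\<bar>sin s - sin t\<bar> \<le> \<bar>s - t\<bar>"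
    using field_differentiable_bound[of UNIV sin cos 1 s t]
    by (auto intro!: derivative_eq_intros)
  have "(cos s - cos t) *\<^sub>R re z \<le> \<bar>s - t\<bar> *\<^sub>R \<bar>re z\<bar>"
    using banach_lattice_scaleR_le scaleR_right_mono[OF c abs_ge_zero] by (rule order_trans)
  moreover have "(sin s - sin t) *\<^sub>R im z \<le> \<bar>s - t\<bar> *\<^sub>R \<bar>im z\<bar>"
    using banach_lattice_scaleR_le scaleR_right_mono[OF d abs_ge_zero] by (rule order_trans)
  ultimately have "(cos s - cos t) *\<^sub>R re z + (sin s - sin t) *\<^sub>R im z
      \<le> \<bar>s - t\<bar> *\<^sub>R \<bar>re z\<bar> + \<bar>s - t\<bar> *\<^sub>R \<bar>im z\<bar>"
    by (rule add_mono)
  then show ?thesis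
    by (simp add: rotated_def algebra_simps)
qed

lemma rotated_period: "\<exists>t. 0 \<le> t \<and> t < 2 * pi \<and> rotated z s = rotated z t"
proof -
  obtain t where "0 \<le> t" "t < 2*pi" "cos s = cos t" "sin s = sin t"
    using sincos_total_2pi[of "cos s" "sin s"] by auto
  then show ?thesis by (auto simp: rotated_def)
qed

lemma modulus_exists:
  fixes z :: "'a::banach_lattice complexification"
  shows "\<exists>m. (\<forall>t. rotated z t \<le> m) \<and> (\<forall>b. (\<forall>t. rotated z t \<le> b) \<longrightarrow> m \<le> b)"
proof -
  define u where "u = \<bar>re z\<bar> + \<bar>im z\<bar>"
  have u0: "0 \<le> u" by (simp add: u_def)
  define S where "S n = Sup_fin ((\<lambda>k. rotated z (2 * pi * real k / real n)) ` {..n})" for n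
  have S_ub: "S n \<le> b" if "\<And>t. rotated z t \<le> b" for n b
    unfolding S_def using that by (intro Sup_fin.boundedI) auto
  have near: "rotated z t \<le> S n + (2 * pi / real n) *\<^sub>R u" if n: "n \<ge> 1" for n t
  proof -
    obtain s where s: "0 \<le> s" "s < 2 * pi" "rotated z t = rotated z s"
      using rotated_period by blast
    define k where "k = nat \<lfloor>s * real n / (2 * pi)\<rfloor>"
    have n0: "real n > 0" using n by simp
    have q0: "0 \<le> s * real n / (2 * pi)" using s by simp
    have k1: "real k \<le> s * real n / (2 * pi)" and k2: "s * real n / (2 * pi) < real k + 1"
      unfolding k_def using q0 by linarith+
    have "s * real n / (2 * pi) \<le> real n"
      using s n0 by (simp add: field_simps)
    then have kn: "k \<le> n" using k1 by linarith
    have "2 * pi * real k / real n \<le> s" "s \<le> 2 * pi * real k / real n + 2 * pi / real n"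
      using k1 k2 n0 by (simp_all add: field_simps)
    then have diff: "\<bar>s - 2 * pi * real k / real n\<bar> \<le> 2 * pi / real n" by linarith
    have "rotated z s \<le> rotated z (2 * pi * real k / real n) + \<bar>s - 2 * pi * real k / real n\<bar> *\<^sub>R u"
      unfolding u_def by (rule rotated_lipschitz)
    also have "\<dots> \<le> S n + (2 * pi / real n) *\<^sub>R u"
    proof (rule add_mono)
      show "rotated z (2 * pi * real k / real n) \<le> S n"
        unfolding S_def using kn by (intro Sup_fin.coboundedI) auto
      show "\<bar>s - 2 * pi * real k / real n\<bar> *\<^sub>R u \<le> (2 * pi / real n) *\<^sub>R u"
        using diff u0 by (rule scaleR_right_mono)
    qed
    finally show ?thesis using s by simp
  qed
  have half: "S m - S n \<le> (2 * pi / real N) *\<^sub>R u" if "N \<ge> 1" "n \<ge> N" for m n N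
  proof -
    have "S m \<le> S n + (2 * pi / real n) *\<^sub>R u"
      using near that by (intro S_ub) auto
    also have "(2 * pi / real n) *\<^sub>R u \<le> (2 * pi / real N) *\<^sub>R u"
      using that u0 by (intro scaleR_right_mono divide_left_mono) auto
    finally show ?thesis by (simp add: algebra_simps)
  qed
  have bound: "norm (S m - S n) \<le> 2 * pi / real N * norm u"
    if "N \<ge> 1" "n \<ge> N" "m \<ge> N" for m n N
  proof -
    have "\<bar>S m - S n\<bar> \<le> (2 * pi / real N) *\<^sub>R u"
      using half[of N n m] half[of N m n] that by (auto simp: abs_lattice)
    then have "norm \<bar>S m - S n\<bar> \<le> norm ((2 * pi / real N) *\<^sub>R u)"
      by (intro banach_lattice_norm_mono) auto
    then show ?thesis by (simp add: banach_lattice_norm_abs)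
  qed
  have "Cauchy S"
  proof (rule metric_CauchyI)
    fix e :: real assume e: "0 < e"
    obtain M :: nat where M: "2 * pi * norm u / e < real M" using reals_Archimedean2 by blast
    define N where "N = max 1 M"
    have N: "N \<ge> 1" "2 * pi * norm u / e < real N" using M by (auto simp: N_def)
    have "2 * pi / real N * norm u < e" using N e by (simp add: field_simps)
    then show "\<exists>N. \<forall>m\<ge>N. \<forall>n\<ge>N. dist (S m) (S n) < e"
      using bound[OF N(1)] by (auto simp: dist_norm intro!: exI[of _ N] intro: le_less_trans)
  qed
  then obtain L where L: "S \<longlonglongrightarrow> L" using Cauchy_convergent convergent_def by blast
  have "(\<lambda>n. 2 * pi / real n) \<longlonglongrightarrow> 0"
    by (rule lim_const_over_n)
  then have "(\<lambda>n. S n + (2 * pi / real n) *\<^sub>R u) \<longlonglongrightarrow> L + 0 *\<^sub>R u"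
    by (intro tendsto_intros L)
  then have "rotated z t \<le> L" for t
    using banach_lattice_limit_le[OF tendsto_const] near by fastforce
  moreover have "L \<le> b" if "\<forall>t. rotated z t \<le> b" for b
    using banach_lattice_limit_le[OF L tendsto_const] S_ub that by blast
  ultimately show ?thesis by blast
qed

lemma modulus_lub: "(\<forall>t. rotated z t \<le> modulus z) \<and> (\<forall>b. (\<forall>t. rotated z t \<le> b) \<longrightarrow> modulus z \<le> b)"
proof -
  have "\<exists>!m. (\<forall>t. rotated z t \<le> m) \<and> (\<forall>b. (\<forall>t. rotated z t \<le> b) \<longrightarrow> m \<le> b)"
    using modulus_exists[of z] by (auto intro: antisym)
  from theI'[OF this] show ?thesis unfolding modulus_def .
qed

lemma rotated_le_modulus: "rotated z t \<le> modulus z"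
  using modulus_lub by blast

lemma modulus_least: "(\<And>t. rotated z t \<le> b) \<Longrightarrow> modulus z \<le> b"
  using modulus_lub by blast

lemma re_le_modulus: "\<bar>re z\<bar> \<le> modulus z"
  using rotated_le_modulus[of z 0] rotated_le_modulus[of z pi]
  by (simp add: rotated_def abs_lattice)

lemma im_le_modulus: "\<bar>im z\<bar> \<le> modulus z"
  using rotated_le_modulus[of z "pi/2"] rotated_le_modulus[of z "- (pi/2)"]
  by (simp add: rotated_def abs_lattice)

lemma modulus_nonneg: "0 \<le> modulus z"
  using re_le_modulus abs_ge_zero by (rule order_trans[rotated])

lemma modulus_le: "modulus z \<le> \<bar>re z\<bar> + \<bar>im z\<bar>"
proof (rule modulus_least)
  fix t
  have "cos t *\<^sub>R re z \<le> 1 *\<^sub>R \<bar>re z\<bar>"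
    using banach_lattice_scaleR_le scaleR_right_mono[OF abs_cos_le_one abs_ge_zero]
    by (rule order_trans)
  moreover have "sin t *\<^sub>R im z \<le> 1 *\<^sub>R \<bar>im z\<bar>"
    using banach_lattice_scaleR_le scaleR_right_mono[OF abs_sin_le_one abs_ge_zero]
    by (rule order_trans)
  ultimately show "rotated z t \<le> \<bar>re z\<bar> + \<bar>im z\<bar>"
    by (simp add: rotated_def add_mono)
qed

instantiation complexification :: (banach_lattice) complex_vector
begin

definition zero_complexification :: "'a complexification"
  where "0 = Cplx 0 0"
definition plus_complexification :: "'a complexification \<Rightarrow> 'a complexification \<Rightarrow> 'a complexification"
  where "z + w = Cplx (re z + re w) (im z + im w)"
definition uminus_complexification :: "'a complexification \<Rightarrow> 'a complexification"
  where "- z = Cplx (- re z) (- im z)"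
definition minus_complexification :: "'a complexification \<Rightarrow> 'a complexification \<Rightarrow> 'a complexification"
  where "z - w = Cplx (re z - re w) (im z - im w)"
definition scaleR_complexification :: "real \<Rightarrow> 'a complexification \<Rightarrow> 'a complexification"
  where "r *\<^sub>R z = Cplx (r *\<^sub>R re z) (r *\<^sub>R im z)"
definition scaleC_complexification :: "complex \<Rightarrow> 'a complexification \<Rightarrow> 'a complexification"
  where "c *\<^sub>C z = Cplx (Re c *\<^sub>R re z - Im c *\<^sub>R im z) (Re c *\<^sub>R im z + Im c *\<^sub>R re z)"

lemmas complexification_defs = zero_complexification_def plus_complexification_def
  uminus_complexification_def minus_complexification_def scaleR_complexification_def
  scaleC_complexification_def

instance
  by standard (auto simp: complexification_defs algebra_simps intro: complexification.expand)

end

lemma re_im_simps [simp]: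
  "re (0::'a::banach_lattice complexification) = 0" "im (0::'a complexification) = 0"
  "re (z + w) = re z + re w" "im (z + w) = im z + im w"
  "re (z - w) = re z - re w" "im (z - w) = im z - im w"
  "re (- z) = - re z" "im (- z) = - im z"
  "re (r *\<^sub>R z) = r *\<^sub>R re z" "im (r *\<^sub>R z) = r *\<^sub>R im z"
  "re (c *\<^sub>C z) = Re c *\<^sub>R re z - Im c *\<^sub>R im z"
  "im (c *\<^sub>C z) = Re c *\<^sub>R im z + Im c *\<^sub>R re z"
  for z w :: "'a::banach_lattice complexification"
  by (simp_all add: complexification_defs)

lemma modulus_triangle: "modulus (z + w) \<le> modulus z + modulus w"
proof (rule modulus_least)
  fix t
  have "rotated (z + w) t = rotated z t + rotated w t"
    by (simp add: rotated_def algebra_simps)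
  then show "rotated (z + w) t \<le> modulus z + modulus w"
    using add_mono[OF rotated_le_modulus rotated_le_modulus] by simp
qed

lemma modulus_scaleC_le: "modulus (c *\<^sub>C z) \<le> cmod c *\<^sub>R modulus z"
proof (rule modulus_least)
  fix t
  have c: "c = rcis (cmod c) (Arg c)" by (simp add: rcis_cmod_Arg)
  have Re: "Re c = cmod c * cos (Arg c)" and Im: "Im c = cmod c * sin (Arg c)"
    by (subst c, simp)+
  have "rotated (c *\<^sub>C z) t = cmod c *\<^sub>R rotated z (t - Arg c)"
    unfolding rotated_def re_im_simps Re Im cos_diff sin_diff by (simp add: algebra_simps)
  then show "rotated (c *\<^sub>C z) t \<le> cmod c *\<^sub>R modulus z"
    by (simp add: scaleR_left_mono rotated_le_modulus)
qed

lemma modulus_scaleC: "modulus (c *\<^sub>C z) = cmod c *\<^sub>R modulus z"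
proof (cases "c = 0")
  case True
  have "modulus (c *\<^sub>C z) \<le> 0" using modulus_scaleC_le[of c z] True by simp
  then show ?thesis using True modulus_nonneg by (auto intro: antisym)
next
  case False
  have "modulus z = modulus (inverse c *\<^sub>C c *\<^sub>C z)"
    using False by (simp add: scaleC_scaleC scaleC_one)
  also have "\<dots> \<le> cmod (inverse c) *\<^sub>R modulus (c *\<^sub>C z)" by (rule modulus_scaleC_le)
  finally have "cmod c *\<^sub>R modulus z \<le> cmod c *\<^sub>R cmod (inverse c) *\<^sub>R modulus (c *\<^sub>C z)"
    by (intro scaleR_left_mono) auto
  also have "\<dots> = modulus (c *\<^sub>C z)" using False by (simp add: norm_inverse)
  finally show ?thesis using modulus_scaleC_le by (intro antisym)
qed

lemma modulus_eq_0: "modulus z = 0 \<longleftrightarrow> z = 0"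
proof
  assume "modulus z = 0"
  then have "re z = 0" "im z = 0"
    using re_le_modulus[of z] im_le_modulus[of z] by auto
  then show "z = 0" by (auto intro: complexification.expand)
next
  assume "z = 0"
  then show "modulus z = 0"
    using modulus_le[of z] modulus_nonneg[of z] by (auto intro: antisym)
qed

instantiation complexification :: (banach_lattice) complex_normed_vector
begin

definition norm_complexification :: "'a complexification \<Rightarrow> real"
  where "norm_complexification z = norm (modulus z)"
definition dist_complexification :: "'a complexification \<Rightarrow> 'a complexification \<Rightarrow> real"
  where "dist_complexification z w = norm (z - w)"
definition sgn_complexification :: "'a complexification \<Rightarrow> 'a complexification"
  where "sgn_complexification z = z /\<^sub>R norm z"
definition uniformity_complexification :: "('a complexification \<times> 'a complexification) filter"
  where "uniformity_complexification = (INF e\<in>{0 <..}. principal {(z :: 'a complexification, w). dist z w < e})"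
definition open_complexification :: "'a complexification set \<Rightarrow> bool"
  where "open_complexification U \<longleftrightarrow> (\<forall>z\<in>U. \<forall>\<^sub>F (z', w) in uniformity. z' = z \<longrightarrow> w \<in> U)"

instance
proof
  fix z w :: "'a complexification" and r :: real and c :: complex
  show "norm z = 0 \<longleftrightarrow> z = 0"
    by (simp add: norm_complexification_def modulus_eq_0)
  have "norm (z + w) \<le> norm (modulus z + modulus w)"
    unfolding norm_complexification_def
    by (intro banach_lattice_norm_mono modulus_nonneg modulus_triangle)
  also have "\<dots> \<le> norm z + norm w"
    unfolding norm_complexification_def by (rule norm_triangle_ineq)
  finally show "norm (z + w) \<le> norm z + norm w" .
  show "norm (c *\<^sub>C z) = cmod c * norm z"
    by (simp add: norm_complexification_def modulus_scaleC)
  show "norm (r *\<^sub>R z) = \<bar>r\<bar> * norm z"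
    unfolding norm_complexification_def scaleC_of_real[symmetric] modulus_scaleC by simp
qed (simp_all add: dist_complexification_def sgn_complexification_def
    uniformity_complexification_def open_complexification_def)

end

lemma norm_re_le: "norm (re z) \<le> norm z" for z :: "'a::banach_lattice complexification"
  unfolding norm_complexification_def
  by (rule norm_mono_abs) (use re_le_modulus[of z] modulus_nonneg[of z] in simp)

lemma norm_im_le: "norm (im z) \<le> norm z" for z :: "'a::banach_lattice complexification"
  unfolding norm_complexification_def
  by (rule norm_mono_abs) (use im_le_modulus[of z] modulus_nonneg[of z] in simp)

lemma norm_le_re_im: "norm z \<le> norm (re z) + norm (im z)"
  for z :: "'a::banach_lattice complexification"
proof -
  have "norm z \<le> norm (\<bar>re z\<bar> + \<bar>im z\<bar>)"
    unfolding norm_complexification_def by (intro banach_lattice_norm_mono modulus_nonneg modulus_le)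
  also have "\<dots> \<le> norm (re z) + norm (im z)"
    using norm_triangle_ineq[of "\<bar>re z\<bar>" "\<bar>im z\<bar>"] by (simp add: banach_lattice_norm_abs)
  finally show ?thesis .
qed

instance complexification :: (banach_lattice) complex_banach
proof
  fix X :: "nat \<Rightarrow> 'a complexification"
  assume X: "Cauchy X"
  have "Cauchy (\<lambda>n. re (X n))" "Cauchy (\<lambda>n. im (X n))"
    unfolding Cauchy_iff
    using X[unfolded Cauchy_iff]
      norm_re_le[of "X _ - X _", unfolded re_im_simps] norm_im_le[of "X _ - X _", unfolded re_im_simps]
    by (meson le_less_trans)+
  then obtain a b where a: "(\<lambda>n. re (X n)) \<longlonglongrightarrow> a" and b: "(\<lambda>n. im (X n)) \<longlonglongrightarrow> b"
    using Cauchy_convergent convergent_def by metis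
  have "(\<lambda>n. norm (re (X n) - a) + norm (im (X n) - b)) \<longlonglongrightarrow> 0 + 0"
    using a b by (intro tendsto_add) (simp_all add: LIM_zero tendsto_norm_zero)
  then have "(\<lambda>n. norm (re (X n) - a) + norm (im (X n) - b)) \<longlonglongrightarrow> 0" by simp
  then have "(\<lambda>n. X n - Cplx a b) \<longlonglongrightarrow> 0"
    by (rule Lim_null_comparison[rotated])
      (use norm_le_re_im[of "X _ - Cplx a b"] in simp)
  then show "convergent X" unfolding convergent_def using LIM_zero_cancel by blast
qed

text \<open>\<open>f \<ge> 0\<close> in \<open>E\<close> means that \<open>f\<close> belongs to the positive cone of \<open>E\<^sub>R\<close>.\<close>

instantiation complexification :: (banach_lattice) ordered_ab_group_add
begin

definition less_eq_complexification :: "'a complexification \<Rightarrow> 'a complexification \<Rightarrow> bool"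
  where "z \<le> w \<longleftrightarrow> re z \<le> re w \<and> im z = im w"
definition less_complexification :: "'a complexification \<Rightarrow> 'a complexification \<Rightarrow> bool"
  where "z < w \<longleftrightarrow> re z < re w \<and> im z = im w"

instance
  by standard (auto simp: less_eq_complexification_def less_complexification_def
      intro: complexification.expand)

end

definition real_part :: "'a::banach_lattice complexification set"
  where "real_part = {z. im z = 0}"

definition lattice_ideal :: "'a::banach_lattice complexification set \<Rightarrow> bool"
  where "lattice_ideal I \<longleftrightarrow>
    0 \<in> I \<and> (\<forall>x\<in>I. \<forall>y\<in>I. x + y \<in> I) \<and> (\<forall>c. \<forall>x\<in>I. c *\<^sub>C x \<in> I) \<and>
    (\<forall>x\<in>I. \<forall>y. modulus y \<le> modulus x \<longrightarrow> y \<in> I)"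


section \<open>Unbounded operators and their spectra\<close>

text \<open>A possibly unbounded operator is given by its domain and its action there; the values of the
  action outside the domain are irrelevant.\<close>

datatype 'a operator = Operator (dom: "'a set") (act: "'a \<Rightarrow> 'a")

definition shifted :: "'a::complex_vector operator \<Rightarrow> complex \<Rightarrow> 'a \<Rightarrow> 'a"
  where "shifted A \<mu> x = \<mu> *\<^sub>C x - act A x"

definition resolvent_set :: "'a::complex_normed_vector operator \<Rightarrow> complex set"
  where "resolvent_set A = {\<mu>. bij_betw (shifted A \<mu>) (dom A) UNIV \<and>
    bounded_linear (the_inv_into (dom A) (shifted A \<mu>))}"

definition resolvent :: "'a::complex_normed_vector operator \<Rightarrow> complex \<Rightarrow> 'a \<Rightarrow>\<^sub>L 'a"
  where "resolvent A \<mu> = Blinfun (the_inv_into (dom A) (shifted A \<mu>))"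

definition spectrum :: "'a::complex_normed_vector operator \<Rightarrow> complex set"
  where "spectrum A = - resolvent_set A"

definition point_spectrum :: "'a::complex_normed_vector operator \<Rightarrow> complex set"
  where "point_spectrum A = {\<mu>. \<exists>x\<in>dom A. x \<noteq> 0 \<and> act A x = \<mu> *\<^sub>C x}"

text \<open>The supremum is meaningful because it is used only for generators of \<open>C\<^sub>0\<close>-semigroups, whose
  spectrum lies in a left half-plane, and under the assumption that the spectrum is nonempty.\<close>

definition spectral_bound :: "'a::complex_normed_vector operator \<Rightarrow> real"
  where "spectral_bound A = Sup (Re ` spectrum A)"

definition peripheral_spectrum :: "'a::complex_normed_vector operator \<Rightarrow> complex set"
  where "peripheral_spectrum A = {\<mu>\<in>spectrum A. Re \<mu> = spectral_bound A}"

definition peripheral_point_spectrum :: "'a::complex_normed_vector operator \<Rightarrow> complex set"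
  where "peripheral_point_spectrum A = peripheral_spectrum A \<inter> point_spectrum A"

text \<open>
  A pole of order \<open>n\<close> is an isolated singularity whose Laurent expansion in operator norm starts at
  exponent \<open>-n\<close>. The library predicate \<open>is_pole\<close> (the norm tends to infinity) is too weak here: it
  holds for the resolvent at every isolated point of the spectrum, essential singularities included.
\<close>

definition resolvent_pole_of_order :: "'a::complex_normed_vector operator \<Rightarrow> complex \<Rightarrow> nat \<Rightarrow> bool"
  where "resolvent_pole_of_order A \<mu>\<^sub>0 n \<longleftrightarrow> n \<ge> 1 \<and>
    (\<exists>r>0. \<exists>Q :: nat \<Rightarrow> 'a \<Rightarrow>\<^sub>L 'a. Q 0 \<noteq> 0 \<and>
      (\<forall>\<mu>. 0 < cmod (\<mu> - \<mu>\<^sub>0) \<and> cmod (\<mu> - \<mu>\<^sub>0) < r \<longrightarrow>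
        \<mu> \<in> resolvent_set A \<and>
        (\<lambda>k. ((\<mu> - \<mu>\<^sub>0) powi (int k - int n)) *\<^sub>C Q k) sums resolvent A \<mu>))"

definition resolvent_pole :: "'a::complex_normed_vector operator \<Rightarrow> complex \<Rightarrow> bool"
  where "resolvent_pole A \<mu>\<^sub>0 \<longleftrightarrow> (\<exists>n. resolvent_pole_of_order A \<mu>\<^sub>0 n)"

definition simple_resolvent_pole :: "'a::complex_normed_vector operator \<Rightarrow> complex \<Rightarrow> bool"
  where "simple_resolvent_pole A \<mu>\<^sub>0 \<longleftrightarrow> resolvent_pole_of_order A \<mu>\<^sub>0 1"


section \<open>Semigroups\<close>

text \<open>Only the values of \<open>T\<close> on nonnegative times are relevant.\<close>

definition C0_semigroup :: "(real \<Rightarrow> 'a::complex_banach \<Rightarrow>\<^sub>L 'a) \<Rightarrow> bool"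
  where "C0_semigroup T \<longleftrightarrow>
    (\<forall>t\<ge>0. complex_linear (T t)) \<and>
    T 0 = id_blinfun \<and>
    (\<forall>s\<ge>0. \<forall>t\<ge>0. T (s + t) = T s o\<^sub>L T t) \<and>
    (\<forall>x. ((\<lambda>t. T t x) \<longlongrightarrow> x) (at_right 0))"

definition generator :: "(real \<Rightarrow> 'a::complex_banach \<Rightarrow>\<^sub>L 'a) \<Rightarrow> 'a operator"
  where "generator T = Operator
    {x. \<exists>y. ((\<lambda>h. (T h x - x) /\<^sub>R h) \<longlongrightarrow> y) (at_right 0)}
    (\<lambda>x. Lim (at_right 0) (\<lambda>h. (T h x - x) /\<^sub>R h))"

definition real_semigroup ::
    "(real \<Rightarrow> 'a::banach_lattice complexification \<Rightarrow>\<^sub>L 'a complexification) \<Rightarrow> bool"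
  where "real_semigroup T \<longleftrightarrow> (\<forall>t\<ge>0. T t ` real_part \<subseteq> real_part)"

definition uniformly_eventually_positive ::
    "(real \<Rightarrow> 'a::banach_lattice complexification \<Rightarrow>\<^sub>L 'a complexification) \<Rightarrow> bool"
  where "uniformly_eventually_positive T \<longleftrightarrow> (\<exists>t\<^sub>0\<ge>0. \<forall>t\<ge>t\<^sub>0. \<forall>f\<ge>0. T t f \<ge> 0)"

definition persistently_irreducible ::
    "(real \<Rightarrow> 'a::banach_lattice complexification \<Rightarrow>\<^sub>L 'a complexification) \<Rightarrow> bool"
  where "persistently_irreducible T \<longleftrightarrow>
    (\<forall>I. closed I \<and> lattice_ideal I \<and> (\<exists>t\<^sub>0\<ge>0. \<forall>t\<ge>t\<^sub>0. T t ` I \<subseteq> I) \<longrightarrow> I = {0} \<or> I = UNIV)"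

end

theory Submission
  imports Defs
begin

text \<open>
  Let \<open>s\<close> be the spectral bound and \<open>Q\<close> the leading Laurent coefficient of the resolvent at \<open>s\<close>.
  Domination of the resolvents, \<open>|T(t) R(x + i\<beta>) f| \<le> T(t) R(x) |f|\<close> for large \<open>t\<close> and \<open>x > s\<close>, passes
  to the limit at the poles. Hence \<open>Q\<close> is positive; by irreducibility the closed invariant ideal
  \<open>{f. Q|f| = 0}\<close> is trivial, which excludes \<open>Q\<^sup>2 = 0\<close> and makes \<open>s\<close> a simple pole. By domination the
  order of every other pole on the line \<open>Re \<mu> = s\<close> is at most that of \<open>s\<close>.

  The moduli of the eigenvectors for \<open>s + i\<beta>\<close> are fixed by the rescaled semigroup, whose fixed space is
  one-dimensional, so they may be assumed to equal one vector \<open>u\<close>. On vectors that are recurrent along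
  common return times the semigroup acts by lattice homomorphisms fixing \<open>u\<close>, hence multiplicatively
  for the product with unit \<open>u\<close>. If \<open>z\<close> and \<open>w\<close> are eigenvectors for \<open>i\<beta>\<close> and \<open>i\<gamma>\<close>, the product of \<open>z\<close>
  with the conjugate of \<open>w\<close> is therefore one for \<open>i(\<beta> - \<gamma>)\<close>. So the \<open>\<beta>\<close> form a subgroup of the reals,
  which is discrete since \<open>s\<close> is isolated in the spectrum.
\<close>

section \<open>Products relative to an order unit in a Banach lattice\<close>

text \<open>Three obstacles shape the proof. Positivity is assumed only from
  \<open>t\<^sub>0\<close> on, so neither the early operators nor the resolvents need be positive. A
  factor \<open>T t\<close> with \<open>t \<ge> t\<^sub>0\<close> is therefore kept in front of
  every resolvent; it disappears only at the poles, where it acts as a nonzero scalar on the range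
  of the leading coefficient. The Laplace integral is controlled only for large real part, while the
  spectral bound may lie strictly to the left of the growth bound. Domination is therefore
  transported leftwards by Neumann series, and for that purpose it is carried for all powers of the
  resolvents. Finally, \<open>P\<close>, the restriction of \<open>Q\<close> to the real lattice,
  has values in the lattice and not in the scalars. Being positive, invariant and strict, it still
  does the work of a strictly positive functional, and no dual space enters. The product with unit
  \<open>u\<close> is defined by order alone, which is what makes lattice homomorphisms respect it;
  the price is that its bilinearity has to be derived from the parallelogram law.\<close>

lemma lattice_norm_le_of_abs_le:
  fixes x y :: "'a::banach_lattice"
  assumes "\<bar>x\<bar> \<le> y"
  shows "norm x \<le> norm y"
  using norm_mono_abs[of x y] assms abs_ge_self[of y] by (meson order_trans)

lemma norm_abs_diff_le: "norm (\<bar>x\<bar> - \<bar>y\<bar>) \<le> norm (x - y::'a::banach_lattice)"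
  by (rule norm_mono_abs) (rule abs_triangle_ineq3)

lemma tendsto_lattice_abs:
  fixes f :: "'b \<Rightarrow> 'a::banach_lattice"
  assumes "(f \<longlongrightarrow> l) F"
  shows "((\<lambda>x. \<bar>f x\<bar>) \<longlongrightarrow> \<bar>l\<bar>) F"
proof -
  have "((\<lambda>x. norm (f x - l)) \<longlongrightarrow> 0) F"
    using assms by (simp add: LIM_zero tendsto_norm_zero)
  then have "((\<lambda>x. \<bar>f x\<bar> - \<bar>l\<bar>) \<longlongrightarrow> 0) F"
    by (rule Lim_null_comparison[rotated]) (simp add: norm_abs_diff_le)
  then show ?thesis by (rule LIM_zero_cancel)
qed

lemma closed_lattice_nonneg: "closed {x::'a::banach_lattice. 0 \<le> x}"
  by (auto simp: closed_sequential_limits intro: banach_lattice_limit_nonneg)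

lemma tendsto_lattice_le:
  fixes f g :: "'b \<Rightarrow> 'a::banach_lattice"
  assumes "(f \<longlongrightarrow> l) F" "(g \<longlongrightarrow> m) F" "eventually (\<lambda>x. f x \<le> g x) F" "F \<noteq> bot"
  shows "l \<le> m"
proof -
  have "m - l \<in> {x. 0 \<le> x}"
    using assms by (intro Lim_in_closed_set[OF closed_lattice_nonneg _ _ tendsto_diff[OF assms(2,1)]]) auto
  then show ?thesis by simp
qed

lemma lattice_archimedean:
  fixes x y u :: "'a::banach_lattice"
  assumes "\<And>e. e > 0 \<Longrightarrow> x \<le> y + e *\<^sub>R u"
  shows "x \<le> y"
proof (rule tendsto_lattice_le[where F = "at_right 0"])
  show "((\<lambda>e. y + e *\<^sub>R u) \<longlongrightarrow> y) (at_right (0::real))"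
    by (auto intro!: tendsto_eq_intros)
  show "eventually (\<lambda>e. x \<le> y + e *\<^sub>R u) (at_right (0::real))"
    using assms by (auto simp: eventually_at_right_less intro: eventually_at_rightI[of 0 1])
qed auto

lemma lattice_half_le:
  fixes x y :: "'a::banach_lattice"
  assumes "c *\<^sub>R x \<le> c *\<^sub>R y" "0 < c"
  shows "x \<le> y"
  using scaleR_left_mono[OF assms(1), of "inverse c"] assms(2) by simp

lemma lattice_scaleR_le_abs_bound:
  fixes f u :: "'a::banach_lattice"
  assumes "\<bar>f\<bar> \<le> c *\<^sub>R u"
  shows "r *\<^sub>R f \<le> (\<bar>r\<bar> * c) *\<^sub>R u"
  using order_trans[OF banach_lattice_scaleR_le[of r f] scaleR_left_mono[OF assms, of "\<bar>r\<bar>"]]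
  by simp

lemma lattice_abs_scaleR: "\<bar>r *\<^sub>R x\<bar> = \<bar>r\<bar> *\<^sub>R \<bar>x::'a::banach_lattice\<bar>"
proof -
  have le: "\<bar>r *\<^sub>R x\<bar> \<le> \<bar>r\<bar> *\<^sub>R \<bar>x\<bar>" for r and x :: 'a
    using banach_lattice_scaleR_le[of r x] banach_lattice_scaleR_le[of "-r" x]
    by (intro abs_leI) simp_all
  show ?thesis
  proof (cases "r = 0")
    case False
    have "\<bar>r\<bar> *\<^sub>R \<bar>x\<bar> = \<bar>r\<bar> *\<^sub>R \<bar>inverse r *\<^sub>R r *\<^sub>R x\<bar>" using False by simp
    also have "\<dots> \<le> \<bar>r\<bar> *\<^sub>R \<bar>inverse r\<bar> *\<^sub>R \<bar>r *\<^sub>R x\<bar>"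
      by (rule scaleR_left_mono[OF le]) simp
    also have "\<dots> = \<bar>r *\<^sub>R x\<bar>" using False by simp
    finally show ?thesis using le by (intro antisym)
  qed simp
qed

text \<open>A Banach lattice need not be order complete. Here the finite suprema \<open>S n\<close>
  of ever finer approximating subfamilies form a Cauchy sequence in norm, and its limit is the
  supremum of the whole family.\<close>

lemma lub_of_approximable_family:
  fixes x :: "'i \<Rightarrow> 'a::banach_lattice"
  assumes u: "0 \<le> u"
    and approx: "\<And>e::real. e > 0 \<Longrightarrow> \<exists>A. finite A \<and> A \<noteq> {} \<and> (\<forall>i. \<exists>j\<in>A. x i \<le> x j + e *\<^sub>R u)"
  shows "\<exists>m. (\<forall>i. x i \<le> m) \<and> (\<forall>b. (\<forall>i. x i \<le> b) \<longrightarrow> m \<le> b)"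
proof -
  define e where "e n = inverse (real (Suc n))" for n
  have e0: "e n > 0" for n by (simp add: e_def)
  obtain A where A: "\<And>n. finite (A n)" "\<And>n. A n \<noteq> {}"
    "\<And>n i. \<exists>j\<in>A n. x i \<le> x j + e n *\<^sub>R u"
    using approx[OF e0] by metis
  define S where "S n = Sup_fin (x ` A n)" for n
  have S_ub: "S n \<le> b" if "\<And>i. x i \<le> b" for n b
    unfolding S_def using that A by (intro Sup_fin.boundedI) auto
  have near: "x i \<le> S n + e n *\<^sub>R u" for i n
  proof -
    obtain j where j: "j \<in> A n" "x i \<le> x j + e n *\<^sub>R u" using A(3) by blast
    have "x j \<le> S n" unfolding S_def using j A by (intro Sup_fin.coboundedI) auto
    then show ?thesis using j(2) by (meson add_right_mono order_trans)
  qed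
  \<comment> \<open>\<open>S m\<close> is a supremum of members of the family, each of which lies
    below \<open>S n + e n *\<^sub>R u\<close>. The estimate is one-sided; exchanging
    \<open>m\<close> and \<open>n\<close> gives the bound on the modulus.\<close>
  have half: "S m - S n \<le> e N *\<^sub>R u" if "n \<ge> N" for m n N
  proof -
    have "S m \<le> S n + e n *\<^sub>R u" using near by (rule S_ub)
    also have "e n *\<^sub>R u \<le> e N *\<^sub>R u"
      using that u by (intro scaleR_right_mono) (auto simp: e_def field_simps)
    finally show ?thesis by (simp add: algebra_simps)
  qed
  have bound: "norm (S m - S n) \<le> e N * norm u" if "n \<ge> N" "m \<ge> N" for m n N
  proof -
    have "\<bar>S m - S n\<bar> \<le> e N *\<^sub>R u"
      using half[of N n m] half[of N m n] that by (auto intro!: abs_leI)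
    from lattice_norm_le_of_abs_le[OF this] show ?thesis using e0[of N] by simp
  qed
  have elim: "e \<longlonglongrightarrow> 0" unfolding e_def by (rule LIMSEQ_inverse_real_of_nat)
  have "Cauchy S"
  proof (rule metric_CauchyI)
    fix d :: real assume d: "0 < d"
    have "(\<lambda>n. e n * norm u) \<longlonglongrightarrow> 0" using tendsto_mult_left_zero[OF elim] .
    then obtain N where "e N * norm u < d"
      using order_tendstoD(2)[OF _ d] eventually_happens[of _ sequentially] by fastforce
    then show "\<exists>N. \<forall>m\<ge>N. \<forall>n\<ge>N. dist (S m) (S n) < d"
      using bound by (auto simp: dist_norm intro!: exI[of _ N] intro: le_less_trans)
  qed
  then obtain L where L: "S \<longlonglongrightarrow> L" using Cauchy_convergent convergent_def by blast
  have "(\<lambda>n. S n + e n *\<^sub>R u) \<longlonglongrightarrow> L"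
    using L elim by (auto intro!: tendsto_eq_intros)
  then have "x i \<le> L" for i
    using banach_lattice_limit_le[OF tendsto_const] near by blast
  moreover have "L \<le> b" if "\<forall>i. x i \<le> b" for b
    using banach_lattice_limit_le[OF L tendsto_const] S_ub that by blast
  ultimately show ?thesis by blast
qed

text \<open>In a function algebra with unit \<open>u\<close>, \<open>f\<^sup>2\<close> is the supremum over \<open>a\<close> of its tangents
  \<open>2af - a\<^sup>2u\<close>. This makes sense in any Banach lattice and commutes with lattice homomorphisms
  that fix \<open>u\<close>; it replaces the Kakutani representation of the ideal generated by \<open>u\<close>.\<close>

definition tangent :: "'a::banach_lattice \<Rightarrow> 'a \<Rightarrow> real \<Rightarrow> 'a"
  where "tangent u f a = (2 * a) *\<^sub>R f - a\<^sup>2 *\<^sub>R u"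

definition unit_square :: "'a::banach_lattice \<Rightarrow> 'a \<Rightarrow> 'a"
  where "unit_square u f = (THE m. (\<forall>a. tangent u f a \<le> m) \<and> (\<forall>b. (\<forall>a. tangent u f a \<le> b) \<longrightarrow> m \<le> b))"

text \<open>Membership in the principal ideal generated by \<open>u\<close>.\<close>

definition unit_bounded :: "'a::banach_lattice \<Rightarrow> 'a \<Rightarrow> bool"
  where "unit_bounded u f \<longleftrightarrow> (\<exists>c\<ge>0. \<bar>f\<bar> \<le> c *\<^sub>R u)"

text \<open>For a number \<open>p\<close> in \<open>[-c, c]\<close> the parabola
  \<open>2ap - a^2\<close> in \<open>a\<close> has its vertex at \<open>p\<close>, so moving
  \<open>a\<close> into \<open>[-c, c]\<close> can only raise it. This confines the parameter to a
  compact interval.\<close>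

lemma tangent_clamp:
  assumes u: "0 \<le> u" and f: "\<bar>f\<bar> \<le> c *\<^sub>R u" and c: "0 \<le> c"
  shows "tangent u f a \<le> tangent u f (max (-c) (min c a))"
proof -
  have key: "tangent u f a \<le> tangent u f b" if "2 * \<bar>a - b\<bar> * c \<le> a\<^sup>2 - b\<^sup>2" for b
  proof -
    have "(2 * (a - b)) *\<^sub>R f \<le> (\<bar>2 * (a - b)\<bar> * c) *\<^sub>R u"
      using f by (rule lattice_scaleR_le_abs_bound)
    also have "\<dots> \<le> (a\<^sup>2 - b\<^sup>2) *\<^sub>R u"
      using that u by (intro scaleR_right_mono) (auto simp: abs_mult simp del: right_diff_distrib_numeral)
    finally show ?thesis by (simp add: tangent_def algebra_simps)
  qed
  consider "a > c" | "a < - c" | "-c \<le> a" "a \<le> c" by linarith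
  then show ?thesis
  proof cases
    case 1
    then have "2 * (a - c) * c \<le> (a - c) * (a + c)"
      using mult_left_mono[of "2*c" "a + c" "a - c"] by (simp add: algebra_simps)
    then show ?thesis using 1 c key[of c] by (simp add: power2_eq_square algebra_simps)
  next
    case 2
    then have "2 * (- a - c) * c \<le> (- a - c) * (- a + c)"
      using mult_left_mono[of "2*c" "- a + c" "- a - c"] by (simp add: algebra_simps)
    then show ?thesis using 2 c key[of "-c"] by (simp add: power2_eq_square algebra_simps)
  qed simp
qed

text \<open>Half of the constant \<open>4 * c\<close> comes from the linear term, the other half
  from the difference of the squares.\<close>

lemma tangent_lipschitz:
  assumes u: "0 \<le> u" and f: "\<bar>f\<bar> \<le> c *\<^sub>R u" and ab: "\<bar>a\<bar> \<le> c" "\<bar>b\<bar> \<le> c"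
  shows "tangent u f a \<le> tangent u f b + (4 * c * \<bar>a - b\<bar>) *\<^sub>R u"
proof -
  have "(2 * (a - b)) *\<^sub>R f \<le> (\<bar>2 * (a - b)\<bar> * c) *\<^sub>R u"
    using f by (rule lattice_scaleR_le_abs_bound)
  moreover have "(b\<^sup>2 - a\<^sup>2) *\<^sub>R u \<le> (2 * c * \<bar>a - b\<bar>) *\<^sub>R u"
  proof (intro scaleR_right_mono u)
    have "b\<^sup>2 - a\<^sup>2 = (b + a) * (b - a)" by (simp add: power2_eq_square algebra_simps)
    also have "\<dots> \<le> \<bar>b + a\<bar> * \<bar>b - a\<bar>" by (metis abs_ge_self abs_mult)
    also have "\<dots> \<le> (2 * c) * \<bar>a - b\<bar>" using ab by (intro mult_mono) auto
    finally show "b\<^sup>2 - a\<^sup>2 \<le> 2 * c * \<bar>a - b\<bar>" .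
  qed
  ultimately have "(2 * (a - b)) *\<^sub>R f + (b\<^sup>2 - a\<^sup>2) *\<^sub>R u
      \<le> (\<bar>2 * (a - b)\<bar> * c) *\<^sub>R u + (2 * c * \<bar>a - b\<bar>) *\<^sub>R u"
    by (rule add_mono)
  also have "\<dots> = (4 * c * \<bar>a - b\<bar>) *\<^sub>R u"
    unfolding scaleR_add_left[symmetric] abs_mult by simp
  finally show ?thesis
    by (simp add: tangent_def algebra_simps)
qed

lemma tangent_approximable:
  assumes u: "0 \<le> u" and f: "unit_bounded u f" and e: "e > 0"
  shows "\<exists>A. finite A \<and> A \<noteq> {} \<and> (\<forall>a. \<exists>b\<in>A. tangent u f a \<le> tangent u f b + e *\<^sub>R u)"
proof -
  obtain c where c: "c \<ge> 0" "\<bar>f\<bar> \<le> c *\<^sub>R u" using f by (auto simp: unit_bounded_def)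
  \<comment> \<open>Adding 1 to the denominator covers \<open>c = 0\<close>; still
    \<open>4 * c * d \<le> e\<close>.\<close>
  define d where "d = e / (4 * c + 1)"
  have d: "d > 0" "4 * c * d \<le> e"
    using e c by (auto simp: d_def field_simps)
  obtain A where A: "finite A" "A \<subseteq> {-c..c}" "{-c..c} \<subseteq> (\<Union>x\<in>A. ball x d)"
    using seq_compact_imp_totally_bounded[of "{-c..c}"] compact_Icc[of "-c" c] d(1)
    unfolding compact_eq_seq_compact_metric by metis
  have "\<exists>b\<in>A. tangent u f a \<le> tangent u f b + e *\<^sub>R u" for a
  proof -
    define a' where "a' = max (-c) (min c a)"
    have "a' \<in> {-c..c}" using c by (auto simp: a'_def)
    then obtain b where b: "b \<in> A" "\<bar>a' - b\<bar> < d"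
      using A(3) by (auto simp: dist_real_def abs_minus_commute)
    have "tangent u f a \<le> tangent u f a'" unfolding a'_def by (rule tangent_clamp[OF u c(2,1)])
    also have "\<dots> \<le> tangent u f b + (4 * c * \<bar>a' - b\<bar>) *\<^sub>R u"
      using b A(2) \<open>a' \<in> _\<close> by (intro tangent_lipschitz u c) (auto simp: abs_le_iff)
    also have "(4 * c * \<bar>a' - b\<bar>) *\<^sub>R u \<le> e *\<^sub>R u"
    proof (intro scaleR_right_mono u)
      have "4 * c * \<bar>a' - b\<bar> \<le> 4 * c * d" using b(2) c by (intro mult_left_mono) auto
      then show "4 * c * \<bar>a' - b\<bar> \<le> e" using d by linarith
    qed
    finally show ?thesis using b(1) by auto
  qed
  then show ?thesis using A(1) by blast
qed

lemma unit_square_lub: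
  assumes "0 \<le> u" "unit_bounded u f"
  shows "(\<forall>a. tangent u f a \<le> unit_square u f) \<and>
    (\<forall>b. (\<forall>a. tangent u f a \<le> b) \<longrightarrow> unit_square u f \<le> b)"
proof -
  have "\<exists>!m. (\<forall>a. tangent u f a \<le> m) \<and> (\<forall>b. (\<forall>a. tangent u f a \<le> b) \<longrightarrow> m \<le> b)"
    using lub_of_approximable_family[OF assms(1) tangent_approximable[OF assms]]
    by (auto intro: antisym)
  from theI'[OF this] show ?thesis unfolding unit_square_def .
qed

lemma tangent_le_unit_square: "0 \<le> u \<Longrightarrow> unit_bounded u f \<Longrightarrow> tangent u f a \<le> unit_square u f"
  using unit_square_lub by blast

lemma unit_square_least:
  "0 \<le> u \<Longrightarrow> unit_bounded u f \<Longrightarrow> (\<And>a. tangent u f a \<le> b) \<Longrightarrow> unit_square u f \<le> b"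
  using unit_square_lub by blast

lemma unit_bounded_add:
  assumes "unit_bounded u f" "unit_bounded u g"
  shows "unit_bounded u (f + g)"
proof -
  obtain c d where "c \<ge> 0" "\<bar>f\<bar> \<le> c *\<^sub>R u" "d \<ge> 0" "\<bar>g\<bar> \<le> d *\<^sub>R u"
    using assms by (auto simp: unit_bounded_def)
  then show ?thesis
    unfolding unit_bounded_def
    by (intro exI[of _ "c + d"]) (auto simp: scaleR_add_left intro: order_trans[OF abs_triangle_ineq] add_mono)
qed

lemma unit_bounded_scaleR:
  assumes "unit_bounded u f"
  shows "unit_bounded u (r *\<^sub>R f)"
proof -
  obtain c where "c \<ge> 0" "\<bar>f\<bar> \<le> c *\<^sub>R u" using assms by (auto simp: unit_bounded_def)
  then show ?thesis
    unfolding unit_bounded_def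
    by (intro exI[of _ "\<bar>r\<bar> * c"])
      (auto simp: lattice_abs_scaleR simp flip: scaleR_scaleR intro!: scaleR_left_mono)
qed

lemma unit_bounded_uminus: "unit_bounded u f \<Longrightarrow> unit_bounded u (- f)"
  by (simp add: unit_bounded_def)

lemma unit_bounded_diff: "unit_bounded u f \<Longrightarrow> unit_bounded u g \<Longrightarrow> unit_bounded u (f - g)"
  using unit_bounded_add[of u f "- g"] unit_bounded_uminus[of u g] by simp

lemmas unit_bounded_intros = unit_bounded_add unit_bounded_scaleR unit_bounded_uminus unit_bounded_diff

text \<open>With \<open>p = a + b\<close> and \<open>q = a - b\<close>, \<open>tangent (f + g) a + tangent (f - g) b\<close> equals
  \<open>2(pf + qg) - (p\<^sup>2 + q\<^sup>2)u/2\<close>, so the law is an interchange of suprema with sums.\<close>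

lemma unit_square_parallelogram:
  assumes u: "0 \<le> u" and f: "unit_bounded u f" and g: "unit_bounded u g"
  shows "unit_square u (f + g) + unit_square u (f - g) = 2 *\<^sub>R unit_square u f + 2 *\<^sub>R unit_square u g"
proof (rule antisym)
  let ?q = "unit_square u"
  note fg = unit_bounded_add[OF f g] unit_bounded_diff[OF f g]
  have id: "tangent u (f + g) a + tangent u (f - g) b
      = 2 *\<^sub>R tangent u f ((a + b) / 2) + 2 *\<^sub>R tangent u g ((a - b) / 2)" for a b
  proof -
    have "a\<^sup>2 + b\<^sup>2 = 2 * ((a + b) / 2)\<^sup>2 + 2 * ((a - b) / 2)\<^sup>2"
      by (simp add: power2_eq_square field_simps)
    then have "a\<^sup>2 *\<^sub>R u + b\<^sup>2 *\<^sub>R u = (2 * ((a + b) / 2)\<^sup>2) *\<^sub>R u + (2 * ((a - b) / 2)\<^sup>2) *\<^sub>R u"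
      by (metis scaleR_add_left)
    moreover have "(2 * a) *\<^sub>R f + (2 * b) *\<^sub>R f = (4 * ((a + b) / 2)) *\<^sub>R f"
      "(2 * a) *\<^sub>R g - (2 * b) *\<^sub>R g = (4 * ((a - b) / 2)) *\<^sub>R g"
      unfolding scaleR_add_left[symmetric] scaleR_diff_left[symmetric] by simp_all
    ultimately show ?thesis
      unfolding tangent_def scaleR_add_right scaleR_diff_right scaleR_scaleR by (simp add: algebra_simps)
  qed
  let ?R = "2 *\<^sub>R ?q f + 2 *\<^sub>R ?q g"
  have 1: "tangent u (f + g) a + tangent u (f - g) b \<le> ?R" for a b
    unfolding id by (intro add_mono scaleR_left_mono tangent_le_unit_square u f g) auto
  \<comment> \<open>The supremum is taken over one tangent parameter at a time, with the other
    tangent moved to the right-hand side.\<close>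
  have "?q (f + g) \<le> ?R - tangent u (f - g) b" for b
    using 1 by (intro unit_square_least u fg) (simp add: algebra_simps)
  then have "?q (f - g) \<le> ?R - ?q (f + g)"
    by (intro unit_square_least u fg) (simp add: algebra_simps)
  then show "?q (f + g) + ?q (f - g) \<le> ?R" by (simp add: algebra_simps)
  let ?L = "?q (f + g) + ?q (f - g)"
  have 2: "2 *\<^sub>R tangent u f p + 2 *\<^sub>R tangent u g r \<le> ?L" for p r
  proof -
    have "2 *\<^sub>R tangent u f p + 2 *\<^sub>R tangent u g r = tangent u (f + g) (p + r) + tangent u (f - g) (p - r)"
      unfolding id by simp
    also have "\<dots> \<le> ?L" by (intro add_mono tangent_le_unit_square u fg)
    finally show ?thesis .
  qed
  have "?q f \<le> (1/2) *\<^sub>R (?L - 2 *\<^sub>R tangent u g r)" for r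
  proof (intro unit_square_least u f)
    fix p
    have "(1/2) *\<^sub>R (2 *\<^sub>R tangent u f p) \<le> (1/2) *\<^sub>R (?L - 2 *\<^sub>R tangent u g r)"
      using 2[of p r] by (intro scaleR_left_mono) (auto simp: algebra_simps)
    then show "tangent u f p \<le> (1/2) *\<^sub>R (?L - 2 *\<^sub>R tangent u g r)" by simp
  qed
  then have 3: "2 *\<^sub>R ?q f + 2 *\<^sub>R tangent u g r \<le> ?L" for r
    using scaleR_left_mono[of "?q f" "(1/2) *\<^sub>R (?L - 2 *\<^sub>R tangent u g r)" 2]
    by (fastforce simp: algebra_simps)
  have "?q g \<le> (1/2) *\<^sub>R (?L - 2 *\<^sub>R ?q f)"
  proof (intro unit_square_least u g)
    fix r
    have "(1/2) *\<^sub>R (2 *\<^sub>R tangent u g r) \<le> (1/2) *\<^sub>R (?L - 2 *\<^sub>R ?q f)"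
      using 3[of r] by (intro scaleR_left_mono) (auto simp: algebra_simps)
    then show "tangent u g r \<le> (1/2) *\<^sub>R (?L - 2 *\<^sub>R ?q f)" by simp
  qed
  from scaleR_left_mono[OF this, of 2] show "?R \<le> ?L" by (simp add: algebra_simps)
qed

lemma unit_square_uminus: "unit_square u (- f) = unit_square u f"
proof -
  have t: "tangent u (- f) a = tangent u f (- a)" for a by (simp add: tangent_def)
  have "(\<forall>a. tangent u (- f) a \<le> m) \<longleftrightarrow> (\<forall>a. tangent u f a \<le> m)" for m
    unfolding t by (metis minus_minus)
  then show ?thesis unfolding unit_square_def by simp
qed

text \<open>The inequality of arithmetic and geometric means bounds every tangent. The result
  supplies the local boundedness that makes the product homogeneous over the reals.\<close>

lemma norm_unit_square_le:
  assumes u: "0 \<le> u" and f: "\<bar>f\<bar> \<le> c *\<^sub>R u" "c \<ge> 0"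
  shows "norm (unit_square u f) \<le> c\<^sup>2 * norm u"
proof -
  have b: "unit_bounded u f" using f by (auto simp: unit_bounded_def)
  have "0 \<le> unit_square u f"
    using tangent_le_unit_square[OF u b, of 0] by (simp add: tangent_def)
  moreover have "unit_square u f \<le> c\<^sup>2 *\<^sub>R u"
  proof (intro unit_square_least u b)
    fix a :: real
    have "(2 * a) *\<^sub>R f \<le> (\<bar>2 * a\<bar> * c) *\<^sub>R u" by (rule lattice_scaleR_le_abs_bound[OF f(1)])
    also have "\<dots> \<le> (c\<^sup>2 + a\<^sup>2) *\<^sub>R u"
    proof (intro scaleR_right_mono u)
      have "0 \<le> (\<bar>a\<bar> - c)\<^sup>2" by simp
      then show "\<bar>2 * a\<bar> * c \<le> c\<^sup>2 + a\<^sup>2" by (simp add: power2_diff abs_mult)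
    qed
    finally show "tangent u f a \<le> c\<^sup>2 *\<^sub>R u" by (simp add: tangent_def algebra_simps)
  qed
  ultimately have "norm (unit_square u f) \<le> norm (c\<^sup>2 *\<^sub>R u)" by (rule banach_lattice_norm_mono)
  then show ?thesis by simp
qed

section \<open>Compatibility of the square with lattice homomorphisms\<close>

lemma Sup_fin_hom:
  fixes G :: "'a::lattice \<Rightarrow> 'b::lattice"
  assumes "finite A" "A \<noteq> {}" "x ` A \<subseteq> F"
    and F: "\<And>a b. a \<in> F \<Longrightarrow> b \<in> F \<Longrightarrow> sup a b \<in> F"
    and G: "\<And>a b. a \<in> F \<Longrightarrow> b \<in> F \<Longrightarrow> G (sup a b) = sup (G a) (G b)"
  shows "Sup_fin (x ` A) \<in> F \<and> G (Sup_fin (x ` A)) = Sup_fin ((\<lambda>i. G (x i)) ` A)"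
  using assms(1-3)
proof (induction A rule: finite_ne_induct)
  case (insert a A)
  then show ?case by (simp add: F G)
qed simp

text \<open>\<open>G\<close> is known to preserve finite suprema in \<open>F\<close>, whereas the
  square is an infinite supremum. Finitely many tangents reach it up to
  \<open>e *\<^sub>R u\<close>, an error that \<open>G\<close> leaves unchanged because
  \<open>G u = u\<close>.\<close>

lemma unit_square_hom:
  fixes G :: "'a::banach_lattice \<Rightarrow> 'a"
  assumes u: "0 \<le> u" and f: "unit_bounded u f"
    and lin: "linear G" and mono: "\<And>x y. x \<le> y \<Longrightarrow> G x \<le> G y" and Gu: "G u = u"
    and F: "\<And>a. tangent u f a \<in> F" "\<And>a b. a \<in> F \<Longrightarrow> b \<in> F \<Longrightarrow> sup a b \<in> F"
    and G: "\<And>a b. a \<in> F \<Longrightarrow> b \<in> F \<Longrightarrow> G (sup a b) = sup (G a) (G b)"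
  shows "unit_bounded u (G f)" and "unit_square u (G f) = G (unit_square u f)"
proof -
  interpret linear G by (rule lin)
  obtain c where c: "c \<ge> 0" "\<bar>f\<bar> \<le> c *\<^sub>R u" using f by (auto simp: unit_bounded_def)
  have "\<bar>G f\<bar> \<le> c *\<^sub>R u"
  proof (rule abs_leI)
    show "G f \<le> c *\<^sub>R u" using mono[of f "c *\<^sub>R u"] abs_le_D1[OF c(2)] by (simp add: scaleR Gu)
    show "- G f \<le> c *\<^sub>R u" using mono[of "- f" "c *\<^sub>R u"] abs_le_D2[OF c(2)] by (simp add: scaleR Gu neg)
  qed
  then show b: "unit_bounded u (G f)" using c by (auto simp: unit_bounded_def)
  have Gt: "G (tangent u f a) = tangent u (G f) a" for a
    by (simp add: tangent_def diff scaleR Gu)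
  show "unit_square u (G f) = G (unit_square u f)"
  proof (rule antisym)
    show "unit_square u (G f) \<le> G (unit_square u f)"
      by (intro unit_square_least u b) (simp add: mono tangent_le_unit_square u f flip: Gt)
    show "G (unit_square u f) \<le> unit_square u (G f)"
    proof (rule lattice_archimedean)
      fix e :: real assume "e > 0"
      then obtain A where A: "finite A" "A \<noteq> {}"
        "\<And>a. \<exists>b\<in>A. tangent u f a \<le> tangent u f b + e *\<^sub>R u"
        using tangent_approximable[OF u f] by metis
      let ?S = "Sup_fin (tangent u f ` A)"
      have "unit_square u f \<le> ?S + e *\<^sub>R u"
      proof (intro unit_square_least u f)
        fix a
        obtain b where b: "b \<in> A" "tangent u f a \<le> tangent u f b + e *\<^sub>R u" using A(3) by blast
        have "tangent u f b \<le> ?S" using b A(1) by (intro Sup_fin.coboundedI) auto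
        then show "tangent u f a \<le> ?S + e *\<^sub>R u" using b(2) by (meson add_right_mono order_trans)
      qed
      then have "G (unit_square u f) \<le> G ?S + e *\<^sub>R u"
        using mono by (fastforce simp: add scaleR Gu)
      also have "G ?S = Sup_fin ((\<lambda>a. G (tangent u f a)) ` A)"
        using Sup_fin_hom[OF A(1,2), of "tangent u f" F G] F G by auto
      also have "\<dots> \<le> unit_square u (G f)"
        unfolding Gt using A tangent_le_unit_square[OF u b] by (intro Sup_fin.boundedI) auto
      finally show "G (unit_square u f) \<le> unit_square u (G f) + e *\<^sub>R u" by simp
    qed
  qed
qed

text \<open>Cauchy's functional equation. The defect \<open>e\<close> from linearity vanishes on the
  integers, hence has period 1 and is bounded; a bounded additive function vanishes.\<close>

lemma additive_bounded_imp_scaleR: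
  fixes h :: "real \<Rightarrow> 'a::real_normed_vector"
  assumes add: "\<And>a b. h (a + b) = h a + h b" and bd: "\<And>a. \<bar>a\<bar> \<le> 1 \<Longrightarrow> norm (h a) \<le> K"
  shows "h c = c *\<^sub>R h 1"
proof -
  define e where "e a = h a - a *\<^sub>R h 1" for a
  have eadd: "e (a + b) = e a + e b" for a b by (simp add: e_def add algebra_simps)
  have e0: "e 0 = 0" using eadd[of 0 0] by simp
  have eneg: "e (- a) = - e a" for a using eadd[of a "-a"] e0 by (simp add: eq_neg_iff_add_eq_0 add.commute)
  have en: "e (real n * a) = real n *\<^sub>R e a" for n a
    by (induction n) (auto simp: e0 eadd algebra_simps)
  have e1: "e 1 = 0" by (simp add: e_def)
  have eint: "e (of_int k) = 0" for k
    using en[of _ 1] e1 eneg by (cases k rule: int_cases2) (simp_all add: eneg)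
  have bnd: "norm (e a) \<le> K + norm (h 1)" for a
  proof -
    have "e a = e (frac a) + e (of_int \<lfloor>a\<rfloor>)" by (simp add: frac_def flip: eadd)
    then have "e a = e (frac a)" by (simp add: eint)
    also have "norm \<dots> \<le> norm (h (frac a)) + norm (frac a *\<^sub>R h 1)"
      unfolding e_def by (rule norm_triangle_ineq4)
    also have "\<dots> \<le> K + norm (h 1)"
      using frac_lt_1[of a] frac_ge_0[of a]
      by (intro add_mono bd) (auto intro: mult_left_le_one_le)
    finally show ?thesis .
  qed
  have "norm (e c) = 0"
  proof (rule ccontr)
    assume "norm (e c) \<noteq> 0"
    then have "norm (e c) > 0" by simp
    then obtain n where "real n * norm (e c) > K + norm (h 1)"
      using reals_Archimedean3 by blast
    then show False using bnd[of "real n * c"] by (simp add: en)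
  qed
  then show ?thesis by (simp add: e_def)
qed

section \<open>The product obtained from the square by polarization\<close>

definition unit_product :: "'a::banach_lattice \<Rightarrow> 'a \<Rightarrow> 'a \<Rightarrow> 'a"
  where "unit_product u f g = (1/4) *\<^sub>R (unit_square u (f + g) - unit_square u (f - g))"

lemma unit_product_commute: "unit_product u f g = unit_product u g f"
  using unit_square_uminus[of u "f - g"] by (simp add: unit_product_def add.commute)

text \<open>The Jordan-von Neumann argument: additivity of the polarized form follows from the
  parallelogram law.\<close>

lemma unit_product_add_left:
  assumes u: "0 \<le> u" and x: "unit_bounded u x" and y: "unit_bounded u y" and z: "unit_bounded u z"
  shows "unit_product u (x + y) z = unit_product u x z + unit_product u y z"
proof -
  let ?q = "unit_square u"
  \<comment> \<open>The sum of the parallelogram laws for \<open>x + w\<close>, \<open>y\<close> and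
    for \<open>y + w\<close>, \<open>x\<close>. Subtracting the case \<open>w = - z\<close> from the
    case \<open>w = z\<close> removes the terms without \<open>w\<close>, and the last two terms
    cancel because the square is even.\<close>
  have dbl: "2 *\<^sub>R ?q (x + y + w) = 2 *\<^sub>R ?q x + 2 *\<^sub>R ?q y + 2 *\<^sub>R ?q (x + w) + 2 *\<^sub>R ?q (y + w)
      - ?q (x + w - y) - ?q (y + w - x)" if w: "unit_bounded u w" for w
  proof -
    have eq1: "x + w + y = x + y + w" and eq2: "y + w + x = x + y + w" by (simp_all add: algebra_simps)
    have "?q (x + w + y) + ?q (x + w - y) = 2 *\<^sub>R ?q (x + w) + 2 *\<^sub>R ?q y"
      by (intro unit_square_parallelogram u unit_bounded_intros x y w)
    moreover have "?q (y + w + x) + ?q (y + w - x) = 2 *\<^sub>R ?q (y + w) + 2 *\<^sub>R ?q x"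
      by (intro unit_square_parallelogram u unit_bounded_intros x y w)
    ultimately have 1: "?q (x + y + w) + ?q (x + w - y) = 2 *\<^sub>R ?q (x + w) + 2 *\<^sub>R ?q y"
      and 2: "?q (x + y + w) + ?q (y + w - x) = 2 *\<^sub>R ?q (y + w) + 2 *\<^sub>R ?q x"
      by (simp_all only: eq1 eq2)
    have aux: "2 *\<^sub>R A = 2 *\<^sub>R X + 2 *\<^sub>R Y + 2 *\<^sub>R C + 2 *\<^sub>R D - K - L"
      if "A + K = 2 *\<^sub>R C + 2 *\<^sub>R Y" "A + L = 2 *\<^sub>R D + 2 *\<^sub>R X" for A K L C D X Y :: 'a
    proof -
      have "2 *\<^sub>R A = (A + K) + (A + L) - K - L" by (simp add: scaleR_2)
      then show ?thesis unfolding that by (simp add: algebra_simps)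
    qed
    show ?thesis by (rule aux[OF 1 2])
  qed
  have m1: "?q (x - z - y) = ?q (y + z - x)" and m2: "?q (y - z - x) = ?q (x + z - y)"
    using unit_square_uminus[of u "y + z - x"] unit_square_uminus[of u "x + z - y"]
    by (simp_all add: algebra_simps)
  have "2 *\<^sub>R ?q (x + y + z) - 2 *\<^sub>R ?q (x + y - z)
      = 2 *\<^sub>R ?q (x + z) + 2 *\<^sub>R ?q (y + z) - 2 *\<^sub>R ?q (x - z) - 2 *\<^sub>R ?q (y - z)"
    using dbl[OF z] dbl[OF unit_bounded_uminus[OF z]] m1 m2 by simp
  then have "2 *\<^sub>R (?q (x + y + z) - ?q (x + y - z))
      = 2 *\<^sub>R (?q (x + z) + ?q (y + z) - ?q (x - z) - ?q (y - z))"
    by (simp add: algebra_simps)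
  then have *: "?q (x + y + z) - ?q (x + y - z) = ?q (x + z) + ?q (y + z) - ?q (x - z) - ?q (y - z)"
    by (simp del: scaleR_2)
  show ?thesis
    unfolding unit_product_def scaleR_add_right[symmetric] * by (rule arg_cong) (simp add: algebra_simps)
qed

text \<open>Additivity alone gives only rational homogeneity; the norm bound for
  \<open>\<bar>r\<bar> \<le> 1\<close> excludes wild additive functions.\<close>

lemma unit_product_scaleR_left:
  assumes u: "0 \<le> u" and x: "unit_bounded u x" and z: "unit_bounded u z"
  shows "unit_product u (c *\<^sub>R x) z = c *\<^sub>R unit_product u x z"
proof -
  obtain a b where ab: "a \<ge> 0" "\<bar>x\<bar> \<le> a *\<^sub>R u" "b \<ge> 0" "\<bar>z\<bar> \<le> b *\<^sub>R u"
    using x z by (auto simp: unit_bounded_def)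
  define h where "h r = unit_product u (r *\<^sub>R x) z" for r
  have "h c = c *\<^sub>R h 1"
  proof (rule additive_bounded_imp_scaleR)
    show "h (p + q) = h p + h q" for p q
      unfolding h_def scaleR_add_left by (intro unit_product_add_left u unit_bounded_intros x z)
    fix r :: real assume r: "\<bar>r\<bar> \<le> 1"
    have rx: "\<bar>r *\<^sub>R x\<bar> \<le> a *\<^sub>R u"
    proof -
      have "\<bar>r *\<^sub>R x\<bar> = \<bar>r\<bar> *\<^sub>R \<bar>x\<bar>" by (rule lattice_abs_scaleR)
      also have "\<dots> \<le> 1 *\<^sub>R \<bar>x\<bar>" using r by (intro scaleR_right_mono) auto
      finally show ?thesis using ab(2) by simp
    qed
    have "norm (unit_square u (r *\<^sub>R x + z)) \<le> (a + b)\<^sup>2 * norm u"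
      using ab rx by (intro norm_unit_square_le u)
        (auto simp: scaleR_add_left intro: order_trans[OF abs_triangle_ineq] add_mono)
    moreover have "norm (unit_square u (r *\<^sub>R x - z)) \<le> (a + b)\<^sup>2 * norm u"
      using ab rx by (intro norm_unit_square_le u)
        (auto simp: scaleR_add_left intro: order_trans[OF abs_triangle_ineq4] add_mono)
    ultimately have "norm (unit_square u (r *\<^sub>R x + z) - unit_square u (r *\<^sub>R x - z)) \<le> 2 * (a + b)\<^sup>2 * norm u"
      using norm_triangle_ineq4[of "unit_square u (r *\<^sub>R x + z)" "unit_square u (r *\<^sub>R x - z)"] by linarith
    moreover have "0 \<le> (a + b)\<^sup>2 * norm u" by simp
    moreover have "norm (h r) = 1/4 * norm (unit_square u (r *\<^sub>R x + z) - unit_square u (r *\<^sub>R x - z))"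
      by (simp add: h_def unit_product_def)
    ultimately show "norm (h r) \<le> (a + b)\<^sup>2 * norm u" by linarith
  qed
  then show ?thesis by (simp add: h_def)
qed

lemma unit_square_add:
  assumes "0 \<le> u" "unit_bounded u f" "unit_bounded u g"
  shows "unit_square u (f + g) = unit_square u f + unit_square u g + 2 *\<^sub>R unit_product u f g"
proof -
  let ?p = "unit_square u (f + g)" and ?m = "unit_square u (f - g)"
  have "2 *\<^sub>R unit_product u f g = (1/2) *\<^sub>R (?p + ?p) - (1/2) *\<^sub>R (?p + ?m)"
    by (simp add: unit_product_def algebra_simps)
  also have "\<dots> = ?p - unit_square u f - unit_square u g"
    unfolding unit_square_parallelogram[OF assms] by (simp add: algebra_simps flip: scaleR_2)
  finally show ?thesis by simp
qed

section \<open>Irreducible semigroups on a real Banach lattice\<close>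

definition real_ideal :: "'a::banach_lattice set \<Rightarrow> bool"
  where "real_ideal I \<longleftrightarrow> 0 \<in> I \<and> (\<forall>x\<in>I. \<forall>y\<in>I. x + y \<in> I) \<and> (\<forall>c. \<forall>x\<in>I. c *\<^sub>R x \<in> I) \<and>
    (\<forall>x\<in>I. \<forall>y. \<bar>y\<bar> \<le> \<bar>x\<bar> \<longrightarrow> y \<in> I)"

text \<open>By this formula a linear map that preserves moduli also preserves binary
  suprema.\<close>

lemma lattice_sup_eq: "sup a b = (1/2) *\<^sub>R (a + b + \<bar>a - b\<bar>)" for a b :: "'a::banach_lattice"
proof -
  have "sup a b = b + pprt (a - b)"
    by (simp add: pprt_def add_sup_distrib_left)
  moreover have "2 *\<^sub>R pprt (a - b) = (a - b) + \<bar>a - b\<bar>"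
    using prts[of "a - b"] abs_prts[of "a - b"] by (simp only: scaleR_2) (simp add: algebra_simps)
  then have "(1/2) *\<^sub>R (2 *\<^sub>R pprt (a - b)) = (1/2) *\<^sub>R ((a - b) + \<bar>a - b\<bar>)" by simp
  then have "pprt (a - b) = (1/2) *\<^sub>R ((a - b) + \<bar>a - b\<bar>)" by simp
  ultimately have "sup a b = b + (1/2) *\<^sub>R ((a - b) + \<bar>a - b\<bar>)" by simp
  also have "\<dots> = (1/2) *\<^sub>R (2 *\<^sub>R b + ((a - b) + \<bar>a - b\<bar>))" by (simp only: scaleR_add_right) simp
  also have "2 *\<^sub>R b + ((a - b) + \<bar>a - b\<bar>) = a + b + \<bar>a - b\<bar>" by (simp add: scaleR_2)
  finally show ?thesis .
qed

lemma inf_pprt_pprt_uminus: "inf (sup d 0) (sup (- d) 0) = (0::'a::banach_lattice)"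
proof -
  have "sup d 0 - sup (- d) 0 = d"
    using prts[of d] pprt_neg[of d] by (simp add: pprt_def algebra_simps)
  moreover have "sup d 0 - inf (sup d 0) (sup (- d) 0) = sup (sup d 0 - sup d 0) (sup d 0 - sup (- d) 0)"
    by (simp only: diff_inf_eq_sup add_sup_distrib_left add_uminus_conv_diff)
  ultimately have "sup d 0 - inf (sup d 0) (sup (- d) 0) = sup d 0 - 0"
    by (simp only: diff_self sup.commute[of 0 d] diff_0_right)
  then show ?thesis by (rule diff_left_imp_eq)
qed

lemma disjoint_scaleR:
  fixes v u :: "'a::banach_lattice"
  assumes "0 \<le> v" "0 \<le> u" "inf v u = 0" "0 \<le> c"
  shows "inf v (c *\<^sub>R u) = 0"
proof (rule antisym)
  show "0 \<le> inf v (c *\<^sub>R u)" using assms by (simp add: scaleR_nonneg_nonneg)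
  define m where "m = inf v (c *\<^sub>R u)"
  \<comment> \<open>With this factor both \<open>k\<close> and \<open>k * c\<close> are at most 1,
    so \<open>k *\<^sub>R m\<close> lies below \<open>v\<close> and below \<open>u\<close>.\<close>
  define k where "k = inverse (max 1 c)"
  have k: "0 < k" "k \<le> 1" "k * c \<le> 1" using assms(4) by (auto simp: k_def field_simps max_def)
  have "k *\<^sub>R m \<le> k *\<^sub>R v" unfolding m_def using k by (intro scaleR_left_mono) auto
  also have "\<dots> \<le> 1 *\<^sub>R v" using k assms by (intro scaleR_right_mono) auto
  finally have 1: "k *\<^sub>R m \<le> v" by simp
  have "k *\<^sub>R m \<le> k *\<^sub>R (c *\<^sub>R u)" unfolding m_def using k by (intro scaleR_left_mono) auto
  also have "\<dots> = (k * c) *\<^sub>R u" by simp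
  also have "\<dots> \<le> 1 *\<^sub>R u" using k assms by (intro scaleR_right_mono) auto
  finally have "k *\<^sub>R m \<le> inf v u" using 1 by simp
  then have "k *\<^sub>R m \<le> k *\<^sub>R 0" using assms(3) by simp
  then show "inf v (c *\<^sub>R u) \<le> 0" using k(1) unfolding m_def by (rule lattice_half_le)
qed

text \<open>Dirichlet's simultaneous approximation brings all \<open>b i * \<tau> n\<close> close to
  integer multiples of \<open>2 * pi\<close> along one sequence of times.\<close>

lemma simultaneous_return_times:
  fixes b :: "nat \<Rightarrow> real" and T :: real
  obtains \<tau> :: "nat \<Rightarrow> real" where "\<And>n. \<tau> n \<ge> T" "filterlim \<tau> at_top sequentially"
    "\<And>i. i < m \<Longrightarrow> (\<lambda>n. cos (b i * \<tau> n)) \<longlonglongrightarrow> 1" "\<And>i. i < m \<Longrightarrow> (\<lambda>n. sin (b i * \<tau> n)) \<longlonglongrightarrow> 0"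
proof -
  \<comment> \<open>Dirichlet's theorem yields some \<open>q n > 0\<close>, possibly a bounded
    sequence. Approximating multiples of \<open>b i * M n\<close> makes the times
    \<open>q n * M n\<close> tend to infinity all the same.\<close>
  define M where "M n = real (Suc n + nat \<lceil>T\<rceil>)" for n
  have M: "M n \<ge> T" "M n \<ge> real n" "M n > 0" for n by (auto simp: M_def) linarith
  have "\<exists>q p. 0 < q \<and> (\<forall>i<m. \<bar>of_int q * (b i * M n / (2 * pi)) - of_int (p i)\<bar> < 1 / real (Suc n))" for n
    using Dirichlet_approx_simult[of "Suc n" m "\<lambda>i. b i * M n / (2 * pi)"] by (metis zero_less_Suc)
  then obtain q :: "nat \<Rightarrow> int" and p :: "nat \<Rightarrow> nat \<Rightarrow> int" where q: "\<And>n. 0 < q n"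
    and qp: "\<And>n i. i < m \<Longrightarrow> \<bar>of_int (q n) * (b i * M n / (2 * pi)) - of_int (p n i)\<bar> < 1 / real (Suc n)"
    by metis
  define \<tau> where "\<tau> n = of_int (q n) * M n" for n
  have \<tau>M: "\<tau> n \<ge> M n" for n
    using q[of n] M(3)[of n] by (simp add: \<tau>_def)
  have small: "(\<lambda>n. 2 * pi * (of_int (q n) * (b i * M n / (2 * pi)) - of_int (p n i))) \<longlonglongrightarrow> 0" if "i < m" for i
  proof (rule Lim_null_comparison)
    show "\<forall>\<^sub>F n in sequentially. norm (2 * pi * (of_int (q n) * (b i * M n / (2 * pi)) - of_int (p n i)))
        \<le> 2 * pi * inverse (real (Suc n))"
    proof (intro always_eventually allI)
      fix n
      have "\<bar>of_int (q n) * (b i * M n / (2 * pi)) - of_int (p n i)\<bar> \<le> inverse (real (Suc n))"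
        using qp[OF that, of n] by (simp add: inverse_eq_divide)
      then show "norm (2 * pi * (of_int (q n) * (b i * M n / (2 * pi)) - of_int (p n i)))
        \<le> 2 * pi * inverse (real (Suc n))"
        unfolding real_norm_def abs_mult by (intro mult_mono) auto
    qed
    show "(\<lambda>n. 2 * pi * inverse (real (Suc n))) \<longlonglongrightarrow> 0"
      using tendsto_mult_right_zero[OF LIMSEQ_inverse_real_of_nat] .
  qed
  have arg: "b i * \<tau> n = 2 * pi * (of_int (q n) * (b i * M n / (2 * pi)) - of_int (p n i)) + of_int (p n i) * (2 * pi)" for i n
    by (simp add: \<tau>_def field_simps)
  have c: "cos (x + of_int k * (2 * pi)) = cos x" and s: "sin (x + of_int k * (2 * pi)) = sin x" for x k
    using sin_cos_eq_iff[of "x + of_int k * (2 * pi)" x] by (auto simp: mult.commute mult.left_commute)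
  show thesis
  proof
    show "\<tau> n \<ge> T" for n using \<tau>M[of n] M(1)[of n] by linarith
    have "real n \<le> \<tau> n" for n using \<tau>M[of n] M(2)[of n] by linarith
    then show "filterlim \<tau> at_top sequentially"
      by (intro filterlim_at_top_mono[OF filterlim_real_sequentially]) auto
    show "(\<lambda>n. cos (b i * \<tau> n)) \<longlonglongrightarrow> 1" if "i < m" for i
      using tendsto_cos[OF small[OF that]] unfolding arg c by simp
    show "(\<lambda>n. sin (b i * \<tau> n)) \<longlonglongrightarrow> 0" if "i < m" for i
      using tendsto_sin[OF small[OF that]] unfolding arg s by simp
  qed
qed

text \<open>The projection \<open>P\<close> plays the role of a strictly positive invariant functional.\<close>

locale irreducible_lattice_semigroup =
  fixes G :: "real \<Rightarrow> 'a::banach_lattice \<Rightarrow> 'a" and P :: "'a \<Rightarrow> 'a" and t\<^sub>0 :: real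
  assumes t0: "0 \<le> t\<^sub>0"
    and bounded_linear_G: "t \<ge> t\<^sub>0 \<Longrightarrow> bounded_linear (G t)"
    and G_add: "s \<ge> t\<^sub>0 \<Longrightarrow> t \<ge> t\<^sub>0 \<Longrightarrow> G (s + t) x = G s (G t x)"
    and G_nonneg: "t \<ge> t\<^sub>0 \<Longrightarrow> 0 \<le> x \<Longrightarrow> 0 \<le> G t x"
    and bounded_linear_P: "bounded_linear P"
    and P_nonneg: "0 \<le> x \<Longrightarrow> 0 \<le> P x"
    and P_G: "t \<ge> t\<^sub>0 \<Longrightarrow> P (G t x) = P x"
    and P_strict: "0 \<le> x \<Longrightarrow> P x = 0 \<Longrightarrow> x = 0"
    and irreducible: "closed I \<Longrightarrow> real_ideal I \<Longrightarrow> (\<And>t x. t \<ge> t\<^sub>0 \<Longrightarrow> x \<in> I \<Longrightarrow> G t x \<in> I)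
      \<Longrightarrow> I = {0} \<or> I = UNIV"
begin

section \<open>Fixed vectors of an irreducible positive semigroup\<close>

lemma linear_G: "t \<ge> t\<^sub>0 \<Longrightarrow> linear (G t)"
  using bounded_linear_G bounded_linear.linear by blast

lemmas G_simps = linear_add[OF linear_G] linear_diff[OF linear_G] linear_neg[OF linear_G]
  linear_cmul[OF linear_G] linear_0[OF linear_G]

lemma linear_P: "linear P"
  using bounded_linear_P bounded_linear.linear by blast

lemmas P_simps = linear_add[OF linear_P] linear_diff[OF linear_P] linear_0[OF linear_P]

lemma G_mono: "t \<ge> t\<^sub>0 \<Longrightarrow> x \<le> y \<Longrightarrow> G t x \<le> G t y"
  using G_nonneg[of t "y - x"] by (simp add: G_simps)

lemma P_mono: "x \<le> y \<Longrightarrow> P x \<le> P y"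
  using P_nonneg[of "y - x"] by (simp add: P_simps)

lemma abs_G_le: "t \<ge> t\<^sub>0 \<Longrightarrow> \<bar>G t x\<bar> \<le> G t \<bar>x\<bar>"
  using G_mono[OF _ abs_ge_self, of t x] G_mono[OF _ abs_ge_minus_self, of t x]
  by (auto intro!: abs_leI simp: G_simps)

lemma eq_of_P_le:
  assumes "x \<le> y" "P y \<le> P x"
  shows "y = x"
proof -
  have "P (y - x) \<le> 0" "0 \<le> P (y - x)" using assms P_nonneg[of "y - x"] by (simp_all add: P_simps)
  then show ?thesis using P_strict[of "y - x"] assms by auto
qed

lemma fixed_of_le: "t \<ge> t\<^sub>0 \<Longrightarrow> x \<le> G t x \<Longrightarrow> G t x = x"
  by (rule eq_of_P_le) (simp_all add: P_G)

text \<open>A nonzero positive fixed vector is a quasi-interior point: its principal ideal is dense.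
  The closure of that ideal is invariant because \<open>u\<close> is fixed, so irreducibility makes
  it the whole space.\<close>

lemma quasi_interior:
  assumes u: "0 \<le> u" "u \<noteq> 0" and fixed: "\<And>t. t \<ge> t\<^sub>0 \<Longrightarrow> G t u = u" and e: "e > 0"
  shows "\<exists>c\<ge>0. norm (pprt (\<bar>x\<bar> - c *\<^sub>R u)) < e"
proof -
  \<comment> \<open>The closure of the principal ideal of \<open>u\<close>, described by the part of
    \<open>\<bar>x\<bar>\<close> that exceeds a multiple of \<open>u\<close>.\<close>
  define I where "I = {x. \<forall>e>0. \<exists>c\<ge>0. norm (pprt (\<bar>x\<bar> - c *\<^sub>R u)) < e}"
  have I_D: "\<exists>c\<ge>0. norm (pprt (\<bar>x\<bar> - c *\<^sub>R u)) < e" if "x \<in> I" "e > 0" for x e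
    using that by (simp add: I_def)
  have sub: "pprt (x + y) \<le> pprt x + pprt y" for x y :: 'a
    by (auto simp: pprt_def intro: add_mono add_nonneg_nonneg)
  \<comment> \<open>Proved for a general bounded operator \<open>H\<close>: the identity gives
    solidity, and \<open>G t\<close> gives invariance.\<close>
  have I_of_le: "y \<in> I" if x: "x \<in> I" and le: "\<And>c. c \<ge> 0 \<Longrightarrow> pprt (\<bar>y\<bar> - c *\<^sub>R u) \<le> H (pprt (\<bar>x\<bar> - c *\<^sub>R u))"
    and H: "bounded_linear H" for x y H
  proof -
    obtain K where K: "K > 0" "\<And>x. norm (H x) \<le> norm x * K"
      using bounded_linear.pos_bounded[OF H] by blast
    have "\<exists>c\<ge>0. norm (pprt (\<bar>y\<bar> - c *\<^sub>R u)) < e" if "e > 0" for e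
    proof -
      obtain c where c: "c \<ge> 0" "norm (pprt (\<bar>x\<bar> - c *\<^sub>R u)) < e / K"
        using I_D[OF x, of "e / K"] \<open>e > 0\<close> K(1) by auto
      have "norm (pprt (\<bar>y\<bar> - c *\<^sub>R u)) \<le> norm (H (pprt (\<bar>x\<bar> - c *\<^sub>R u)))"
        using le[OF c(1)] by (intro banach_lattice_norm_mono) auto
      also have "\<dots> \<le> norm (pprt (\<bar>x\<bar> - c *\<^sub>R u)) * K" by (rule K)
      also have "\<dots> < e" using c(2) K(1) by (simp add: field_simps)
      finally show ?thesis using c(1) by blast
    qed
    then show ?thesis by (simp add: I_def)
  qed
  have solid: "y \<in> I" if "x \<in> I" "\<bar>y\<bar> \<le> \<bar>x\<bar>" for x y
    using that by (intro I_of_le[of x y "\<lambda>x. x"]) (auto intro!: pprt_mono bounded_linear_ident)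
  have add: "x + y \<in> I" if x: "x \<in> I" and y: "y \<in> I" for x y
  proof -
    have "\<exists>c\<ge>0. norm (pprt (\<bar>x + y\<bar> - c *\<^sub>R u)) < e" if "e > 0" for e
    proof -
      obtain c where c: "c \<ge> 0" "norm (pprt (\<bar>x\<bar> - c *\<^sub>R u)) < e / 2"
        using I_D[OF x, of "e / 2"] \<open>e > 0\<close> by auto
      obtain d where d: "d \<ge> 0" "norm (pprt (\<bar>y\<bar> - d *\<^sub>R u)) < e / 2"
        using I_D[OF y, of "e / 2"] \<open>e > 0\<close> by auto
      have "pprt (\<bar>x + y\<bar> - (c + d) *\<^sub>R u) \<le> pprt ((\<bar>x\<bar> - c *\<^sub>R u) + (\<bar>y\<bar> - d *\<^sub>R u))"
        using abs_triangle_ineq[of x y] by (intro pprt_mono) (simp add: algebra_simps)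
      also have "\<dots> \<le> pprt (\<bar>x\<bar> - c *\<^sub>R u) + pprt (\<bar>y\<bar> - d *\<^sub>R u)" by (rule sub)
      finally have "norm (pprt (\<bar>x + y\<bar> - (c + d) *\<^sub>R u)) \<le> norm (pprt (\<bar>x\<bar> - c *\<^sub>R u) + pprt (\<bar>y\<bar> - d *\<^sub>R u))"
        by (intro banach_lattice_norm_mono) auto
      also have "\<dots> < e" using c d norm_triangle_ineq[of "pprt (\<bar>x\<bar> - c *\<^sub>R u)" "pprt (\<bar>y\<bar> - d *\<^sub>R u)"] by linarith
      finally show ?thesis using c d by (intro exI[of _ "c + d"]) auto
    qed
    then show ?thesis by (simp add: I_def)
  qed
  have zero: "0 \<in> I" by (auto simp: I_def intro!: exI[of _ 0])
  have scale: "r *\<^sub>R x \<in> I" if x: "x \<in> I" for r x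
  proof -
    have nat: "real n *\<^sub>R x \<in> I" for n
      by (induction n) (auto simp: zero scaleR_add_left intro: add x)
    obtain n :: nat where "\<bar>r\<bar> \<le> real n" using real_arch_simple by blast
    then have "\<bar>r *\<^sub>R x\<bar> \<le> \<bar>real n *\<^sub>R x\<bar>" by (auto simp: lattice_abs_scaleR intro: scaleR_right_mono)
    then show ?thesis using solid nat by blast
  qed
  have "closed I"
    unfolding closed_sequential_limits
  proof (intro allI impI, elim conjE)
    fix X x assume X: "\<forall>n. X n \<in> I" "X \<longlonglongrightarrow> x"
    have "\<exists>c\<ge>0. norm (pprt (\<bar>x\<bar> - c *\<^sub>R u)) < e" if "e > 0" for e
    proof -
      obtain n where n: "norm (X n - x) < e / 2"
        using LIMSEQ_D[OF X(2), of "e/2"] \<open>e > 0\<close> by auto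
      obtain c where c: "c \<ge> 0" "norm (pprt (\<bar>X n\<bar> - c *\<^sub>R u)) < e / 2"
        using I_D[of "X n" "e / 2"] X(1) \<open>e > 0\<close> by auto
      have "pprt (\<bar>x\<bar> - c *\<^sub>R u) \<le> pprt (\<bar>x - X n\<bar> + (\<bar>X n\<bar> - c *\<^sub>R u))"
        using abs_triangle_ineq[of "x - X n" "X n"] by (intro pprt_mono) (simp add: algebra_simps)
      also have "\<dots> \<le> pprt \<bar>x - X n\<bar> + pprt (\<bar>X n\<bar> - c *\<^sub>R u)" by (rule sub)
      finally have "norm (pprt (\<bar>x\<bar> - c *\<^sub>R u)) \<le> norm (\<bar>x - X n\<bar> + pprt (\<bar>X n\<bar> - c *\<^sub>R u))"
        by (intro banach_lattice_norm_mono) auto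
      also have "\<dots> \<le> norm (X n - x) + norm (pprt (\<bar>X n\<bar> - c *\<^sub>R u))"
        using norm_triangle_ineq[of "\<bar>x - X n\<bar>" "pprt (\<bar>X n\<bar> - c *\<^sub>R u)"]
        by (simp add: banach_lattice_norm_abs norm_minus_commute)
      finally show ?thesis using c n by (intro exI[of _ c]) auto
    qed
    then show "x \<in> I" by (simp add: I_def)
  qed
  moreover have "real_ideal I"
    unfolding real_ideal_def using zero add scale solid by blast
  moreover have "G t x \<in> I" if t: "t \<ge> t\<^sub>0" and x: "x \<in> I" for t x
  proof (rule I_of_le[OF x _ bounded_linear_G[OF t]])
    fix c :: real assume "c \<ge> 0"
    \<comment> \<open>Since \<open>G t u = u\<close>, the excess of the image is dominated by the
      image of the excess.\<close>
    have "\<bar>G t x\<bar> - c *\<^sub>R u \<le> G t (\<bar>x\<bar> - c *\<^sub>R u)"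
      using abs_G_le[OF t, of x] by (simp add: G_simps t fixed)
    also have "\<dots> \<le> G t (pprt (\<bar>x\<bar> - c *\<^sub>R u))"
      by (intro G_mono t) (simp add: pprt_def)
    finally show "pprt (\<bar>G t x\<bar> - c *\<^sub>R u) \<le> G t (pprt (\<bar>x\<bar> - c *\<^sub>R u))"
      using G_nonneg[OF t zero_le_pprt] by (simp add: pprt_def)
  qed
  ultimately have "I = {0} \<or> I = UNIV" by (rule irreducible)
  moreover have "u \<in> I" using u by (auto simp: I_def intro!: exI[of _ 1])
  ultimately have "x \<in> I" using u(2) by auto
  then show ?thesis using e by (simp add: I_def)
qed

text \<open>Disjointness from \<open>u\<close> persists for its multiples, so the excess of
  \<open>v\<close> over \<open>c *\<^sub>R u\<close> is \<open>v\<close> itself and cannot be made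
  small unless \<open>v = 0\<close>.\<close>

lemma disjoint_from_fixed:
  assumes u: "0 \<le> u" "u \<noteq> 0" and fixed: "\<And>t. t \<ge> t\<^sub>0 \<Longrightarrow> G t u = u"
    and v: "0 \<le> v" "inf v u = 0"
  shows "v = 0"
proof (rule ccontr)
  assume "v \<noteq> 0"
  then obtain c where c: "c \<ge> 0" "norm (pprt (\<bar>v\<bar> - c *\<^sub>R u)) < norm v"
    using quasi_interior[OF u fixed, of "norm v" v] by auto
  have "sup (v - c *\<^sub>R u) 0 = v - inf v (c *\<^sub>R u)"
    by (simp add: diff_inf_eq_sup add_sup_distrib_left sup.commute)
  then have "pprt (\<bar>v\<bar> - c *\<^sub>R u) = v"
    using disjoint_scaleR[OF v(1) u(1) v(2) c(1)] v(1) by (simp add: pprt_def)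
  then show False using c(2) by simp
qed

text \<open>The positive part of \<open>v - c *\<^sub>R u\<close> is fixed and the negative part is
  disjoint from it, so one of them vanishes. Hence \<open>v\<close> is comparable with every
  multiple of \<open>u\<close>, and the comparison defines a cut of the reals.\<close>

lemma fixed_space_one_dimensional:
  assumes u: "0 \<le> u" "u \<noteq> 0" and fu: "\<And>t. t \<ge> t\<^sub>0 \<Longrightarrow> G t u = u"
    and v: "0 \<le> v" and fv: "\<And>t. t \<ge> t\<^sub>0 \<Longrightarrow> G t v = v"
  shows "\<exists>c\<ge>0. v = c *\<^sub>R u"
proof -
  have total: "c *\<^sub>R u \<le> v \<or> v \<le> c *\<^sub>R u" for c
  proof -
    define d where "d = v - c *\<^sub>R u"
    have Gd: "G t d = d" if "t \<ge> t\<^sub>0" for t using that by (simp add: d_def G_simps fu fv)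
    have fixed_pos: "G t (sup w 0) = sup w 0" if "t \<ge> t\<^sub>0" "G t w = w" for t w
      using G_mono[of t w "sup w 0"] G_nonneg[of t "sup w 0"] that by (intro fixed_of_le) auto
    have p: "G t (sup d 0) = sup d 0" if "t \<ge> t\<^sub>0" for t using fixed_pos Gd that by blast
    show ?thesis
    proof (cases "sup d 0 = 0")
      case True
      then have "d \<le> 0" by (metis sup.cobounded1)
      then show ?thesis by (simp add: d_def)
    next
      case False
      then have "sup (- d) 0 = 0"
        using disjoint_from_fixed[of "sup d 0" "sup (- d) 0"] p inf_pprt_pprt_uminus[of d]
        by (simp add: inf.commute)
      then have "- d \<le> 0" by (metis sup.cobounded1)
      then show ?thesis by (simp add: d_def)
    qed
  qed
  \<comment> \<open>The lower part of the cut. It is bounded because the norm is monotone, and its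
    supremum is the factor sought.\<close>
  define C where "C = {c. c \<ge> 0 \<and> c *\<^sub>R u \<le> v}"
  define s where "s = Sup C"
  have C0: "0 \<in> C" using v by (simp add: C_def)
  have nu: "norm u > 0" using u(2) by simp
  have "c \<le> norm v / norm u" if "c \<in> C" for c
  proof -
    have "norm (c *\<^sub>R u) \<le> norm v"
      using that u(1) by (intro banach_lattice_norm_mono) (auto simp: C_def scaleR_nonneg_nonneg)
    then show ?thesis using that nu by (simp add: C_def field_simps)
  qed
  then have bdd: "bdd_above C" by (rule bdd_aboveI)
  have s0: "s \<ge> 0" unfolding s_def by (rule cSup_upper[OF C0 bdd])
  have "s *\<^sub>R u \<le> v"
  proof (rule lattice_archimedean)
    fix e :: real assume "e > 0"
    then obtain c where c: "c \<in> C" "s - e < c"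
      using less_cSup_iff[of C "s - e"] C0 bdd unfolding s_def by auto
    have "(s - e) *\<^sub>R u \<le> c *\<^sub>R u" using c u(1) by (intro scaleR_right_mono) auto
    also have "\<dots> \<le> v" using c by (simp add: C_def)
    finally show "s *\<^sub>R u \<le> v + e *\<^sub>R u" by (simp add: algebra_simps)
  qed
  moreover have "v \<le> s *\<^sub>R u"
  proof (rule lattice_archimedean)
    fix e :: real assume e: "e > 0"
    then have "s + e \<notin> C" using cSup_upper[OF _ bdd, of "s + e"] by (auto simp: s_def)
    then have "\<not> (s + e) *\<^sub>R u \<le> v" using e s0 by (simp add: C_def)
    then show "v \<le> s *\<^sub>R u + e *\<^sub>R u" using total[of "s + e"] by (simp add: scaleR_add_left)
  qed
  ultimately have "v = s *\<^sub>R u" by (intro antisym)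
  then show ?thesis using s0 by blast
qed

end

section \<open>Products of complex vectors whose modulus is the unit\<close>

lemma unit_product_bilinear:
  assumes u: "0 \<le> u" and f: "unit_bounded u f" and g: "unit_bounded u g" and h: "unit_bounded u h" and k: "unit_bounded u k"
  shows "unit_product u (a *\<^sub>R f + b *\<^sub>R g) (c *\<^sub>R h + d *\<^sub>R k)
    = (a * c) *\<^sub>R unit_product u f h + (a * d) *\<^sub>R unit_product u f k
      + (b * c) *\<^sub>R unit_product u g h + (b * d) *\<^sub>R unit_product u g k"
proof -
  have right: "unit_product u x (c *\<^sub>R h + d *\<^sub>R k) = c *\<^sub>R unit_product u x h + d *\<^sub>R unit_product u x k"
    if x: "unit_bounded u x" for x
    unfolding unit_product_commute[of u x]
    by (simp add: unit_product_add_left unit_product_scaleR_left u h k x unit_bounded_scaleR)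
  show ?thesis
    by (simp add: unit_product_add_left unit_product_scaleR_left right u f g h k unit_bounded_scaleR
        unit_bounded_add scaleR_add_right mult.commute)
qed

text \<open>For functions and \<open>u = 1\<close> this reads \<open>x^2 + y^2 \<le> 1\<close>. Two
  tangents with parameters in polar form add up to \<open>2 * r\<close> times a rotation of
  \<open>z\<close> minus \<open>r\<^sup>2 *\<^sub>R u\<close>, and
  \<open>2 * r \<le> 1 + r\<^sup>2\<close> bounds this by \<open>u\<close>.\<close>

lemma unit_square_cartesian_le:
  assumes z: "modulus z \<le> u"
  shows "unit_square u (re z) + unit_square u (im z) \<le> u"
proof -
  have u: "0 \<le> u" using modulus_nonneg z by (rule order_trans)
  have f: "unit_bounded u (re z)" and g: "unit_bounded u (im z)"
    using order_trans[OF re_le_modulus z] order_trans[OF im_le_modulus z]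
    by (auto simp: unit_bounded_def intro!: exI[of _ 1])
  have t: "tangent u (re z) p + tangent u (im z) q \<le> u" for p q
  proof -
    obtain r \<theta> where r: "r = sqrt (p\<^sup>2 + q\<^sup>2)" "p = r * cos \<theta>" "q = r * sin \<theta>"
      using polar_Ex[of p q] by (metis complex_norm complex.sel cmod_def rcis_def rcis_cmod_Arg Re_rcis Im_rcis)
    have "p\<^sup>2 + q\<^sup>2 = r\<^sup>2" using r(1) by simp
    then have pq: "p\<^sup>2 *\<^sub>R u + q\<^sup>2 *\<^sub>R u = r\<^sup>2 *\<^sub>R u" by (metis scaleR_add_left)
    have "tangent u (re z) p + tangent u (im z) q = (2 * r) *\<^sub>R rotated z \<theta> - r\<^sup>2 *\<^sub>R u"
      unfolding pq[symmetric] by (simp add: tangent_def rotated_def r(2,3) algebra_simps)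
    also have "(2 * r) *\<^sub>R rotated z \<theta> \<le> (2 * r) *\<^sub>R u"
      using order_trans[OF rotated_le_modulus z] r(1) by (intro scaleR_left_mono) auto
    also have "\<dots> \<le> (1 + r\<^sup>2) *\<^sub>R u"
    proof (intro scaleR_right_mono u)
      have "0 \<le> (r - 1)\<^sup>2" by simp
      then show "2 * r \<le> 1 + r\<^sup>2" by (simp add: power2_diff)
    qed
    finally show ?thesis by (simp add: scaleR_add_left)
  qed
  have "unit_square u (re z) \<le> u - tangent u (im z) q" for q
    using t by (intro unit_square_least u f) (simp add: algebra_simps)
  then have "unit_square u (im z) \<le> u - unit_square u (re z)"
    by (intro unit_square_least u g) (simp add: algebra_simps)
  then show ?thesis by (simp add: algebra_simps)
qed

lemma rotated_cis: "rotated (cis \<theta> *\<^sub>C z) \<psi> = rotated z (\<psi> - \<theta>)"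
  by (simp add: rotated_def cos_diff sin_diff algebra_simps)

lemma rotated_add: "rotated (z + w) \<theta> = rotated z \<theta> + rotated w \<theta>"
  by (simp add: rotated_def algebra_simps)

text \<open>If the product of \<open>z\<close> with the conjugate of \<open>w\<close> vanished, then \<open>|z + cw|\<close> would be at most
  \<open>\<surd>2 u\<close> for every unimodular \<open>c\<close>, whereas the supremum over \<open>c\<close> is \<open>2 u\<close>.\<close>

lemma unit_product_conj_nonzero:
  assumes z: "modulus z = u" and w: "modulus w = u" and u: "u \<noteq> 0"
  shows "unit_product u (re z) (re w) + unit_product u (im z) (im w) \<noteq> 0 \<or>
    unit_product u (im z) (re w) - unit_product u (re z) (im w) \<noteq> 0"
proof (rule ccontr)
  let ?B = "unit_product u"
  assume "\<not> ?thesis"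
  then have X: "?B (re z) (re w) + ?B (im z) (im w) = 0" and Y: "?B (im z) (re w) - ?B (re z) (im w) = 0"
    by auto
  have u0: "0 \<le> u" using modulus_nonneg z by blast
  have bnd: "unit_bounded u (re v)" "unit_bounded u (im v)" if "modulus v = u" for v
    using re_le_modulus[of v] im_le_modulus[of v] that by (auto simp: unit_bounded_def intro!: exI[of _ 1])
  note b = bnd[OF z] bnd[OF w]
  have bound: "rotated z \<psi> + rotated w \<phi> \<le> sqrt 2 *\<^sub>R u" for \<psi> \<phi>
  proof -
    \<comment> \<open>Turning \<open>w\<close> by this angle aligns the two rotations:
      \<open>rotated v \<psi> = rotated w \<phi>\<close>.\<close>
    define \<theta> where "\<theta> = \<psi> - \<phi>"
    define v where "v = cis \<theta> *\<^sub>C w"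
    have v: "modulus v = u" using w by (simp add: v_def modulus_scaleC)
    note bv = bnd[OF v]
    \<comment> \<open>The real part of \<open>z\<close> times the conjugate of \<open>v\<close> is a
      combination of the two components assumed to vanish.\<close>
    have "?B (re z) (re v) + ?B (im z) (im v)
        = ?B (1 *\<^sub>R re z + 0 *\<^sub>R im z) (cos \<theta> *\<^sub>R re w + (- sin \<theta>) *\<^sub>R im w)
        + ?B (0 *\<^sub>R re z + 1 *\<^sub>R im z) (sin \<theta> *\<^sub>R re w + cos \<theta> *\<^sub>R im w)"
      by (simp add: v_def add.commute)
    also have "\<dots> = cos \<theta> *\<^sub>R (?B (re z) (re w) + ?B (im z) (im w)) + sin \<theta> *\<^sub>R (?B (im z) (re w) - ?B (re z) (im w))"
      unfolding unit_product_bilinear[OF u0 b(1,2,3,4)] by (simp add: algebra_simps)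
    finally have 0: "?B (re z) (re v) + ?B (im z) (im v) = 0" by (simp add: X Y)
    have "unit_square u (re (z + v)) + unit_square u (im (z + v))
        = (unit_square u (re z) + unit_square u (im z)) + (unit_square u (re v) + unit_square u (im v))
          + 2 *\<^sub>R (?B (re z) (re v) + ?B (im z) (im v))"
      unfolding re_im_simps unit_square_add[OF u0 b(1) bv(1)] unit_square_add[OF u0 b(2) bv(2)]
      by (simp add: algebra_simps)
    also have "\<dots> \<le> u + u + 0"
      unfolding 0 using z v by (intro add_mono unit_square_cartesian_le) auto
    finally have le: "unit_square u (re (z + v)) + unit_square u (im (z + v)) \<le> u + u" by simp
    \<comment> \<open>The squares of the two parts of \<open>z + v\<close> sum to at most
      \<open>2 u\<close>, as on a disc of radius \<open>sqrt 2\<close>; these parameters give the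
      supporting line of the disc in direction \<open>\<psi>\<close>.\<close>
    have "tangent u (re (z + v)) (sqrt 2 * cos \<psi>) + tangent u (im (z + v)) (sqrt 2 * sin \<psi>) \<le> u + u"
      using le unfolding re_im_simps
      by (intro order_trans[OF _ le[unfolded re_im_simps]] add_mono tangent_le_unit_square u0 unit_bounded_add b bv)
    moreover have "(sqrt 2 * cos \<psi>)\<^sup>2 *\<^sub>R u + (sqrt 2 * sin \<psi>)\<^sup>2 *\<^sub>R u = 2 *\<^sub>R u"
    proof -
      have "(sqrt 2 * cos \<psi>)\<^sup>2 + (sqrt 2 * sin \<psi>)\<^sup>2 = 2 * ((sin \<psi>)\<^sup>2 + (cos \<psi>)\<^sup>2)"
        unfolding power_mult_distrib distrib_left by simp
      also have "\<dots> = 2" by (simp only: sin_cos_squared_add mult_1_right)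
      finally show ?thesis unfolding scaleR_add_left[symmetric] by simp
    qed
    then have "tangent u (re (z + v)) (sqrt 2 * cos \<psi>) + tangent u (im (z + v)) (sqrt 2 * sin \<psi>)
        = (2 * sqrt 2) *\<^sub>R rotated (z + v) \<psi> - 2 *\<^sub>R u"
      by (simp add: tangent_def rotated_def algebra_simps)
    ultimately have "(2 * sqrt 2) *\<^sub>R rotated (z + v) \<psi> - 2 *\<^sub>R u \<le> u + u" by (simp only:)
    then have "(2 * sqrt 2) *\<^sub>R rotated (z + v) \<psi> \<le> u + u + 2 *\<^sub>R u" by (simp only: diff_le_eq)
    also have "u + u + 2 *\<^sub>R u = 4 *\<^sub>R u" using scaleR_add_left[of 2 2 u] by (simp add: scaleR_2)
    also have "4 *\<^sub>R u = (2 * sqrt 2) *\<^sub>R (sqrt 2 *\<^sub>R u)" by simp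
    finally have "rotated (z + v) \<psi> \<le> sqrt 2 *\<^sub>R u" by (rule lattice_half_le) simp
    then show ?thesis by (simp add: rotated_add v_def rotated_cis \<theta>_def)
  qed
  \<comment> \<open>Taking suprema over \<open>\<psi>\<close> and then over \<open>\<phi>\<close>
    leads to \<open>2 u \<le> sqrt 2 u\<close>.\<close>
  have "modulus z \<le> sqrt 2 *\<^sub>R u - rotated w \<phi>" for \<phi>
    using bound by (intro modulus_least) (simp add: algebra_simps)
  then have "modulus w \<le> sqrt 2 *\<^sub>R u - modulus z"
    by (intro modulus_least) (simp add: algebra_simps)
  then have "(2 - sqrt 2) *\<^sub>R u \<le> (2 - sqrt 2) *\<^sub>R 0"
    using z w by (simp add: algebra_simps scaleR_2)
  moreover have "2 - sqrt 2 > 0" by (simp add: sqrt2_less_2)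
  ultimately have "u \<le> 0" by (rule lattice_half_le)
  then show False using u u0 by auto
qed

section \<open>Unimodular eigenvectors and recurrence\<close>

context irreducible_lattice_semigroup
begin

text \<open>The equation \<open>G t z = exp (\<i> * b * t) z\<close> split into real and imaginary
  parts, since \<open>G\<close> acts on the real lattice. It is demanded only for the times at which
  \<open>G\<close> is a positive semigroup.\<close>

definition eigenvector :: "real \<Rightarrow> 'a complexification \<Rightarrow> bool"
  where "eigenvector b z \<longleftrightarrow> (\<forall>t\<ge>t\<^sub>0. G t (re z) = cos (b * t) *\<^sub>R re z - sin (b * t) *\<^sub>R im z \<and>
    G t (im z) = sin (b * t) *\<^sub>R re z + cos (b * t) *\<^sub>R im z)"

lemma G_rotated:
  assumes "eigenvector b z" "t \<ge> t\<^sub>0"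
  shows "G t (rotated z \<theta>) = rotated z (\<theta> - b * t)"
proof -
  have "G t (rotated z \<theta>) = cos \<theta> *\<^sub>R (cos (b * t) *\<^sub>R re z - sin (b * t) *\<^sub>R im z)
      + sin \<theta> *\<^sub>R (sin (b * t) *\<^sub>R re z + cos (b * t) *\<^sub>R im z)"
    using assms by (simp add: rotated_def eigenvector_def G_simps)
  also have "\<dots> = rotated z (\<theta> - b * t)"
    unfolding rotated_def cos_diff sin_diff by (simp add: algebra_simps)
  finally show ?thesis .
qed

text \<open>\<open>G t\<close> permutes the rotations of \<open>z\<close>, whose supremum is the
  modulus. Positivity then puts the modulus below its own image, and such vectors are fixed.\<close>

lemma modulus_eigenvector_fixed:
  assumes z: "eigenvector b z" and t: "t \<ge> t\<^sub>0"
  shows "G t (modulus z) = modulus z"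
proof (rule fixed_of_le[OF t], rule modulus_least)
  fix \<theta>
  have "rotated z \<theta> = G t (rotated z (\<theta> + b * t))" by (simp add: G_rotated[OF z t])
  also have "\<dots> \<le> G t (modulus z)" by (intro G_mono t rotated_le_modulus)
  finally show "rotated z \<theta> \<le> G t (modulus z)" .
qed

text \<open>Along return times, \<open>P |G t y|\<close> is nonincreasing and comes back to \<open>P |y|\<close>, hence is constant.
  So the semigroup acts by lattice homomorphisms on the recurrent vectors.\<close>

definition recurrent :: "(nat \<Rightarrow> real) \<Rightarrow> 'a set"
  where "recurrent \<tau> = {y. (\<lambda>n. G (\<tau> n) y) \<longlonglongrightarrow> y}"

lemma recurrent_abs:
  assumes \<tau>: "\<And>n. \<tau> n \<ge> t\<^sub>0" "filterlim \<tau> at_top sequentially" and y: "y \<in> recurrent \<tau>"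
  shows "t \<ge> t\<^sub>0 \<Longrightarrow> G t \<bar>y\<bar> = \<bar>G t y\<bar>" and "\<bar>y\<bar> \<in> recurrent \<tau>"
proof -
  show hom: "G t \<bar>y\<bar> = \<bar>G t y\<bar>" if t: "t \<ge> t\<^sub>0" for t
  proof (rule eq_of_P_le)
    show "\<bar>G t y\<bar> \<le> G t \<bar>y\<bar>" by (rule abs_G_le[OF t])
    have "P \<bar>y\<bar> \<le> P \<bar>G t y\<bar>"
    proof (rule tendsto_lattice_le[where F = sequentially])
      show "(\<lambda>n. P \<bar>G (\<tau> n) y\<bar>) \<longlonglongrightarrow> P \<bar>y\<bar>"
        using y bounded_linear.tendsto[OF bounded_linear_P tendsto_lattice_abs] by (auto simp: recurrent_def)
      show "\<forall>\<^sub>F n in sequentially. P \<bar>G (\<tau> n) y\<bar> \<le> P \<bar>G t y\<bar>"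
      proof -
        \<comment> \<open>The margin \<open>t\<^sub>0\<close> keeps the remaining time
          \<open>\<tau> n - t\<close> in the range where \<open>G\<close> is a positive
          semigroup.\<close>
        have "\<forall>\<^sub>F n in sequentially. t + t\<^sub>0 \<le> \<tau> n" using \<tau>(2) by (simp add: filterlim_at_top)
        then show ?thesis
        proof eventually_elim
          case (elim n)
          then have s: "\<tau> n - t \<ge> t\<^sub>0" by simp
          have "G (\<tau> n) y = G (\<tau> n - t) (G t y)" using G_add[OF s t, of y] by simp
          then have "P \<bar>G (\<tau> n) y\<bar> \<le> P (G (\<tau> n - t) \<bar>G t y\<bar>)" using abs_G_le[OF s] by (simp add: P_mono)
          then show ?case by (simp add: P_G[OF s])
        qed
      qed
    qed auto
    then show "P (G t \<bar>y\<bar>) \<le> P \<bar>G t y\<bar>" by (simp add: P_G t)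
  qed
  show "\<bar>y\<bar> \<in> recurrent \<tau>"
    using y tendsto_lattice_abs[of "\<lambda>n. G (\<tau> n) y" y] by (simp add: recurrent_def hom \<tau>)
qed

lemma recurrent_lincomb:
  assumes \<tau>: "\<And>n. \<tau> n \<ge> t\<^sub>0" and "x \<in> recurrent \<tau>" "y \<in> recurrent \<tau>"
  shows "a *\<^sub>R x + b *\<^sub>R y \<in> recurrent \<tau>"
  using assms by (auto simp: recurrent_def G_simps \<tau> intro!: tendsto_intros)

lemma recurrent_sup:
  assumes \<tau>: "\<And>n. \<tau> n \<ge> t\<^sub>0" "filterlim \<tau> at_top sequentially" and x: "x \<in> recurrent \<tau>" and y: "y \<in> recurrent \<tau>"
  shows "sup x y \<in> recurrent \<tau>" and "t \<ge> t\<^sub>0 \<Longrightarrow> G t (sup x y) = sup (G t x) (G t y)"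
proof -
  have d: "x - y \<in> recurrent \<tau>" and s: "x + y \<in> recurrent \<tau>"
    using recurrent_lincomb[OF \<tau>(1) x y, of 1 "-1"] recurrent_lincomb[OF \<tau>(1) x y, of 1 1] by simp_all
  show "sup x y \<in> recurrent \<tau>"
    using recurrent_lincomb[OF \<tau>(1) s recurrent_abs(2)[OF \<tau> d], of "1/2" "1/2"]
    by (simp add: lattice_sup_eq[of x y] scaleR_add_right)
  show "G t (sup x y) = sup (G t x) (G t y)" if "t \<ge> t\<^sub>0"
    using recurrent_abs(1)[OF \<tau> d that] that by (simp add: lattice_sup_eq G_simps)
qed

lemma recurrent_eigenvector:
  assumes z: "eigenvector b z" and \<tau>: "\<And>n. \<tau> n \<ge> t\<^sub>0"
    and c: "(\<lambda>n. cos (b * \<tau> n)) \<longlonglongrightarrow> 1" and s: "(\<lambda>n. sin (b * \<tau> n)) \<longlonglongrightarrow> 0"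
  shows "re z \<in> recurrent \<tau>" "im z \<in> recurrent \<tau>"
proof -
  have "(\<lambda>n. cos (b * \<tau> n) *\<^sub>R re z - sin (b * \<tau> n) *\<^sub>R im z) \<longlonglongrightarrow> 1 *\<^sub>R re z - 0 *\<^sub>R im z"
    by (intro tendsto_intros c s)
  then show "re z \<in> recurrent \<tau>" using z \<tau> by (simp add: recurrent_def eigenvector_def)
  have "(\<lambda>n. sin (b * \<tau> n) *\<^sub>R re z + cos (b * \<tau> n) *\<^sub>R im z) \<longlonglongrightarrow> 0 *\<^sub>R re z + 1 *\<^sub>R im z"
    by (intro tendsto_intros c s)
  then show "im z \<in> recurrent \<tau>" using z \<tau> by (simp add: recurrent_def eigenvector_def)
qed

lemma eigenvector_product:
  assumes z: "eigenvector b z" and w: "eigenvector d w" and mz: "modulus z = u" and mw: "modulus w = u" and u: "u \<noteq> 0"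
  shows "\<exists>v. v \<noteq> 0 \<and> eigenvector (b - d) v"
proof -
  let ?B = "unit_product u"
  have u0: "0 \<le> u" using modulus_nonneg mz by blast
  \<comment> \<open>The return times must serve both frequencies, because sums of parts of
    \<open>z\<close> and \<open>w\<close> have to be recurrent along one sequence.\<close>
  obtain \<tau> where \<tau>: "\<And>n. \<tau> n \<ge> t\<^sub>0" "filterlim \<tau> at_top sequentially"
    "\<And>i. i < 2 \<Longrightarrow> (\<lambda>n. cos ((case i of 0 \<Rightarrow> b | Suc _ \<Rightarrow> d) * \<tau> n)) \<longlonglongrightarrow> 1"
    "\<And>i. i < 2 \<Longrightarrow> (\<lambda>n. sin ((case i of 0 \<Rightarrow> b | Suc _ \<Rightarrow> d) * \<tau> n)) \<longlonglongrightarrow> 0"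
    using simultaneous_return_times[of t\<^sub>0 2 "\<lambda>i. case i of 0 \<Rightarrow> b | Suc _ \<Rightarrow> d"] by blast
  let ?F = "recurrent \<tau>"
  have F: "re z \<in> ?F" "im z \<in> ?F" "re w \<in> ?F" "im w \<in> ?F"
    using recurrent_eigenvector[OF z \<tau>(1)] \<tau>(3,4)[of 0] recurrent_eigenvector[OF w \<tau>(1)] \<tau>(3,4)[of 1] by auto
  have Gu: "G t u = u" if "t \<ge> t\<^sub>0" for t using modulus_eigenvector_fixed[OF z that] mz by simp
  have Fu: "u \<in> ?F" by (simp add: recurrent_def Gu \<tau>(1))
  have bnd: "unit_bounded u (re v)" "unit_bounded u (im v)" if "modulus v = u" for v
    using re_le_modulus[of v] im_le_modulus[of v] that by (auto simp: unit_bounded_def intro!: exI[of _ 1])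
  note bz = bnd[OF mz] and bw = bnd[OF mw]
  have square: "unit_square u (G t f) = G t (unit_square u f)"
    if f: "f \<in> ?F" "unit_bounded u f" and t: "t \<ge> t\<^sub>0" for f t
  proof (rule unit_square_hom(2)[OF u0 f(2) linear_G[OF t] G_mono[OF t] Gu[OF t]])
    show "tangent u f a \<in> ?F" for a
      using recurrent_lincomb[OF \<tau>(1) f(1) Fu, of "2 * a" "- a\<^sup>2"] by (simp add: tangent_def)
  qed (use recurrent_sup[OF \<tau>(1,2)] t in auto)
  have prod: "G t (?B f g) = ?B (G t f) (G t g)"
    if "f \<in> ?F" "unit_bounded u f" "g \<in> ?F" "unit_bounded u g" and t: "t \<ge> t\<^sub>0" for f g t
  proof -
    have "f + g \<in> ?F" "f - g \<in> ?F"
      using recurrent_lincomb[OF \<tau>(1) that(1,3), of 1 1] recurrent_lincomb[OF \<tau>(1) that(1,3), of 1 "-1"]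
      by simp_all
    then show ?thesis
      using square[of "f + g" t] square[of "f - g" t] that
      by (simp add: unit_product_def G_simps unit_bounded_add unit_bounded_diff)
  qed
  \<comment> \<open>The real and imaginary parts of \<open>z\<close> times the conjugate of
    \<open>w\<close>.\<close>
  define v where "v = Cplx (?B (re z) (re w) + ?B (im z) (im w)) (?B (im z) (re w) - ?B (re z) (im w))"
  have "v \<noteq> 0" using unit_product_conj_nonzero[OF mz mw u] by (auto simp: v_def zero_complexification_def)
  moreover have "eigenvector (b - d) v"
    unfolding eigenvector_def
  proof (intro allI impI)
    fix t assume t: "t \<ge> t\<^sub>0"
    let ?c1 = "cos (b * t)" and ?s1 = "sin (b * t)" and ?c2 = "cos (d * t)" and ?s2 = "sin (d * t)"
    have Gz: "G t (re z) = ?c1 *\<^sub>R re z + (- ?s1) *\<^sub>R im z" "G t (im z) = ?s1 *\<^sub>R re z + ?c1 *\<^sub>R im z"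
      using z t by (simp_all add: eigenvector_def)
    have Gw: "G t (re w) = ?c2 *\<^sub>R re w + (- ?s2) *\<^sub>R im w" "G t (im w) = ?s2 *\<^sub>R re w + ?c2 *\<^sub>R im w"
      using w t by (simp_all add: eigenvector_def)
    note expand = unit_product_bilinear[OF u0 bz bw]
    have cs: "cos ((b - d) * t) = ?c1 * ?c2 + ?s1 * ?s2" "sin ((b - d) * t) = ?s1 * ?c2 - ?c1 * ?s2"
      by (simp_all add: left_diff_distrib cos_diff sin_diff)
    have "G t (re v) = G t (?B (re z) (re w)) + G t (?B (im z) (im w))"
      by (simp add: v_def G_simps t)
    also have "\<dots> = cos ((b - d) * t) *\<^sub>R re v - sin ((b - d) * t) *\<^sub>R im v"
      unfolding prod[OF F(1) bz(1) F(3) bw(1) t] prod[OF F(2) bz(2) F(4) bw(2) t] Gz Gw expand cs v_def complexification.sel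
      by (simp add: algebra_simps)
    finally have 1: "G t (re v) = cos ((b - d) * t) *\<^sub>R re v - sin ((b - d) * t) *\<^sub>R im v" .
    have "G t (im v) = G t (?B (im z) (re w)) - G t (?B (re z) (im w))"
      by (simp add: v_def G_simps t)
    also have "\<dots> = sin ((b - d) * t) *\<^sub>R re v + cos ((b - d) * t) *\<^sub>R im v"
      unfolding prod[OF F(2) bz(2) F(3) bw(1) t] prod[OF F(1) bz(1) F(4) bw(2) t] Gz Gw expand cs v_def complexification.sel
      by (simp add: algebra_simps)
    finally show "G t (re v) = cos ((b - d) * t) *\<^sub>R re v - sin ((b - d) * t) *\<^sub>R im v \<and>
      G t (im v) = sin ((b - d) * t) *\<^sub>R re v + cos ((b - d) * t) *\<^sub>R im v"
      using 1 by blast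
  qed
  ultimately show ?thesis by blast
qed

lemma eigenvector_scaleR: "eigenvector b z \<Longrightarrow> eigenvector b (r *\<^sub>R z)"
  by (simp add: eigenvector_def G_simps scaleR_add_right scaleR_diff_right mult.commute)

theorem eigenvector_diff:
  assumes z: "eigenvector b z" "z \<noteq> 0" and w: "eigenvector d w" "w \<noteq> 0"
  shows "\<exists>v. v \<noteq> 0 \<and> eigenvector (b - d) v"
proof -
  have nz: "modulus z \<noteq> 0" "modulus w \<noteq> 0" using z(2) w(2) by (simp_all add: modulus_eq_0)
  obtain c where c: "c \<ge> 0" "modulus z = c *\<^sub>R modulus w"
    using fixed_space_one_dimensional[OF modulus_nonneg nz(2) _ modulus_nonneg]
      modulus_eigenvector_fixed z(1) w(1) by metis
  have "modulus (c *\<^sub>R w) = modulus z"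
    using c modulus_scaleC[of "complex_of_real c" w] by (simp add: scaleC_of_real)
  then show ?thesis
    using eigenvector_product[OF z(1) eigenvector_scaleR[OF w(1)] refl _ nz(1)] by blast
qed

end

section \<open>Strongly continuous semigroups and their resolvents\<close>

lemma scaleC_zero_right [simp]: "c *\<^sub>C (0::'a::complex_vector) = 0"
  using scaleC_add_right[of c 0 0] by simp

lemma scaleC_minus_right: "c *\<^sub>C (- x) = - (c *\<^sub>C (x::'a::complex_vector))"
proof -
  have "c *\<^sub>C (- x) + c *\<^sub>C x = c *\<^sub>C (- x + x)" by (simp only: scaleC_add_right)
  then show ?thesis by (simp add: eq_neg_iff_add_eq_0)
qed

lemma scaleC_diff_right: "c *\<^sub>C (x - y) = c *\<^sub>C x - c *\<^sub>C (y::'a::complex_vector)"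
  using scaleC_add_right[of c x "- y"] by (simp add: scaleC_minus_right)

lemma scaleC_zero_left [simp]: "0 *\<^sub>C (x::'a::complex_vector) = 0"
  using scaleC_add_left[of 0 0 x] by simp

lemma scaleC_diff_left: "(c - d) *\<^sub>C x = c *\<^sub>C x - d *\<^sub>C (x::'a::complex_vector)"
  using scaleC_add_left[of "c - d" d x] by (simp add: algebra_simps)

lemma scaleC_minus_left: "(- c) *\<^sub>C x = - (c *\<^sub>C (x::'a::complex_vector))"
  using scaleC_diff_left[of 0 c x] by simp

lemma scaleR_scaleC: "r *\<^sub>R (c *\<^sub>C x) = c *\<^sub>C (r *\<^sub>R (x::'a::complex_vector))"
  by (metis scaleC_of_real scaleC_scaleC mult.commute)

lemma scaleC_cancel: "c \<noteq> 0 \<Longrightarrow> inverse c *\<^sub>C c *\<^sub>C x = (x::'a::complex_vector)"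
  "c \<noteq> 0 \<Longrightarrow> c *\<^sub>C inverse c *\<^sub>C x = x"
  by (simp_all add: scaleC_scaleC scaleC_one)

lemma bounded_bilinear_scaleC: "bounded_bilinear (scaleC :: complex \<Rightarrow> 'a::complex_normed_vector \<Rightarrow> 'a)"
proof
  show "\<exists>K. \<forall>(c::complex) (x::'a). norm (c *\<^sub>C x) \<le> norm c * norm x * K"
    by (intro exI[of _ 1]) (simp add: norm_scaleC)
  show "(r *\<^sub>R c) *\<^sub>C x = r *\<^sub>R (c *\<^sub>C x)" for r c and x :: 'a
    by (metis scaleC_of_real scaleC_scaleC scaleR_conv_of_real)
qed (simp_all add: scaleC_add_left scaleC_add_right scaleR_scaleC)

lemmas tendsto_scaleC [tendsto_intros] = bounded_bilinear.tendsto[OF bounded_bilinear_scaleC]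

text \<open>By Baire's theorem one of the closed sets \<open>A k\<close>, on which all
  \<open>F n\<close> are bounded by \<open>k\<close>, contains a ball.\<close>

lemma uniform_boundedness:
  fixes F :: "nat \<Rightarrow> 'a::banach \<Rightarrow>\<^sub>L 'b::real_normed_vector"
  assumes "\<And>x. \<exists>K. \<forall>n. norm (F n x) \<le> K"
  shows "\<exists>K. \<forall>n. norm (F n) \<le> K"
proof -
  define A where "A k = {x. \<forall>n. norm (F n x) \<le> real k}" for k :: nat
  have clA: "closed (A k)" for k
    unfolding A_def by (intro closed_Collect_all closed_Collect_le continuous_intros)
  have "x \<in> (\<Union>k. A k)" for x
  proof -
    obtain K where K: "\<And>n. norm (F n x) \<le> K" using assms by blast
    obtain k :: nat where "K \<le> real k" using real_arch_simple by blast
    then have "x \<in> A k" unfolding A_def using K order_trans by blast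
    then show ?thesis by blast
  qed
  then have UN: "\<Union>(range A) = UNIV" by blast
  have "\<exists>k. interior (A k) \<noteq> {}"
  proof (rule ccontr)
    assume "\<not> ?thesis"
    then have "Met_TC.mtopology interior_of \<Union>(range A) = {}"
      using clA by (intro Met_TC.metric_Baire_category_alt) (auto simp: Met_TC.mcomplete_def Cauchy_convergent_iff convergent_def)
    then show False by (simp add: UN)
  qed
  then obtain k a e where e: "e > 0" "ball a e \<subseteq> A k"
    by (metis equals0I mem_interior)
  have "norm (F n) \<le> 4 * real k / e" for n
  proof (rule norm_blinfun_bound)
    show "0 \<le> 4 * real k / e" using e by simp
    fix v
    show "norm (F n v) \<le> 4 * real k / e * norm v"
    proof (cases "v = 0")
      case False
      \<comment> \<open>Half of \<open>e\<close> keeps \<open>a + r *\<^sub>R v\<close> strictly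
        inside the ball. The difference of two values bounded by \<open>k\<close> then gives the
        factor \<open>4 * k / e\<close>.\<close>
      define r where "r = e / (2 * norm v)"
      have r: "r > 0" using e False by (simp add: r_def)
      have "dist a (a + r *\<^sub>R v) < e" "dist a a < e" using e False by (simp_all add: r_def dist_norm)
      then have "a + r *\<^sub>R v \<in> A k" "a \<in> A k" using e(2) by auto
      then have "norm (F n (a + r *\<^sub>R v)) \<le> real k" "norm (F n a) \<le> real k" by (auto simp: A_def)
      moreover have "r *\<^sub>R F n v = F n (a + r *\<^sub>R v) - F n a"
        by (simp add: blinfun.bilinear_simps)
      then have "norm (r *\<^sub>R F n v) = norm (F n (a + r *\<^sub>R v) - F n a)" by simp
      ultimately have "norm (r *\<^sub>R F n v) \<le> 2 * real k"
        using norm_triangle_ineq4[of "F n (a + r *\<^sub>R v)" "F n a"] by linarith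
      then have "norm (F n v) \<le> 2 * real k / r" using r by (simp add: field_simps)
      then show ?thesis using False e by (simp add: r_def field_simps)
    qed simp
  qed
  then show ?thesis by blast
qed

lemma tendsto_average_right:
  fixes f :: "real \<Rightarrow> 'a::banach"
  assumes "continuous_on {a..a + 1} f"
  shows "((\<lambda>h. integral {a..a + h} f /\<^sub>R h) \<longlongrightarrow> f a) (at_right 0)"
proof -
  have "((\<lambda>u. integral {a..u} f) has_vector_derivative f a) (at a within {a..a + 1})"
    by (rule integral_has_vector_derivative[OF assms]) simp
  then have "((\<lambda>u. (integral {a..u} f - (u - a) *\<^sub>R f a) /\<^sub>R norm (u - a)) \<longlongrightarrow> 0) (at_right a)"
    by (simp add: has_vector_derivative_def has_derivative_within at_within_Icc_at_right divide_inverse_commute algebra_simps)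
  then have "((\<lambda>h. (integral {a..h + a} f - h *\<^sub>R f a) /\<^sub>R \<bar>h\<bar>) \<longlongrightarrow> 0) (at_right 0)"
    by (subst (asm) filterlim_at_right_to_0) simp
  then have "((\<lambda>h. integral {a..a + h} f /\<^sub>R h - f a) \<longlongrightarrow> 0) (at_right 0)"
    by (rule Lim_transform_eventually)
      (auto simp: eventually_at_right_less add.commute scaleR_diff_right intro!: eventually_at_rightI[of 0 1])
  then show ?thesis by (rule LIM_zero_cancel)
qed

text \<open>The graph of the generator. As a relation it joins membership in the domain to the value
  and avoids the definite \<open>Lim\<close>.\<close>

definition generates :: "(real \<Rightarrow> 'a::complex_banach \<Rightarrow>\<^sub>L 'a) \<Rightarrow> 'a \<Rightarrow> 'a \<Rightarrow> bool"
  where "generates T x y \<longleftrightarrow> ((\<lambda>h. (T h x - x) /\<^sub>R h) \<longlongrightarrow> y) (at_right 0)"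

lemma dom_generator_iff: "x \<in> dom (generator T) \<longleftrightarrow> (\<exists>y. generates T x y)"
  by (simp add: generator_def generates_def)

lemma act_generator_eq: "generates T x y \<Longrightarrow> act (generator T) x = y"
  by (auto simp: generator_def generates_def intro: tendsto_Lim)

lemma generates_act: "x \<in> dom (generator T) \<Longrightarrow> generates T x (act (generator T) x)"
  by (metis dom_generator_iff act_generator_eq)

lemma generates_iff: "generates T x y \<longleftrightarrow> x \<in> dom (generator T) \<and> act (generator T) x = y"
  by (metis dom_generator_iff act_generator_eq)

lemma generates_diff: "generates T x y \<Longrightarrow> generates T x' y' \<Longrightarrow> generates T (x - x') (y - y')"
  unfolding generates_def
  by (drule (1) tendsto_diff) (simp add: blinfun.bilinear_simps algebra_simps)

lemma generates_add: "generates T x y \<Longrightarrow> generates T x' y' \<Longrightarrow> generates T (x + x') (y + y')"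
  unfolding generates_def
  by (drule (1) tendsto_add) (simp add: blinfun.bilinear_simps algebra_simps)

text \<open>Rescaling shifts the generator by \<open>- \<mu>\<close>, so questions about the
  spectral value \<open>\<mu>\<close> become questions about 0.\<close>

definition rescaled :: "complex \<Rightarrow> (real \<Rightarrow> 'a::complex_banach \<Rightarrow>\<^sub>L 'a) \<Rightarrow> real \<Rightarrow> 'a \<Rightarrow>\<^sub>L 'a"
  where "rescaled \<mu> T t = exp (- \<mu> * of_real t) *\<^sub>C T t"

lemma rescaled_apply: "rescaled \<mu> T t x = exp (- \<mu> * of_real t) *\<^sub>C T t x"
  by (simp add: rescaled_def scaleC_blinfun.rep_eq)

lemma rescaled_rescaled: "rescaled (- \<mu>) (rescaled \<mu> T) = T"
  by (auto simp: rescaled_apply scaleC_scaleC scaleC_one simp flip: exp_add intro!: ext blinfun_eqI)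

section \<open>Continuity and integrals of orbits\<close>

locale c0_semigroup =
  fixes T :: "real \<Rightarrow> 'a::complex_banach \<Rightarrow>\<^sub>L 'a"
  assumes C0: "C0_semigroup T"
begin

lemma T_scaleC: "t \<ge> 0 \<Longrightarrow> T t (c *\<^sub>C x) = c *\<^sub>C T t x"
  using C0 by (simp add: C0_semigroup_def complex_linear_def)

lemma T_0: "T 0 x = x"
  using C0 by (simp add: C0_semigroup_def)

lemma T_add: "s \<ge> 0 \<Longrightarrow> t \<ge> 0 \<Longrightarrow> T (s + t) x = T s (T t x)"
  using C0 by (simp add: C0_semigroup_def)

lemma T_commute: "s \<ge> 0 \<Longrightarrow> t \<ge> 0 \<Longrightarrow> T s (T t x) = T t (T s x)"
  by (metis T_add add.commute)

lemma T_tendsto: "((\<lambda>t. T t x) \<longlongrightarrow> x) (at 0 within {0..})"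
proof -
  have "((\<lambda>t. T t x) \<longlongrightarrow> x) (at_right 0)" using C0 by (simp add: C0_semigroup_def)
  moreover have "at (0::real) within {0..} = at_right 0"
    by (rule at_within_nhd[of _ UNIV]) auto
  ultimately show ?thesis by simp
qed

lemma T_tendsto_compose:
  assumes "(s \<longlongrightarrow> 0) F" "\<And>n. s n \<ge> 0"
  shows "((\<lambda>n. T (s n) x) \<longlongrightarrow> x) F"
proof -
  have "continuous (at 0 within {0..}) (\<lambda>t. T t x)"
    by (simp add: continuous_within T_0 T_tendsto)
  from continuous_within_tendsto_compose'[OF this _ assms(1)] assms(2) show ?thesis
    by (simp add: T_0)
qed

text \<open>Otherwise norms above \<open>n\<close> occur at times tending to 0, although strong
  continuity bounds every orbit along these times; this contradicts uniform boundedness.\<close>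

lemma locally_bounded: "\<exists>d>0. \<exists>M. \<forall>t\<in>{0..d}. norm (T t) \<le> M"
proof (rule ccontr)
  assume "\<not> ?thesis"
  then have neg: "\<exists>t\<in>{0..d}. norm (T t) > M" if "d > 0" for d M using that by (meson not_le)
  have "\<exists>t\<in>{0..inverse (real (Suc n))}. norm (T t) > real n" for n
    by (rule neg) simp
  then obtain t where t: "\<And>n. t n \<in> {0..inverse (real (Suc n))}" "\<And>n. norm (T (t n)) > real n"
    by metis
  have t0: "t \<longlonglongrightarrow> 0"
    by (rule tendsto_sandwich[OF _ _ tendsto_const LIMSEQ_inverse_real_of_nat]) (use t(1) in auto)
  have conv: "(\<lambda>n. T (t n) x) \<longlonglongrightarrow> x" for x
    using t(1) by (intro T_tendsto_compose t0) auto
  have "\<exists>K. \<forall>n. norm (T (t n) x) \<le> K" for x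
  proof -
    have "Bseq (\<lambda>n. T (t n) x)" using conv convergentI convergent_imp_Bseq by blast
    then show ?thesis by (auto simp: Bseq_def)
  qed
  from uniform_boundedness[of "\<lambda>n. T (t n)", OF this]
  obtain K where K: "\<And>n. norm (T (t n)) \<le> K" by blast
  obtain n :: nat where "K \<le> real n" using real_arch_simple by blast
  then show False using K[of n] t(2)[of n] by linarith
qed

lemma bounded_on_compact: "\<exists>M. \<forall>t\<in>{0..\<tau>}. norm (T t) \<le> M"
proof -
  obtain d M where d: "d > 0" and M: "\<And>t. t \<in> {0..d} \<Longrightarrow> norm (T t) \<le> M"
    using locally_bounded by blast
  have step: "norm (T t) \<le> max 1 M ^ Suc n" if "t \<in> {0..real (Suc n) * d}" for t n
    using that
  proof (induction n arbitrary: t)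
    case 0
    then show ?case using M[of t] by auto
  next
    case (Suc n)
    show ?case
    proof (cases "t \<le> d")
      case True
      then have "norm (T t) \<le> max 1 M" using M[of t] Suc.prems by auto
      also have "\<dots> \<le> max 1 M ^ Suc (Suc n)" by (rule self_le_power) auto
      finally show ?thesis .
    next
      case False
      then have "T t = T d o\<^sub>L T (t - d)"
        using T_add[of d "t - d"] d by (intro blinfun_eqI) simp
      then have "norm (T t) \<le> norm (T d) * norm (T (t - d))" by (simp add: norm_blinfun_compose)
      also have "\<dots> \<le> max 1 M * max 1 M ^ Suc n"
      proof (rule mult_mono)
        show "norm (T d) \<le> max 1 M" using M[of d] d by simp
        show "norm (T (t - d)) \<le> max 1 M ^ Suc n"
          using Suc.prems False by (intro Suc.IH) (auto simp: algebra_simps)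
      qed auto
      finally show ?thesis by simp
    qed
  qed
  obtain n :: nat where "\<tau> / d \<le> real n" using real_arch_simple by blast
  then have "\<tau> \<le> real (Suc n) * d" using d by (simp add: field_simps)
  then show ?thesis using step[of _ n] by (intro exI[of _ "max 1 M ^ Suc n"]) auto
qed

lemma continuous_on_T: "continuous_on {0..} (\<lambda>t. T t x)"
  unfolding continuous_on_def
proof (intro ballI)
  fix t :: real assume t: "t \<in> {0..}"
  obtain M where M: "\<And>s. s \<in> {0..t + 1} \<Longrightarrow> norm (T s) \<le> M" using bounded_on_compact by blast
  \<comment> \<open>Factoring out the operator at the smaller of the two times treats continuity
    from the left and from the right together.\<close>
  have b: "norm (T s x - T t x) \<le> M * norm (T \<bar>s - t\<bar> x - x)" if s: "s \<in> {0..t + 1}" for s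
  proof -
    define m where "m = min s t"
    have m: "m \<in> {0..t+1}" using s t by (auto simp: m_def)
    have split: "T (m + r) x - T m x = T m (T r x - x)" if "r \<ge> 0" for r
      using T_add[of m r x] that m by (simp add: blinfun.bilinear_simps)
    have "norm (T s x - T t x) = norm (T m (T \<bar>s - t\<bar> x - x))"
    proof (cases "s \<le> t")
      case True
      then have "m + \<bar>s - t\<bar> = t" "m = s" by (auto simp: m_def)
      then have "T t x - T s x = T m (T \<bar>s - t\<bar> x - x)" using split[of "\<bar>s - t\<bar>"] by simp
      then show ?thesis by (metis norm_minus_commute)
    next
      case False
      then have "m + \<bar>s - t\<bar> = s" "m = t" by (auto simp: m_def)
      then show ?thesis using split[of "\<bar>s - t\<bar>"] by simp
    qed
    also have "\<dots> \<le> norm (T m) * norm (T \<bar>s - t\<bar> x - x)" by (rule norm_blinfun)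
    also have "\<dots> \<le> M * norm (T \<bar>s - t\<bar> x - x)" using M[OF m] by (intro mult_right_mono) auto
    finally show ?thesis .
  qed
  have "((\<lambda>s. \<bar>s - t\<bar>) \<longlongrightarrow> \<bar>t - t\<bar>) (at t within {0..})" by (intro tendsto_intros)
  then have "((\<lambda>s. T \<bar>s - t\<bar> x) \<longlongrightarrow> x) (at t within {0..})" by (intro T_tendsto_compose) auto
  then have "((\<lambda>s. M * norm (T \<bar>s - t\<bar> x - x)) \<longlongrightarrow> M * norm (x - x)) (at t within {0..})"
    by (intro tendsto_intros)
  then have z: "((\<lambda>s. M * norm (T \<bar>s - t\<bar> x - x)) \<longlongrightarrow> 0) (at t within {0..})" by simp
  have ev: "\<forall>\<^sub>F s in at t within {0..}. norm (T s x - T t x) \<le> M * norm (T \<bar>s - t\<bar> x - x)"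
    unfolding eventually_at using b
    by (intro exI[of _ 1]) (auto simp: dist_real_def)
  have "((\<lambda>s. T s x - T t x) \<longlongrightarrow> 0) (at t within {0..})"
    by (rule Lim_null_comparison[OF ev z])
  then show "((\<lambda>s. T s x) \<longlongrightarrow> T t x) (at t within {0..})" by (rule LIM_zero_cancel)
qed

lemma continuous_on_T_Icc: "0 \<le> a \<Longrightarrow> continuous_on {a..b} (\<lambda>t. T t x)"
  by (rule continuous_on_subset[OF continuous_on_T]) auto

lemma integrable_T: "0 \<le> a \<Longrightarrow> (\<lambda>t. T t x) integrable_on {a..b}"
  by (intro integrable_continuous_real continuous_on_T_Icc)

lemma generates_scaleC: "generates T x y \<Longrightarrow> generates T (c *\<^sub>C x) (c *\<^sub>C y)"
proof -
  assume "generates T x y"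
  then have "((\<lambda>h. c *\<^sub>C ((T h x - x) /\<^sub>R h)) \<longlongrightarrow> c *\<^sub>C y) (at_right 0)"
    unfolding generates_def by (intro tendsto_intros)
  then show ?thesis
    unfolding generates_def
    by (rule Lim_transform_eventually)
      (auto simp: T_scaleC scaleC_diff_right scaleR_diff_right simp flip: scaleR_scaleC intro!: eventually_at_rightI[of 0 1])
qed

lemma C0_rescaled: "C0_semigroup (rescaled \<mu> T)"
  unfolding C0_semigroup_def
proof (intro conjI allI impI)
  show "complex_linear (rescaled \<mu> T t)" if "t \<ge> 0" for t
    using that unfolding complex_linear_def rescaled_apply
    by (simp add: T_scaleC blinfun.bilinear_simps scaleC_add_right scaleC_scaleC mult.commute)
  show "rescaled \<mu> T 0 = id_blinfun"
    by (rule blinfun_eqI) (simp add: rescaled_apply T_0 scaleC_one)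
  show "rescaled \<mu> T (s + t) = rescaled \<mu> T s o\<^sub>L rescaled \<mu> T t" if "s \<ge> 0" "t \<ge> 0" for s t
    by (rule blinfun_eqI)
      (simp add: rescaled_apply T_add T_scaleC that scaleC_scaleC algebra_simps flip: exp_add)
  have "((\<lambda>t. exp (- \<mu> * of_real t) *\<^sub>C T t x) \<longlongrightarrow> exp (- \<mu> * of_real 0) *\<^sub>C x) (at_right 0)" for x
    by (intro tendsto_intros) (use C0 in \<open>auto simp: C0_semigroup_def\<close>)
  then show "((\<lambda>t. rescaled \<mu> T t x) \<longlongrightarrow> x) (at_right 0)" for x
    by (simp add: rescaled_apply scaleC_one)
qed

lemma generates_rescaled:
  assumes "generates T x y"
  shows "generates (rescaled \<mu> T) x (y - \<mu> *\<^sub>C x)"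
proof -
  have "((\<lambda>h. exp (- \<mu> * of_real h)) has_vector_derivative (- \<mu>)) (at 0 within {0..1})"
    by (auto intro!: derivative_eq_intros has_vector_derivative_real_field)
  then have "((\<lambda>h. (exp (- \<mu> * of_real h) - 1 - h *\<^sub>R (- \<mu>)) /\<^sub>R norm h) \<longlongrightarrow> 0) (at_right 0)"
    by (simp add: has_vector_derivative_def has_derivative_within at_within_Icc_at_right divide_inverse_commute algebra_simps)
  then have "((\<lambda>h. (exp (- \<mu> * of_real h) - 1) /\<^sub>R h - (- \<mu>)) \<longlongrightarrow> 0) (at_right 0)"
    by (rule Lim_transform_eventually)
      (auto simp: scaleR_add_right scaleR_diff_right intro!: eventually_at_rightI[of 0 1])
  then have e: "((\<lambda>h. (exp (- \<mu> * of_real h) - 1) /\<^sub>R h) \<longlongrightarrow> - \<mu>) (at_right 0)"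
    by (rule LIM_zero_cancel)
  have "((\<lambda>h. exp (- \<mu> * of_real h) *\<^sub>C ((T h x - x) /\<^sub>R h) + ((exp (- \<mu> * of_real h) - 1) /\<^sub>R h) *\<^sub>C x)
      \<longlongrightarrow> exp (- \<mu> * of_real 0) *\<^sub>C y + (- \<mu>) *\<^sub>C x) (at_right 0)"
    by (intro tendsto_intros e assms[unfolded generates_def])
  moreover have "exp (- \<mu> * of_real h) *\<^sub>C ((T h x - x) /\<^sub>R h) + ((exp (- \<mu> * of_real h) - 1) /\<^sub>R h) *\<^sub>C x
      = (rescaled \<mu> T h x - x) /\<^sub>R h" for h
    by (simp add: rescaled_apply scaleC_diff_right scaleC_diff_left scaleR_diff_right scaleC_one
        bounded_bilinear.scaleR_left[OF bounded_bilinear_scaleC] bounded_bilinear.scaleR_right[OF bounded_bilinear_scaleC])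
  ultimately show ?thesis
    unfolding generates_def by (simp add: scaleC_one scaleC_minus_left)
qed

definition orbit_integral :: "real \<Rightarrow> 'a \<Rightarrow> 'a"
  where "orbit_integral \<tau> x = integral {0..\<tau>} (\<lambda>t. T t x)"

lemma orbit_integral_bounded_linear: "bounded_linear (orbit_integral \<tau>)"
proof -
  obtain M where M: "\<And>s. s \<in> {0..\<tau>} \<Longrightarrow> norm (T s) \<le> M" using bounded_on_compact by blast
  show ?thesis
  proof (rule bounded_linear_intro)
    fix x
    have "norm (orbit_integral \<tau> x) \<le> (max 0 M * norm x) * measure lborel {0..\<tau>}"
      unfolding orbit_integral_def
    proof (rule has_integral_bound_real[OF _ finite.emptyI integrable_integral[OF integrable_T]])
      fix t assume "t \<in> {0..\<tau>} - {}"
      then have t: "t \<in> {0..\<tau>}" by simp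
      have "norm (T t x) \<le> norm (T t) * norm x" by (rule norm_blinfun)
      also have "\<dots> \<le> max 0 M * norm x" using M[OF t] by (intro mult_right_mono) auto
      finally show "norm (T t x) \<le> max 0 M * norm x" .
    qed auto
    then show "norm (orbit_integral \<tau> x) \<le> norm x * (max 0 M * measure lborel {0..\<tau>})" by (simp add: mult_ac)
  next
    fix r x
    show "orbit_integral \<tau> (r *\<^sub>R x) = r *\<^sub>R orbit_integral \<tau> x"
      by (simp add: orbit_integral_def blinfun.bilinear_simps)
  qed (simp add: orbit_integral_def blinfun.bilinear_simps integrable_T integral_add)
qed

lemma T_orbit_integral:
  assumes "h \<ge> 0"
  shows "T h (orbit_integral \<tau> x) = orbit_integral \<tau> (T h x)"
    and "T h (orbit_integral \<tau> x) = integral {h..\<tau> + h} (\<lambda>t. T t x)"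
proof -
  have 1: "T h (orbit_integral \<tau> x) = integral {0..\<tau>} (\<lambda>t. T h (T t x))"
    using integral_linear[OF integrable_T[of 0 x \<tau>] blinfun.bounded_linear_right[of "T h"]]
    by (simp add: orbit_integral_def o_def)
  also have "\<dots> = integral {0..\<tau>} (\<lambda>t. T t (T h x))"
    using assms by (intro integral_cong T_commute) auto
  finally show "T h (orbit_integral \<tau> x) = orbit_integral \<tau> (T h x)" by (simp add: orbit_integral_def)
  have "integral {0..\<tau>} (\<lambda>t. T h (T t x)) = integral {0..\<tau>} ((\<lambda>t. T t x) \<circ> (+) h)"
    using assms by (intro integral_cong) (simp add: T_add)
  then show "T h (orbit_integral \<tau> x) = integral {h..\<tau> + h} (\<lambda>t. T t x)"
    using 1 integral_shift_Icc_real[of 0 \<tau> "\<lambda>t. T t x" h] by simp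
qed

text \<open>The difference quotient is the mean of the orbit over
  \<open>[\<tau>, \<tau> + h]\<close> minus its mean over \<open>[0, h]\<close>.\<close>

lemma generates_orbit_integral:
  assumes \<tau>: "\<tau> \<ge> 0"
  shows "generates T (orbit_integral \<tau> x) (T \<tau> x - x)"
proof -
  let ?f = "\<lambda>t. T t x"
  have "((\<lambda>h. integral {\<tau>..\<tau> + h} ?f /\<^sub>R h - integral {0..0 + h} ?f /\<^sub>R h) \<longlongrightarrow> T \<tau> x - T 0 x) (at_right 0)"
    by (intro tendsto_diff tendsto_average_right continuous_on_T_Icc \<tau>) simp
  then show ?thesis
    unfolding generates_def T_0
  proof (rule Lim_transform_eventually)
    show "\<forall>\<^sub>F h in at_right 0. integral {\<tau>..\<tau> + h} ?f /\<^sub>R h - integral {0..0 + h} ?f /\<^sub>R h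
        = (T h (orbit_integral \<tau> x) - orbit_integral \<tau> x) /\<^sub>R h"
    proof (intro eventually_at_rightI[of 0 1])
      fix h :: real assume h: "h \<in> {0<..<1}"
      have "integral {0..h} ?f + integral {h..\<tau> + h} ?f = integral {0..\<tau> + h} ?f"
        using h \<tau> by (intro Henstock_Kurzweil_Integration.integral_combine integrable_T) auto
      moreover have "integral {0..\<tau>} ?f + integral {\<tau>..\<tau> + h} ?f = integral {0..\<tau> + h} ?f"
        using h \<tau> by (intro Henstock_Kurzweil_Integration.integral_combine integrable_T) auto
      ultimately have "integral {\<tau>..\<tau> + h} ?f - integral {0..h} ?f = integral {h..\<tau> + h} ?f - integral {0..\<tau>} ?f"
        by (simp add: algebra_simps)
      then show "integral {\<tau>..\<tau> + h} ?f /\<^sub>R h - integral {0..0 + h} ?f /\<^sub>R h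
        = (T h (orbit_integral \<tau> x) - orbit_integral \<tau> x) /\<^sub>R h"
        using h unfolding T_orbit_integral(2)[OF less_imp_le[OF h[simplified, THEN conjunct1]]]
        by (simp add: orbit_integral_def flip: scaleR_diff_right)
    qed simp
  qed
qed

text \<open>The bounded operator \<open>orbit_integral \<tau>\<close> commutes with
  \<open>T h\<close>, so it sends the difference quotient at \<open>x\<close> to the one at the
  orbit integral.\<close>

lemma orbit_integral_generates:
  assumes \<tau>: "\<tau> \<ge> 0" and xy: "generates T x y"
  shows "orbit_integral \<tau> y = T \<tau> x - x"
proof -
  interpret V: bounded_linear "orbit_integral \<tau>" by (rule orbit_integral_bounded_linear)
  have "((\<lambda>h. orbit_integral \<tau> ((T h x - x) /\<^sub>R h)) \<longlongrightarrow> orbit_integral \<tau> y) (at_right 0)"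
    using xy unfolding generates_def by (rule V.tendsto)
  then have "((\<lambda>h. (T h (orbit_integral \<tau> x) - orbit_integral \<tau> x) /\<^sub>R h) \<longlongrightarrow> orbit_integral \<tau> y) (at_right 0)"
    by (rule Lim_transform_eventually)
      (auto simp: V.scaleR V.diff T_orbit_integral(1) intro!: eventually_at_rightI[of 0 1])
  moreover have "((\<lambda>h. (T h (orbit_integral \<tau> x) - orbit_integral \<tau> x) /\<^sub>R h) \<longlongrightarrow> T \<tau> x - x) (at_right 0)"
    using generates_orbit_integral[OF \<tau>, of x] by (simp add: generates_def)
  ultimately show ?thesis by (rule tendsto_unique[rotated]) simp
qed

lemma generates_zero_iff: "generates T x 0 \<longleftrightarrow> (\<forall>t\<ge>0. T t x = x)"
proof
  assume "generates T x 0"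
  then have "T t x - x = orbit_integral t 0" if "t \<ge> 0" for t
    using orbit_integral_generates[OF that] by simp
  then show "\<forall>t\<ge>0. T t x = x" by (simp add: orbit_integral_def)
next
  assume "\<forall>t\<ge>0. T t x = x"
  then show "generates T x 0"
    unfolding generates_def
    by (intro tendsto_eventually eventually_at_rightI[of 0 1]) auto
qed

end

section \<open>Resolvent identity, Neumann series and Laplace transform\<close>

lemma
  assumes "\<mu> \<in> resolvent_set A"
  shows resolvent_in_dom: "resolvent A \<mu> x \<in> dom A"
    and shifted_resolvent: "shifted A \<mu> (resolvent A \<mu> x) = x"
    and resolvent_shifted: "y \<in> dom A \<Longrightarrow> resolvent A \<mu> (shifted A \<mu> y) = y"
proof -
  have bij: "bij_betw (shifted A \<mu>) (dom A) UNIV" and "bounded_linear (the_inv_into (dom A) (shifted A \<mu>))"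
    using assms by (auto simp: resolvent_set_def)
  then have R: "resolvent A \<mu> x = the_inv_into (dom A) (shifted A \<mu>) x" for x
    by (simp add: resolvent_def bounded_linear_Blinfun_apply)
  have inj: "inj_on (shifted A \<mu>) (dom A)" and im: "shifted A \<mu> ` dom A = UNIV"
    using bij by (auto simp: bij_betw_def)
  show "resolvent A \<mu> x \<in> dom A"
    unfolding R using the_inv_into_into[OF inj] im by blast
  show "shifted A \<mu> (resolvent A \<mu> x) = x"
    unfolding R using f_the_inv_into_f[OF inj] im by blast
  show "resolvent A \<mu> (shifted A \<mu> y) = y" if "y \<in> dom A"
    unfolding R by (rule the_inv_into_f_f[OF inj that])
qed

lemma funpow_blinfun_linear:
  fixes R :: "'a::real_normed_vector \<Rightarrow>\<^sub>L 'a"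
  shows "bounded_linear (blinfun_apply R ^^ n)"
  by (induction n) (auto intro: bounded_linear_compose[OF blinfun.bounded_linear_right] bounded_linear_ident simp: o_def id_def)

lemma norm_funpow_blinfun_le:
  fixes R :: "'a::real_normed_vector \<Rightarrow>\<^sub>L 'a"
  shows "norm ((blinfun_apply R ^^ n) x) \<le> norm R ^ n * norm x"
proof (induction n)
  case (Suc n)
  have "norm (R ((blinfun_apply R ^^ n) x)) \<le> norm R * norm ((blinfun_apply R ^^ n) x)" by (rule norm_blinfun)
  also have "\<dots> \<le> norm R * (norm R ^ n * norm x)" using Suc by (intro mult_left_mono) auto
  finally show ?case by simp
qed simp

context c0_semigroup
begin

abbreviation R :: "complex \<Rightarrow> 'a \<Rightarrow>\<^sub>L 'a"
  where "R \<equiv> resolvent (generator T)"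

abbreviation \<rho> :: "complex set"
  where "\<rho> \<equiv> resolvent_set (generator T)"

lemma c0_rescaled: "c0_semigroup (rescaled \<mu> T)"
  by standard (rule C0_rescaled)

lemma generates_rescaled_iff: "generates (rescaled \<mu> T) x y \<longleftrightarrow> generates T x (y + \<mu> *\<^sub>C x)"
  using generates_rescaled[of x "y + \<mu> *\<^sub>C x" \<mu>] c0_semigroup.generates_rescaled[OF c0_rescaled, of \<mu> x y "- \<mu>"]
  by (auto simp: rescaled_rescaled scaleC_minus_left)

text \<open>Rescaling by \<open>\<mu>\<close> reduces this to the eigenvalue 0, whose eigenvectors
  have constant orbits.\<close>

lemma eigenvector_iff_orbit: "generates T x (\<mu> *\<^sub>C x) \<longleftrightarrow> (\<forall>t\<ge>0. T t x = exp (\<mu> * of_real t) *\<^sub>C x)"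
proof -
  have "exp (- \<mu> * of_real t) *\<^sub>C T t x = x \<longleftrightarrow> T t x = exp (\<mu> * of_real t) *\<^sub>C x" for t
  proof
    assume "exp (- \<mu> * of_real t) *\<^sub>C T t x = x"
    then have "exp (\<mu> * of_real t) *\<^sub>C exp (- \<mu> * of_real t) *\<^sub>C T t x = exp (\<mu> * of_real t) *\<^sub>C x" by simp
    then show "T t x = exp (\<mu> * of_real t) *\<^sub>C x" by (simp add: scaleC_scaleC scaleC_one flip: exp_add)
  qed (simp add: scaleC_scaleC scaleC_one flip: exp_add)
  then show ?thesis
    using c0_semigroup.generates_zero_iff[OF c0_rescaled, of \<mu> x] generates_rescaled_iff[of \<mu> x 0]
    by (simp add: rescaled_apply)
qed

lemma generates_resolvent:
  assumes "\<mu> \<in> \<rho>"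
  shows "generates T (R \<mu> x) (\<mu> *\<^sub>C R \<mu> x - x)"
proof -
  have "act (generator T) (R \<mu> x) = \<mu> *\<^sub>C R \<mu> x - x"
    using shifted_resolvent[OF assms, of x] by (simp add: shifted_def algebra_simps)
  then show ?thesis using generates_act[OF resolvent_in_dom[OF assms, of x]] by simp
qed

lemma resolvent_generates: "\<mu> \<in> \<rho> \<Longrightarrow> generates T x y \<Longrightarrow> R \<mu> (\<mu> *\<^sub>C x - y) = x"
  using resolvent_shifted[of \<mu> "generator T" x] by (simp add: generates_iff shifted_def)

lemma resolvent_scaleC: "\<mu> \<in> \<rho> \<Longrightarrow> R \<mu> (c *\<^sub>C x) = c *\<^sub>C R \<mu> x"
  using resolvent_generates[OF _ generates_scaleC[OF generates_resolvent], of \<mu> \<mu> c x]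
  by (simp add: scaleC_diff_right scaleC_scaleC mult.commute)

lemma generates_T: "generates T x y \<Longrightarrow> t \<ge> 0 \<Longrightarrow> generates T (T t x) (T t y)"
proof -
  assume xy: "generates T x y" and t: "t \<ge> 0"
  have "((\<lambda>h. T t ((T h x - x) /\<^sub>R h)) \<longlongrightarrow> T t y) (at_right 0)"
    using xy unfolding generates_def by (intro tendsto_intros)
  then show ?thesis
    unfolding generates_def
    by (rule Lim_transform_eventually)
      (auto simp: T_commute[OF t] blinfun.bilinear_simps intro!: eventually_at_rightI[of 0 1])
qed

lemma resolvent_T_commute: "\<mu> \<in> \<rho> \<Longrightarrow> t \<ge> 0 \<Longrightarrow> R \<mu> (T t x) = T t (R \<mu> x)"
  using resolvent_generates[OF _ generates_T[OF generates_resolvent], of \<mu> \<mu> t x]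
  by (simp add: blinfun.bilinear_simps T_scaleC)

lemma resolvent_identity:
  assumes "\<kappa> \<in> \<rho>" "\<mu> \<in> \<rho>"
  shows "R \<mu> x = R \<kappa> x + (\<kappa> - \<mu>) *\<^sub>C R \<kappa> (R \<mu> x)"
proof -
  have "R \<mu> x = R \<kappa> (\<kappa> *\<^sub>C R \<mu> x - (\<mu> *\<^sub>C R \<mu> x - x))"
    by (rule resolvent_generates[OF assms(1) generates_resolvent[OF assms(2), of x], symmetric])
  also have "\<kappa> *\<^sub>C R \<mu> x - (\<mu> *\<^sub>C R \<mu> x - x) = x + (\<kappa> - \<mu>) *\<^sub>C R \<mu> x"
    by (simp add: scaleC_diff_left)
  finally show ?thesis unfolding blinfun.add_right resolvent_scaleC[OF assms(1)] .
qed

text \<open>Iterating the resolvent identity yields the partial sums and a remainder that tends to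
  0. As \<open>\<mu> \<in> \<rho>\<close> is given, the series only has to be identified with
  \<open>R \<mu> x\<close>.\<close>

lemma resolvent_neumann:
  assumes \<kappa>: "\<kappa> \<in> \<rho>" and \<mu>: "\<mu> \<in> \<rho>" and small: "cmod (\<kappa> - \<mu>) * norm (R \<kappa>) < 1"
  shows "(\<lambda>k. (\<kappa> - \<mu>) ^ k *\<^sub>C (blinfun_apply (R \<kappa>) ^^ Suc k) x) sums R \<mu> x"
proof -
  let ?c = "\<kappa> - \<mu>" and ?P = "\<lambda>n. blinfun_apply (R \<kappa>) ^^ n"
  have P_add: "?P n (y + z) = ?P n y + ?P n z" for n y z
    by (rule linear_add[OF bounded_linear.linear[OF funpow_blinfun_linear]])
  have P_scaleC: "?P n (c *\<^sub>C y) = c *\<^sub>C ?P n y" for n c y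
    by (induction n) (simp_all add: resolvent_scaleC \<kappa>)
  have partial: "(\<Sum>k<n. ?c ^ k *\<^sub>C ?P (Suc k) x) = R \<mu> x - ?c ^ n *\<^sub>C ?P n (R \<mu> x)" for n
  proof (induction n)
    case (Suc n)
    have "?P n (R \<mu> x) = ?P n (R \<kappa> x) + ?c *\<^sub>C ?P n (R \<kappa> (R \<mu> x))"
      by (subst resolvent_identity[OF \<kappa> \<mu>]) (simp add: P_add P_scaleC)
    then have "?P n (R \<mu> x) = ?P (Suc n) x + ?c *\<^sub>C ?P (Suc n) (R \<mu> x)"
      by (simp only: funpow_Suc_right o_apply)
    then have eq: "?c ^ n *\<^sub>C ?P n (R \<mu> x) = ?c ^ n *\<^sub>C ?P (Suc n) x + ?c ^ Suc n *\<^sub>C ?P (Suc n) (R \<mu> x)"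
      by (simp only: scaleC_add_right scaleC_scaleC power_Suc2)
    have "X - (B + C) + B = X - C" for X B C :: 'a by (simp add: algebra_simps)
    then show ?case unfolding sum.lessThan_Suc Suc eq .
  qed (simp add: scaleC_one)
  have "(\<lambda>n. ?c ^ n *\<^sub>C ?P n (R \<mu> x)) \<longlonglongrightarrow> 0"
  proof (rule Lim_null_comparison)
    show "\<forall>\<^sub>F n in sequentially. norm (?c ^ n *\<^sub>C ?P n (R \<mu> x)) \<le> (cmod ?c * norm (R \<kappa>)) ^ n * norm (R \<mu> x)"
    proof (intro always_eventually allI)
      fix n
      have "norm (?c ^ n *\<^sub>C ?P n (R \<mu> x)) \<le> cmod ?c ^ n * (norm (R \<kappa>) ^ n * norm (R \<mu> x))"
        unfolding norm_scaleC norm_power by (intro mult_left_mono norm_funpow_blinfun_le) auto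
      then show "norm (?c ^ n *\<^sub>C ?P n (R \<mu> x)) \<le> (cmod ?c * norm (R \<kappa>)) ^ n * norm (R \<mu> x)"
        by (simp add: power_mult_distrib mult.assoc)
    qed
    show "(\<lambda>n. (cmod ?c * norm (R \<kappa>)) ^ n * norm (R \<mu> x)) \<longlonglongrightarrow> 0"
      using small by (intro tendsto_mult_left_zero LIMSEQ_power_zero) simp
  qed
  then have "(\<lambda>n. R \<mu> x - ?c ^ n *\<^sub>C ?P n (R \<mu> x)) \<longlonglongrightarrow> R \<mu> x - 0" by (intro tendsto_intros)
  then show ?thesis unfolding sums_def partial by simp
qed

text \<open>The second term of the resolvent identity is at most half of
  \<open>norm (R \<mu> x)\<close> and is absorbed on the left.\<close>

lemma norm_resolvent_le:
  assumes "\<kappa> \<in> \<rho>" "\<mu> \<in> \<rho>" and small: "cmod (\<kappa> - \<mu>) * norm (R \<kappa>) \<le> 1/2"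
  shows "norm (R \<mu>) \<le> 2 * norm (R \<kappa>)"
proof (rule norm_blinfun_bound)
  fix x
  have "norm (R \<mu> x) \<le> norm (R \<kappa> x) + norm ((\<kappa> - \<mu>) *\<^sub>C R \<kappa> (R \<mu> x))"
    by (subst resolvent_identity[OF assms(1,2)]) (rule norm_triangle_ineq)
  also have "norm ((\<kappa> - \<mu>) *\<^sub>C R \<kappa> (R \<mu> x)) \<le> cmod (\<kappa> - \<mu>) * (norm (R \<kappa>) * norm (R \<mu> x))"
    unfolding norm_scaleC by (intro mult_left_mono norm_blinfun) auto
  also have "\<dots> \<le> 1/2 * norm (R \<mu> x)"
    unfolding mult.assoc[symmetric] using small by (intro mult_right_mono) auto
  finally show "norm (R \<mu> x) \<le> 2 * norm (R \<kappa>) * norm x"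
    using norm_blinfun[of "R \<kappa>" x] by simp
qed simp

text \<open>The operator at time 1 decides: since \<open>exp r \<ge> 1 + r\<close>, the rescaled
  \<open>T 1\<close> is a strict contraction \<open>U\<close>. The resolvent applied to
  \<open>y\<close> is the orbit integral over \<open>[0, 1]\<close> of the solution \<open>w\<close>
  of \<open>w = y + U w\<close>.\<close>

lemma large_in_resolvent_set:
  assumes \<mu>: "Re \<mu> \<ge> norm (T 1)"
  shows "\<mu> \<in> \<rho>"
    and "(\<lambda>n. c0_semigroup.orbit_integral (rescaled \<mu> T) (real n) y) \<longlonglongrightarrow> R \<mu> y"
proof -
  let ?A = "generator T"
  interpret U: c0_semigroup "rescaled \<mu> T" by (rule c0_rescaled)
  let ?U = "rescaled \<mu> T"
  define q where "q = norm (?U 1)"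
  have "norm (T 1) < exp (Re \<mu>)"
    using \<mu> exp_ge_add_one_self[of "Re \<mu>"] by linarith
  then have q: "q < 1"
    by (simp add: q_def rescaled_def norm_scaleC norm_exp_eq_Re) (simp add: exp_minus field_simps)
  have q0: "q \<ge> 0" by (simp add: q_def)
  have q_le: "norm (?U 1 x) \<le> q * norm x" for x unfolding q_def by (rule norm_blinfun)
  let ?V = "U.orbit_integral 1"
  interpret V: bounded_linear ?V by (rule U.orbit_integral_bounded_linear)
  obtain K where K: "\<And>x. norm (?V x) \<le> norm x * K" "K > 0" using V.pos_bounded by blast
  have gen: "generates ?U x (- shifted ?A \<mu> x)" if "x \<in> dom ?A" for x
    using generates_act[OF that] by (simp add: generates_rescaled_iff shifted_def)
  \<comment> \<open>A lower bound for \<open>shifted\<close>; it gives both injectivity and the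
    boundedness of the inverse.\<close>
  have below: "norm x \<le> norm (shifted ?A \<mu> x) * (K / (1 - q))" if "x \<in> dom ?A" for x
  proof -
    have "?V (- shifted ?A \<mu> x) = ?U 1 x - x"
      by (rule U.orbit_integral_generates[OF _ gen[OF that]]) simp
    then have "x = ?V (shifted ?A \<mu> x) + ?U 1 x" by (simp add: V.neg algebra_simps)
    then have "norm x \<le> norm (?V (shifted ?A \<mu> x)) + norm (?U 1 x)" by (metis norm_triangle_ineq)
    also have "\<dots> \<le> norm (shifted ?A \<mu> x) * K + q * norm x" by (intro add_mono K q_le)
    finally show ?thesis using q by (simp add: field_simps)
  qed
  have diff: "x - y \<in> dom ?A" "shifted ?A \<mu> (x - y) = shifted ?A \<mu> x - shifted ?A \<mu> y"
    if "x \<in> dom ?A" "y \<in> dom ?A" for x y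
    using generates_diff[OF generates_act generates_act, OF that]
    by (auto simp: generates_iff shifted_def scaleC_diff_right)
  have add: "x + y \<in> dom ?A" "shifted ?A \<mu> (x + y) = shifted ?A \<mu> x + shifted ?A \<mu> y"
    if "x \<in> dom ?A" "y \<in> dom ?A" for x y
    using generates_add[OF generates_act generates_act, OF that]
    by (auto simp: generates_iff shifted_def scaleC_add_right)
  have scale: "r *\<^sub>R x \<in> dom ?A" "shifted ?A \<mu> (r *\<^sub>R x) = r *\<^sub>R shifted ?A \<mu> x"
    if "x \<in> dom ?A" for r x
    using generates_scaleC[OF generates_act[OF that], of "of_real r"]
    by (auto simp: generates_iff shifted_def scaleC_of_real scaleR_diff_right scaleR_scaleC)
  have inj: "inj_on (shifted ?A \<mu>) (dom ?A)"
  proof (rule inj_onI)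
    fix x y assume xy: "x \<in> dom ?A" "y \<in> dom ?A" "shifted ?A \<mu> x = shifted ?A \<mu> y"
    then show "x = y" using below[OF diff(1)[OF xy(1,2)]] diff(2)[OF xy(1,2)] by simp
  qed
  have surj: "y \<in> shifted ?A \<mu> ` dom ?A" for y
  proof -
    have "\<exists>!w. y + ?U 1 w = w"
    proof (rule banach_fix_type[OF q0 q], intro allI)
      show "dist (y + ?U 1 v) (y + ?U 1 w) \<le> q * dist v w" for v w
        using q_le[of "v - w"] by (simp add: dist_norm blinfun.bilinear_simps)
    qed
    then obtain w where w: "y + ?U 1 w = w" by blast
    have "generates ?U (?V w) (?U 1 w - w)" by (rule U.generates_orbit_integral) simp
    also have "?U 1 w - w = - y" using w by (simp add: algebra_simps)
    finally have "generates T (?V w) (\<mu> *\<^sub>C ?V w - y)" by (simp add: generates_rescaled_iff)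
    then have "?V w \<in> dom ?A" "shifted ?A \<mu> (?V w) = y" by (auto simp: generates_iff shifted_def)
    then show ?thesis by blast
  qed
  let ?g = "the_inv_into (dom ?A) (shifted ?A \<mu>)"
  have g: "?g y \<in> dom ?A" "shifted ?A \<mu> (?g y) = y" for y
    using the_inv_into_into[OF inj surj subset_refl] f_the_inv_into_f[OF inj surj] by auto
  have g_eq: "x = ?g y" if "x \<in> dom ?A" "shifted ?A \<mu> x = y" for x y
    using the_inv_into_f_f[OF inj that(1)] that(2) by simp
  have "bounded_linear ?g"
  proof (rule bounded_linear_intro)
    show "?g (x + y) = ?g x + ?g y" for x y
      using g_eq[of "?g x + ?g y" "x + y"] add g by simp
    show "?g (r *\<^sub>R x) = r *\<^sub>R ?g x" for r x
      using g_eq[of "r *\<^sub>R ?g x" "r *\<^sub>R x"] scale g by simp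
    show "norm (?g x) \<le> norm x * (K / (1 - q))" for x
      using below[OF g(1)[of x]] g(2)[of x] by simp
  qed
  then show \<mu>\<rho>: "\<mu> \<in> \<rho>"
    using inj surj by (auto simp: resolvent_set_def bij_betw_def)
  show "(\<lambda>n. U.orbit_integral (real n) y) \<longlonglongrightarrow> R \<mu> y"
  proof -
    let ?x = "R \<mu> y"
    have "generates ?U ?x (- y)"
      using generates_resolvent[OF \<mu>\<rho>, of y] by (simp add: generates_rescaled_iff)
    then have "U.orbit_integral (real n) (- y) = ?U (real n) ?x - ?x" for n
      by (intro U.orbit_integral_generates) simp
    \<comment> \<open>The truncated Laplace integral differs from the resolvent by
      \<open>?U (real n) ?x\<close>, which decays like \<open>q ^ n\<close>.\<close>
    then have eq: "U.orbit_integral (real n) y = ?x - ?U (real n) ?x" for n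
      by (simp add: linear_neg[OF bounded_linear.linear[OF U.orbit_integral_bounded_linear]] minus_equation_iff[of "U.orbit_integral _ _"])
    have pow: "norm (?U (real n) z) \<le> q ^ n * norm z" for n z
    proof (induction n arbitrary: z)
      case (Suc n)
      have "?U (real (Suc n)) z = ?U (real n) (?U 1 z)"
        using U.T_add[of "real n" 1 z] by (simp add: add.commute)
      then have "norm (?U (real (Suc n)) z) \<le> q ^ n * norm (?U 1 z)" using Suc by simp
      also have "\<dots> \<le> q ^ n * (q * norm z)" using q0 by (intro mult_left_mono q_le) auto
      finally show ?case by (simp add: mult_ac)
    qed (simp add: U.T_0)
    have "(\<lambda>n. ?U (real n) ?x) \<longlonglongrightarrow> 0"
    proof (rule Lim_null_comparison)
      show "\<forall>\<^sub>F n in sequentially. norm (?U (real n) ?x) \<le> q ^ n * norm ?x" using pow by auto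
      show "(\<lambda>n. q ^ n * norm ?x) \<longlonglongrightarrow> 0"
        using q q0 by (intro tendsto_mult_left_zero LIMSEQ_power_zero) simp
    qed
    then have "(\<lambda>n. ?x - ?U (real n) ?x) \<longlonglongrightarrow> ?x - 0" by (intro tendsto_intros)
    then show ?thesis unfolding eq by simp
  qed
qed

lemma right_of_spectral_bound:
  assumes "Re \<mu> > spectral_bound (generator T)"
  shows "\<mu> \<in> \<rho>"
proof (rule ccontr)
  assume "\<mu> \<notin> \<rho>"
  then have \<mu>: "Re \<mu> \<in> Re ` spectrum (generator T)" by (simp add: spectrum_def)
  \<comment> \<open>A real \<open>Sup\<close> bounds its set only if the set is bounded above;
    \<open>norm (T 1)\<close> is such a bound for the real parts of the spectrum.\<close>
  have "Re \<nu> \<le> norm (T 1)" if "\<nu> \<in> spectrum (generator T)" for \<nu>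
  proof (rule ccontr)
    assume "\<not> ?thesis"
    then have "\<nu> \<in> \<rho>" by (intro large_in_resolvent_set(1)) simp
    then show False using that by (simp add: spectrum_def)
  qed
  then have "bdd_above (Re ` spectrum (generator T))" by (auto simp: bdd_above_def)
  from cSup_upper[OF \<mu> this] show False using assms by (simp add: spectral_bound_def)
qed

end

section \<open>Domination of resolvents of eventually positive semigroups\<close>

text \<open>Riemann sums of nonnegative values lie in the positive cone, which is closed, and they
  approximate the gauge integral.\<close>

lemma has_integral_lattice_nonneg:
  fixes f :: "real \<Rightarrow> 'a::banach_lattice"
  assumes f: "(f has_integral y) {a..b}" and nn: "\<And>t. t \<in> {a..b} \<Longrightarrow> 0 \<le> f t"
  shows "0 \<le> y"
proof -
  have "\<exists>z\<in>{z. 0 \<le> z}. dist z y < e" if e: "e > 0" for e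
  proof -
    obtain \<gamma> where \<gamma>: "gauge \<gamma>" "\<And>\<D>. \<D> tagged_division_of {a..b} \<Longrightarrow> \<gamma> fine \<D> \<Longrightarrow>
        norm ((\<Sum>(x,k)\<in>\<D>. measure lborel k *\<^sub>R f x) - y) < e"
      using f e unfolding has_integral_real by metis
    obtain \<D> where \<D>: "\<D> tagged_division_of {a..b}" "\<gamma> fine \<D>"
      using fine_division_exists_real[OF \<gamma>(1)] by blast
    have "0 \<le> (\<Sum>(x,k)\<in>\<D>. measure lborel k *\<^sub>R f x)"
    proof (rule sum_nonneg)
      fix p assume p: "p \<in> \<D>"
      obtain x k where xk: "p = (x, k)" by (cases p)
      have "x \<in> {a..b}" using tag_in_interval[OF \<D>(1), of x k] p xk by simp
      then show "0 \<le> (case p of (x, k) \<Rightarrow> measure lborel k *\<^sub>R f x)"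
        by (simp add: xk scaleR_nonneg_nonneg nn)
    qed
    then show ?thesis using \<gamma>(2)[OF \<D>] by (auto simp: dist_norm)
  qed
  then have "y \<in> {z. 0 \<le> z}"
    using closed_lattice_nonneg closed_approachable by blast
  then show ?thesis by simp
qed

section \<open>The modulus under limits, sums and integrals\<close>

lemma bounded_linear_re: "bounded_linear (re :: 'a::banach_lattice complexification \<Rightarrow> 'a)"
  by (rule bounded_linear_intro[where K = 1]) (auto simp: norm_re_le)

lemma bounded_linear_im: "bounded_linear (im :: 'a::banach_lattice complexification \<Rightarrow> 'a)"
  by (rule bounded_linear_intro[where K = 1]) (auto simp: norm_im_le)

lemma bounded_linear_rotated: "bounded_linear (\<lambda>z. rotated z \<theta>)"
  unfolding rotated_def
  by (intro bounded_linear_add bounded_linear_compose[OF bounded_linear_scaleR_right] bounded_linear_re bounded_linear_im)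

lemma bounded_linear_Cplx: "bounded_linear (\<lambda>x::'a::banach_lattice. Cplx x 0)"
proof (rule bounded_linear_intro[where K = 1])
  show "norm (Cplx x 0) \<le> norm x * 1" for x :: 'a using norm_le_re_im[of "Cplx x 0"] by simp
qed (simp_all add: complexification_defs)

text \<open>Every rotation is a bounded real-linear map into the lattice, so in this form bounds on
  the modulus pass to limits and integrals.\<close>

lemma modulus_le_iff: "modulus z \<le> b \<longleftrightarrow> (\<forall>\<theta>. rotated z \<theta> \<le> b)"
  using modulus_least rotated_le_modulus order_trans by blast

lemma modulus_tendsto_le:
  assumes "(f \<longlongrightarrow> z) F" "(g \<longlongrightarrow> w) F" "\<forall>\<^sub>F n in F. modulus (f n) \<le> re (g n)" "F \<noteq> bot"
  shows "modulus z \<le> re w"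
  unfolding modulus_le_iff
proof
  fix \<theta>
  show "rotated z \<theta> \<le> re w"
  proof (rule tendsto_lattice_le)
    show "((\<lambda>n. rotated (f n) \<theta>) \<longlongrightarrow> rotated z \<theta>) F"
      by (rule bounded_linear.tendsto[OF bounded_linear_rotated assms(1)])
    show "((\<lambda>n. re (g n)) \<longlongrightarrow> re w) F"
      by (rule bounded_linear.tendsto[OF bounded_linear_re assms(2)])
    show "\<forall>\<^sub>F n in F. rotated (f n) \<theta> \<le> re (g n)"
      using assms(3) by eventually_elim (simp add: modulus_le_iff)
  qed (rule assms(4))
qed

lemma modulus_zero [simp]: "modulus 0 = 0"
  by (simp add: modulus_eq_0)

lemma modulus_sums_le:
  assumes f: "f sums z" and g: "g sums w" and le: "\<And>k. modulus (f k) \<le> re (g k)"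
  shows "modulus z \<le> re w"
proof (rule modulus_tendsto_le[where F = sequentially])
  show "(\<lambda>n. \<Sum>k<n. f k) \<longlonglongrightarrow> z" "(\<lambda>n. \<Sum>k<n. g k) \<longlonglongrightarrow> w"
    using f g by (simp_all add: sums_def)
  have "modulus (\<Sum>k<n. f k) \<le> re (\<Sum>k<n. g k)" for n
  proof (induction n)
    case 0
    then show ?case by simp
  next
    case (Suc n)
    have "modulus ((\<Sum>k<n. f k) + f n) \<le> modulus (\<Sum>k<n. f k) + modulus (f n)" by (rule modulus_triangle)
    also have "\<dots> \<le> re (\<Sum>k<n. g k) + re (g n)" by (intro add_mono Suc le)
    finally show ?case by simp
  qed
  then show "\<forall>\<^sub>F n in sequentially. modulus (\<Sum>k<n. f k) \<le> re (\<Sum>k<n. g k)" by simp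
qed simp

lemma modulus_integral_le:
  fixes f g :: "real \<Rightarrow> 'a::banach_lattice complexification"
  assumes f: "f integrable_on {a..b}" and g: "g integrable_on {a..b}"
    and le: "\<And>t. t \<in> {a..b} \<Longrightarrow> modulus (f t) \<le> re (g t)"
  shows "modulus (integral {a..b} f) \<le> re (integral {a..b} g)"
  unfolding modulus_le_iff
proof
  fix \<theta>
  have "((\<lambda>t. re (g t) - rotated (f t) \<theta>) has_integral re (integral {a..b} g) - rotated (integral {a..b} f) \<theta>) {a..b}"
    using has_integral_linear[OF integrable_integral[OF g] bounded_linear_re]
      has_integral_linear[OF integrable_integral[OF f] bounded_linear_rotated]
    by (intro has_integral_diff) (simp_all add: o_def)
  then have "0 \<le> re (integral {a..b} g) - rotated (integral {a..b} f) \<theta>"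
    by (rule has_integral_lattice_nonneg) (use le in \<open>auto simp: modulus_le_iff\<close>)
  then show "rotated (integral {a..b} f) \<theta> \<le> re (integral {a..b} g)" by simp
qed

lemma modulus_scaleR: "modulus (r *\<^sub>R z) = \<bar>r\<bar> *\<^sub>R modulus z"
  using modulus_scaleC[of "of_real r" z] by (simp add: scaleC_of_real)

lemma modulus_of_real: "modulus (Cplx x 0) = \<bar>x\<bar>"
  using modulus_le[of "Cplx x 0"] re_le_modulus[of "Cplx x 0"] by (auto intro: antisym)

locale eventually_positive_semigroup = c0_semigroup T
  for T :: "real \<Rightarrow> 'a::banach_lattice complexification \<Rightarrow>\<^sub>L 'a complexification" +
  fixes t\<^sub>0 :: real
  assumes real: "t \<ge> 0 \<Longrightarrow> im x = 0 \<Longrightarrow> im (T t x) = 0"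
    and t0: "t\<^sub>0 \<ge> 0"
    and positive: "t \<ge> t\<^sub>0 \<Longrightarrow> f \<ge> 0 \<Longrightarrow> T t f \<ge> 0"
begin

lemma re_T: "t \<ge> 0 \<Longrightarrow> re (T t z) = re (T t (Cplx (re z) 0))"
  and im_T: "t \<ge> 0 \<Longrightarrow> im (T t z) = re (T t (Cplx (im z) 0))"
proof -
  assume t: "t \<ge> 0"
  have "z = Cplx (re z) 0 + \<i> *\<^sub>C Cplx (im z) 0" by (simp add: complexification_defs)
  then have "T t z = T t (Cplx (re z) 0) + \<i> *\<^sub>C T t (Cplx (im z) 0)"
    using t by (metis T_scaleC blinfun.add_right)
  then show "re (T t z) = re (T t (Cplx (re z) 0))" "im (T t z) = re (T t (Cplx (im z) 0))"
    by (simp_all add: real t)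
qed

lemma re_T_mono:
  assumes t: "t \<ge> t\<^sub>0" and "re z \<le> re w"
  shows "re (T t z) \<le> re (T t w)"
proof -
  have "0 \<le> Cplx (re (w - z)) 0" using assms(2) by (simp add: less_eq_complexification_def)
  then have "0 \<le> re (T t (Cplx (re (w - z)) 0))"
    using positive[OF t] by (simp add: less_eq_complexification_def)
  then have "0 \<le> re (T t (w - z))" using re_T[of t "w - z"] t t0 by simp
  then show ?thesis by (simp add: blinfun.bilinear_simps)
qed

text \<open>A rotation is the real part of a complex multiple, which \<open>T t\<close>
  respects.\<close>

lemma rotated_T: "t \<ge> 0 \<Longrightarrow> rotated (T t z) \<theta> = re (T t (Cplx (rotated z \<theta>) 0))"
proof -
  assume t: "t \<ge> 0"
  have "re (cis (- \<theta>) *\<^sub>C y) = rotated y \<theta>" for y :: "'a complexification"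
    by (simp add: rotated_def)
  then have "rotated (T t z) \<theta> = re (T t (cis (- \<theta>) *\<^sub>C z))" "re (cis (- \<theta>) *\<^sub>C z) = rotated z \<theta>"
    using T_scaleC[OF t, of "cis (- \<theta>)" z] by metis+
  then show ?thesis using re_T[OF t, of "cis (- \<theta>) *\<^sub>C z"] by simp
qed

lemma modulus_T_le:
  assumes t: "t \<ge> t\<^sub>0" and le: "modulus f \<le> re g"
  shows "modulus (T t f) \<le> re (T t g)"
  unfolding modulus_le_iff
proof
  fix \<theta>
  have "re (T t (Cplx (rotated f \<theta>) 0)) \<le> re (T t g)"
    using le by (intro re_T_mono t) (simp add: modulus_le_iff)
  then show "rotated (T t f) \<theta> \<le> re (T t g)" using t t0 by (simp add: rotated_T)
qed

text \<open>The factor \<open>T t\<close> pushes the Laplace integral to times beyond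
  \<open>t\<^sub>0\<close>, where the semigroup is positive; the resolvent alone need not be. All
  powers are included because one Neumann step to the left involves all of them.\<close>

definition resolvent_dominated :: "real \<Rightarrow> real \<Rightarrow> bool"
  where "resolvent_dominated \<beta> x \<longleftrightarrow> (\<forall>t\<ge>t\<^sub>0. \<forall>n f g. modulus f \<le> re g \<longrightarrow>
    modulus (T t ((blinfun_apply (R (Complex x \<beta>)) ^^ n) f)) \<le> re (T t ((blinfun_apply (R (of_real x)) ^^ n) g)))"

lemma resolvent_dominated_large:
  assumes x: "x \<ge> norm (T 1)"
  shows "resolvent_dominated \<beta> x"
proof -
  let ?\<mu> = "Complex x \<beta>" and ?\<nu> = "complex_of_real x"
  interpret U: c0_semigroup "rescaled ?\<mu> T" by (rule c0_rescaled)
  interpret W: c0_semigroup "rescaled ?\<nu> T" by (rule c0_rescaled)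
  have lim1: "(\<lambda>n. T t (U.orbit_integral (real n) y)) \<longlonglongrightarrow> T t (R ?\<mu> y)"
    and lim2: "(\<lambda>n. T t (W.orbit_integral (real n) y)) \<longlonglongrightarrow> T t (R ?\<nu> y)" for t y
    using large_in_resolvent_set(2)[of ?\<mu> y] large_in_resolvent_set(2)[of ?\<nu> y] x
    by (auto intro!: tendsto_intros)
  have "modulus (T t ((blinfun_apply (R ?\<mu>) ^^ n) f)) \<le> re (T t ((blinfun_apply (R ?\<nu>) ^^ n) g))"
    if "t \<ge> t\<^sub>0" and fg: "modulus f \<le> re g" for t n f g
    using that(1)
  proof (induction n arbitrary: t)
    case 0
    then show ?case using modulus_T_le fg by simp
  next
    case (Suc n)
    define y z where "y = (blinfun_apply (R ?\<mu>) ^^ n) f" and "z = (blinfun_apply (R ?\<nu>) ^^ n) g"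
    have "modulus (T t (U.orbit_integral (real N) y)) \<le> re (T t (W.orbit_integral (real N) z))" for N
    proof -
      have 1: "T t (U.orbit_integral (real N) y) = integral {0..real N} (\<lambda>r. T t (rescaled ?\<mu> T r y))"
        using integral_linear[OF U.integrable_T[of 0 y "real N"] blinfun.bounded_linear_right[of "T t"]]
        by (simp add: U.orbit_integral_def o_def)
      have 2: "T t (W.orbit_integral (real N) z) = integral {0..real N} (\<lambda>r. T t (rescaled ?\<nu> T r z))"
        using integral_linear[OF W.integrable_T[of 0 z "real N"] blinfun.bounded_linear_right[of "T t"]]
        by (simp add: W.orbit_integral_def o_def)
      show ?thesis
        unfolding 1 2
      proof (rule modulus_integral_le)
        show "(\<lambda>r. T t (rescaled ?\<mu> T r y)) integrable_on {0..real N}"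
          using integrable_linear[OF U.integrable_T[of 0 y "real N"] blinfun.bounded_linear_right[of "T t"]]
          by (simp add: o_def)
        show "(\<lambda>r. T t (rescaled ?\<nu> T r z)) integrable_on {0..real N}"
          using integrable_linear[OF W.integrable_T[of 0 z "real N"] blinfun.bounded_linear_right[of "T t"]]
          by (simp add: o_def)
        fix r assume "r \<in> {0..real N}"
        then have r: "r \<ge> 0" by simp
        have t: "t \<ge> 0" using Suc.prems t0 by simp
        have a: "T t (rescaled \<mu> T r v) = exp (- \<mu> * of_real r) *\<^sub>C T (t + r) v" for \<mu> v
          using t r by (simp add: rescaled_apply T_scaleC T_add)
        have ab: "cmod (exp (- ?\<mu> * of_real r)) = exp (- x * r)" by (simp add: norm_exp_eq_Re)
        have real_exp: "exp (- ?\<nu> * of_real r) *\<^sub>C v = exp (- x * r) *\<^sub>R v" for v :: "'a complexification"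
          by (metis exp_of_real of_real_minus of_real_mult scaleC_of_real)
        \<comment> \<open>The induction hypothesis is used at the later time \<open>t + r\<close>,
          which is why the induction keeps \<open>t\<close> arbitrary.\<close>
        have "modulus (T (t + r) y) \<le> re (T (t + r) z)"
          unfolding y_def z_def using Suc.prems r by (intro Suc.IH) simp
        then show "modulus (T t (rescaled ?\<mu> T r y)) \<le> re (T t (rescaled ?\<nu> T r z))"
          unfolding a real_exp modulus_scaleC ab re_im_simps by (intro scaleR_left_mono) simp_all
      qed
    qed
    then have "modulus (T t (R ?\<mu> y)) \<le> re (T t (R ?\<nu> z))"
      by (intro modulus_tendsto_le[OF lim1 lim2]) simp_all
    then show ?case by (simp add: y_def z_def)
  qed
  then show ?thesis by (simp add: resolvent_dominated_def)
qed

lemma resolvent_dominated_step: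
  assumes x: "resolvent_dominated \<beta> x" and y: "y \<le> x"
    and mem: "Complex x \<beta> \<in> \<rho>" "Complex y \<beta> \<in> \<rho>" "of_real x \<in> \<rho>" "of_real y \<in> \<rho>"
    and small: "(x - y) * norm (R (Complex x \<beta>)) < 1" "(x - y) * norm (R (of_real x)) < 1"
  shows "resolvent_dominated \<beta> y"
proof -
  define Rx Ry Sx Sy where "Rx = R (Complex x \<beta>)" and "Ry = R (Complex y \<beta>)"
    and "Sx = R (of_real x)" and "Sy = R (of_real y)"
  have d: "Complex x \<beta> - Complex y \<beta> = of_real (x - y)" by (simp add: complex_eq_iff)
  have cm: "cmod (of_real (x - y)) = x - y" using y by (simp del: of_real_diff)
  have R_sums: "(\<lambda>k. (x - y) ^ k *\<^sub>R (blinfun_apply Rx ^^ Suc k) f) sums Ry f" for f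
  proof -
    have "(\<lambda>k. (of_real (x - y)) ^ k *\<^sub>C (blinfun_apply Rx ^^ Suc k) f) sums Ry f"
      using resolvent_neumann[OF mem(1,2), of f, unfolded d cm, OF small(1)] unfolding Rx_def Ry_def .
    then show ?thesis by (simp only: scaleC_of_real flip: of_real_power)
  qed
  have S_sums: "(\<lambda>k. (x - y) ^ k *\<^sub>R (blinfun_apply Sx ^^ Suc k) f) sums Sy f" for f
  proof -
    have "(\<lambda>k. (of_real (x - y)) ^ k *\<^sub>C (blinfun_apply Sx ^^ Suc k) f) sums Sy f"
      using resolvent_neumann[OF mem(3,4), of f, unfolded of_real_diff[symmetric] cm, OF small(2)]
      unfolding Sx_def Sy_def .
    then show ?thesis by (simp only: scaleC_of_real flip: of_real_power)
  qed
  \<comment> \<open>The powers of the resolvents at \<open>y\<close> are expanded one at a time into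
    series of powers at \<open>x\<close>; hence the mixed products and the arbitrary
    \<open>m\<close>.\<close>
  have "modulus (T t ((blinfun_apply Ry ^^ n) ((blinfun_apply Rx ^^ m) f)))
      \<le> re (T t ((blinfun_apply Sy ^^ n) ((blinfun_apply Sx ^^ m) g)))"
    if t: "t \<ge> t\<^sub>0" and fg: "modulus f \<le> re g" for t n m f g
  proof (induction n arbitrary: m)
    case 0
    then show ?case using x t fg unfolding resolvent_dominated_def Rx_def Sx_def by simp
  next
    case (Suc n)
    define LR where "LR v = T t ((blinfun_apply Ry ^^ n) v)" for v
    define LS where "LS v = T t ((blinfun_apply Sy ^^ n) v)" for v
    have lin: "bounded_linear LR" "bounded_linear LS"
      unfolding LR_def LS_def
      by (intro bounded_linear_compose[OF blinfun.bounded_linear_right] funpow_blinfun_linear)+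
    have "modulus (LR (Ry ((blinfun_apply Rx ^^ m) f))) \<le> re (LS (Sy ((blinfun_apply Sx ^^ m) g)))"
    proof (rule modulus_sums_le)
      show "(\<lambda>k. LR ((x - y) ^ k *\<^sub>R (blinfun_apply Rx ^^ Suc k) ((blinfun_apply Rx ^^ m) f)))
          sums LR (Ry ((blinfun_apply Rx ^^ m) f))"
        by (rule bounded_linear.sums[OF lin(1) R_sums])
      show "(\<lambda>k. LS ((x - y) ^ k *\<^sub>R (blinfun_apply Sx ^^ Suc k) ((blinfun_apply Sx ^^ m) g)))
          sums LS (Sy ((blinfun_apply Sx ^^ m) g))"
        by (rule bounded_linear.sums[OF lin(2) S_sums])
      fix k
      have "modulus (LR ((blinfun_apply Rx ^^ (Suc k + m)) f)) \<le> re (LS ((blinfun_apply Sx ^^ (Suc k + m)) g))"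
        unfolding LR_def LS_def by (rule Suc.IH)
      then show "modulus (LR ((x - y) ^ k *\<^sub>R (blinfun_apply Rx ^^ Suc k) ((blinfun_apply Rx ^^ m) f)))
          \<le> re (LS ((x - y) ^ k *\<^sub>R (blinfun_apply Sx ^^ Suc k) ((blinfun_apply Sx ^^ m) g)))"
        using y unfolding linear_cmul[OF bounded_linear.linear[OF lin(1)]] linear_cmul[OF bounded_linear.linear[OF lin(2)]] modulus_scaleR
          re_im_simps funpow_add o_apply
        by (simp add: scaleR_left_mono)
    qed
    then show ?case by (simp add: LR_def LS_def funpow_swap1)
  qed
  from this[where m = 0] show ?thesis
    by (simp add: resolvent_dominated_def Ry_def Sy_def)
qed

text \<open>Only real resolvent steps are used: the Neumann series around \<open>x\<close> has nonnegative coefficients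
  to the left of \<open>x\<close>, so domination propagates from large \<open>x\<close> down to the spectral bound.\<close>

lemma resolvent_dominated:
  assumes x: "x > spectral_bound (generator T)"
  shows "resolvent_dominated \<beta> x"
proof -
  define b where "b = max x (norm (T 1))"
  have mem: "Complex y \<beta> \<in> \<rho>" "of_real y \<in> \<rho>" if "y > spectral_bound (generator T)" for y
    using that by (auto intro: right_of_spectral_bound)
  have "x \<le> b" by (simp add: b_def)
  then have "resolvent_dominated \<beta> b \<longrightarrow> resolvent_dominated \<beta> x"
  proof (induction rule: Bolzano)
    case (trans p q r)
    then show ?case by blast
  next
    \<comment> \<open>One \<open>d\<close> has to serve for all short intervals around
      \<open>y\<close>, so the resolvents must be bounded uniformly near \<open>y\<close>.\<close>
    case (local y)
    define K where "K = 1 + norm (R (Complex y \<beta>)) + norm (R (of_real y))"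
    \<comment> \<open>The first term keeps all points to the right of the spectral bound. By the
      second, the resolvents at \<open>q\<close> have norm at most \<open>2 * K\<close> and
      \<open>(q - p) * (2 * K) < 1\<close>, as the Neumann step from \<open>q\<close> to
      \<open>p\<close> requires.\<close>
    define d where "d = min (x - spectral_bound (generator T)) (1 / (2 * K))"
    have K: "K \<ge> 1" "norm (R (Complex y \<beta>)) \<le> K" "norm (R (of_real y)) \<le> K" by (auto simp: K_def)
    have d: "d > 0" "d \<le> x - spectral_bound (generator T)" "d * K \<le> 1/2"
      using x K(1) by (auto simp: d_def min_def field_simps)
    have "resolvent_dominated \<beta> p" if pq: "p \<le> y" "y \<le> q" "q - p < d" and q: "resolvent_dominated \<beta> q" for p q
    proof (rule resolvent_dominated_step[OF q])
      have big: "p > spectral_bound (generator T)" "q > spectral_bound (generator T)" "y > spectral_bound (generator T)"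
        using pq d(2) local x by linarith+
      show "Complex q \<beta> \<in> \<rho>" "Complex p \<beta> \<in> \<rho>" "of_real q \<in> \<rho>" "of_real p \<in> \<rho>" using big mem by auto
      have "norm (R \<mu>) \<le> 2 * K" if \<nu>: "\<nu> \<in> \<rho>" "norm (R \<nu>) \<le> K" "\<mu> \<in> \<rho>" "cmod (\<nu> - \<mu>) \<le> q - p" for \<mu> \<nu>
      proof -
        have "cmod (\<nu> - \<mu>) * norm (R \<nu>) \<le> d * K" using \<nu> pq d by (intro mult_mono) auto
        then show ?thesis using norm_resolvent_le[OF \<nu>(1,3)] \<nu>(2) d(3) by linarith
      qed
      note bnd = this
      have "cmod (Complex y \<beta> - Complex q \<beta>) \<le> q - p" "cmod (of_real y - complex_of_real q) \<le> q - p"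
        using pq by (simp_all add: cmod_def flip: of_real_diff)
      then have "norm (R (Complex q \<beta>)) \<le> 2 * K" "norm (R (of_real q)) \<le> 2 * K"
        using bnd[of "Complex y \<beta>" "Complex q \<beta>"] bnd[of "of_real y" "of_real q"] mem big K by auto
      moreover have "(q - p) * (2 * K) < 1"
      proof -
        have "(q - p) * (2 * K) < d * (2 * K)" using pq K by (intro mult_strict_right_mono) auto
        then show ?thesis using d(3) by linarith
      qed
      ultimately show "(q - p) * norm (R (Complex q \<beta>)) < 1" "(q - p) * norm (R (of_real q)) < 1"
        using pq by (meson diff_ge_0_iff_ge le_less_trans mult_left_mono order_trans)+
    qed (use pq in simp)
    then show ?case using d(1) by blast
  qed
  moreover have "resolvent_dominated \<beta> b" by (rule resolvent_dominated_large) (simp add: b_def)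
  ultimately show ?thesis by blast
qed

lemma modulus_T_resolvent_le:
  assumes "x > spectral_bound (generator T)" "t \<ge> t\<^sub>0" "modulus f \<le> re g"
  shows "modulus (T t (R (Complex x \<beta>) f)) \<le> re (T t (R (of_real x) g))"
proof -
  have "modulus (T t ((blinfun_apply (R (Complex x \<beta>)) ^^ 1) f)) \<le> re (T t ((blinfun_apply (R (of_real x)) ^^ 1) g))"
    using resolvent_dominated[OF assms(1), of \<beta>] assms(2,3) unfolding resolvent_dominated_def by blast
  then show ?thesis by simp
qed

end

section \<open>Poles of the resolvent\<close>

text \<open>Terms that are bounded at a single radius \<open>c\<close> have a geometric majorant of
  ratio \<open>cmod z / c\<close>, so the tail after \<open>Q 0\<close> is of order
  \<open>cmod z\<close>.\<close>

lemma power_series_tendsto: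
  fixes Q :: "nat \<Rightarrow> 'a::{complex_normed_vector, banach}"
  assumes r: "r > 0" and F: "\<And>z. 0 < cmod z \<Longrightarrow> cmod z < r \<Longrightarrow> (\<lambda>k. z ^ k *\<^sub>C Q k) sums F z"
  shows "(F \<longlongrightarrow> Q 0) (at 0)"
proof -
  define c where "c = r / 2"
  have c: "0 < c" "c < r" using r by (auto simp: c_def)
  have "(\<lambda>k. of_real c ^ k *\<^sub>C Q k) sums F (of_real c)" using c by (intro F) auto
  then have "Bseq (\<lambda>k. of_real c ^ k *\<^sub>C Q k)"
    using sums_summable summable_LIMSEQ_zero convergentI convergent_imp_Bseq by blast
  then obtain M where M: "M > 0" "\<And>k. c ^ k * norm (Q k) \<le> M"
    using c unfolding Bseq_def by (auto simp: norm_scaleC norm_power)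
  have bound: "norm (F z - Q 0) \<le> 2 * M / c * cmod z" if z: "0 < cmod z" "cmod z < c / 2" for z
  proof -
    define q where "q = cmod z / c"
    have q: "0 < q" "q < 1/2" using z c by (auto simp: q_def field_simps)
    have "(\<lambda>k. z ^ Suc k *\<^sub>C Q (Suc k)) sums (F z - z ^ 0 *\<^sub>C Q 0)"
      using F[of z] z c by (subst sums_Suc_iff) auto
    moreover have "(\<lambda>k. M * q * q ^ k) sums (M * q * (1 / (1 - q)))"
      using q by (intro sums_mult geometric_sums) auto
    moreover have "norm (z ^ Suc k *\<^sub>C Q (Suc k)) \<le> M * q * q ^ k" for k
    proof -
      have "norm (z ^ Suc k *\<^sub>C Q (Suc k)) = q ^ Suc k * (c ^ Suc k * norm (Q (Suc k)))"
        using c by (simp add: norm_scaleC norm_mult norm_power q_def power_divide)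
      also have "\<dots> \<le> q ^ Suc k * M" using q by (intro mult_left_mono M) auto
      finally show ?thesis by (simp add: mult_ac)
    qed
    ultimately have "norm (F z - z ^ 0 *\<^sub>C Q 0) \<le> M * q * (1 / (1 - q))" using norm_sums_le by blast
    also have "\<dots> \<le> M * q * 2" using q M by (intro mult_left_mono) (auto simp: field_simps)
    also have "\<dots> = 2 * M / c * cmod z" by (simp add: q_def)
    finally show ?thesis by (simp add: scaleC_one)
  qed
  have "((\<lambda>z. F z - Q 0) \<longlongrightarrow> 0) (at 0)"
  proof (rule Lim_null_comparison)
    show "\<forall>\<^sub>F z in at 0. norm (F z - Q 0) \<le> 2 * M / c * cmod z"
      unfolding eventually_at using bound c by (intro exI[of _ "c / 2"]) auto
    show "((\<lambda>z. 2 * M / c * cmod z) \<longlongrightarrow> 0) (at 0)"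
      using c by (auto intro!: tendsto_eq_intros)
  qed
  then show ?thesis by (rule LIM_zero_cancel)
qed

lemma tendsto_modulus:
  fixes f :: "'b \<Rightarrow> 'a::banach_lattice complexification"
  assumes "(f \<longlongrightarrow> z) F"
  shows "((\<lambda>n. modulus (f n)) \<longlongrightarrow> modulus z) F"
proof -
  have le: "modulus v - modulus w \<le> modulus (v - w)" for v w :: "'a complexification"
    using modulus_triangle[of "v - w" w] by (simp add: algebra_simps)
  have "\<bar>modulus v - modulus w\<bar> \<le> modulus (v - w)" for v w :: "'a complexification"
    using le[of v w] le[of w v] modulus_scaleR[of "-1" "v - w"] by (intro abs_leI) simp_all
  from lattice_norm_le_of_abs_le[OF this]
  have norm: "norm (modulus v - modulus w) \<le> norm (v - w)" for v w :: "'a complexification"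
    by (simp add: norm_complexification_def)
  have "((\<lambda>n. norm (f n - z)) \<longlongrightarrow> 0) F" using assms by (simp add: LIM_zero tendsto_norm_zero)
  then have "((\<lambda>n. modulus (f n) - modulus z) \<longlongrightarrow> 0) F"
    by (rule Lim_null_comparison[rotated]) (simp add: norm)
  then show ?thesis by (rule LIM_zero_cancel)
qed

section \<open>Leading Laurent coefficients\<close>

context c0_semigroup
begin

text \<open>This keeps of the Laurent expansion what domination can use: the strong limit from the
  right along the horizontal ray. \<open>Q = 0\<close> is allowed; that \<open>Q\<close> is nonzero
  is recorded separately.\<close>

definition leading_coefficient :: "complex \<Rightarrow> nat \<Rightarrow> ('a \<Rightarrow>\<^sub>L 'a) \<Rightarrow> bool"
  where "leading_coefficient \<mu> n Q \<longleftrightarrow> n \<ge> 1 \<and> (\<forall>\<^sub>F e in at_right 0. \<mu> + of_real e \<in> \<rho>) \<and>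
    (\<forall>x. ((\<lambda>e. of_real e ^ n *\<^sub>C R (\<mu> + of_real e) x) \<longlongrightarrow> Q x) (at_right 0))"

lemma pole_leading_coefficient:
  assumes "resolvent_pole_of_order (generator T) \<mu> n"
  obtains Q r where "leading_coefficient \<mu> n Q" "Q \<noteq> 0" "r > 0"
    "\<And>\<nu>. 0 < cmod (\<nu> - \<mu>) \<Longrightarrow> cmod (\<nu> - \<mu>) < r \<Longrightarrow> \<nu> \<in> \<rho>"
proof -
  obtain r Q where n: "n \<ge> 1" and r: "r > 0" and Q0: "Q 0 \<noteq> 0"
    and mem: "\<And>\<nu>. 0 < cmod (\<nu> - \<mu>) \<Longrightarrow> cmod (\<nu> - \<mu>) < r \<Longrightarrow> \<nu> \<in> \<rho>"
    and laurent: "\<And>\<nu>. 0 < cmod (\<nu> - \<mu>) \<Longrightarrow> cmod (\<nu> - \<mu>) < r \<Longrightarrow>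
      (\<lambda>k. ((\<nu> - \<mu>) powi (int k - int n)) *\<^sub>C Q k) sums R \<nu>"
    using assms unfolding resolvent_pole_of_order_def by blast
  have "((\<lambda>z. z ^ n *\<^sub>C R (\<mu> + z)) \<longlongrightarrow> Q 0) (at 0)"
  proof (rule power_series_tendsto[OF r])
    fix z assume z: "0 < cmod z" "cmod z < r"
    have "(\<lambda>k. z ^ n *\<^sub>C (z powi (int k - int n)) *\<^sub>C Q k) sums (z ^ n *\<^sub>C R (\<mu> + z))"
      using laurent[of "\<mu> + z"] z by (intro bounded_linear.sums[OF bounded_linear_scaleC]) simp
    moreover have "z ^ n *\<^sub>C (z powi (int k - int n)) *\<^sub>C Q k = z ^ k *\<^sub>C Q k" for k
      using z by (simp add: scaleC_scaleC power_int_diff)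
    ultimately show "(\<lambda>k. z ^ k *\<^sub>C Q k) sums (z ^ n *\<^sub>C R (\<mu> + z))" by simp
  qed
  moreover have "filterlim complex_of_real (at 0) (at_right 0)"
    unfolding filterlim_at by (auto intro!: tendsto_eq_intros eventually_at_rightI[of 0 1])
  ultimately have lim: "((\<lambda>e. of_real e ^ n *\<^sub>C R (\<mu> + of_real e)) \<longlongrightarrow> Q 0) (at_right 0)"
    by (rule filterlim_compose)
  have "((\<lambda>e. of_real e ^ n *\<^sub>C R (\<mu> + of_real e) x) \<longlongrightarrow> Q 0 x) (at_right 0)" for x
    using blinfun.tendsto[OF lim tendsto_const[of x]] by (simp add: scaleC_blinfun.rep_eq)
  moreover have "\<forall>\<^sub>F e in at_right 0. \<mu> + of_real e \<in> \<rho>"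
    using r by (intro eventually_at_rightI[of 0 r] mem) auto
  ultimately have "leading_coefficient \<mu> n (Q 0)"
    using n by (simp add: leading_coefficient_def)
  then show thesis using that Q0 r mem by blast
qed

text \<open>The first identity is the resolvent identity, multiplied by \<open>e ^ n\<close>, in the
  limit. It shows that \<open>R (\<mu> + e)\<close> acts on the range of \<open>Q\<close> as
  division by \<open>e\<close>; for \<open>n \<ge> 2\<close> the factor \<open>e ^ n\<close> then
  makes the limit 0.\<close>

lemma
  assumes Q: "leading_coefficient \<mu> n Q"
  shows leading_coefficient_resolvent: "\<nu> \<in> \<rho> \<Longrightarrow> Q x = (\<nu> - \<mu>) *\<^sub>C R \<nu> (Q x)"
    and leading_coefficient_generates: "generates T (Q x) (\<mu> *\<^sub>C Q x)"
    and leading_coefficient_T: "t \<ge> 0 \<Longrightarrow> Q (T t x) = T t (Q x)"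
    and leading_coefficient_nilpotent: "n \<ge> 2 \<Longrightarrow> Q (Q x) = 0"
proof -
  have n: "n \<ge> 1" and mem: "\<forall>\<^sub>F e in at_right 0. \<mu> + of_real e \<in> \<rho>"
    and lim: "\<And>x. ((\<lambda>e. of_real e ^ n *\<^sub>C R (\<mu> + of_real e) x) \<longlongrightarrow> Q x) (at_right 0)"
    using Q by (auto simp: leading_coefficient_def)
  have of_real0: "((\<lambda>e. complex_of_real e ^ k) \<longlongrightarrow> 0) (at_right 0)" if "k \<ge> 1" for k
  proof -
    have "((\<lambda>e. complex_of_real e ^ k) \<longlongrightarrow> of_real 0 ^ k) (at_right 0)" by (intro tendsto_intros)
    then show ?thesis using that by (simp add: power_0_left)
  qed
  show res: "Q x = (\<nu> - \<mu>) *\<^sub>C R \<nu> (Q x)" if \<nu>: "\<nu> \<in> \<rho>" for \<nu> x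
  proof (rule tendsto_unique[OF _ lim])
    have "((\<lambda>e. of_real e ^ n *\<^sub>C R \<nu> x + (\<nu> - (\<mu> + of_real e)) *\<^sub>C R \<nu> (of_real e ^ n *\<^sub>C R (\<mu> + of_real e) x))
        \<longlongrightarrow> 0 *\<^sub>C R \<nu> x + (\<nu> - (\<mu> + of_real 0)) *\<^sub>C R \<nu> (Q x)) (at_right 0)"
      by (intro tendsto_intros lim of_real0 n)
    then have "((\<lambda>e. of_real e ^ n *\<^sub>C R \<nu> x + (\<nu> - (\<mu> + of_real e)) *\<^sub>C R \<nu> (of_real e ^ n *\<^sub>C R (\<mu> + of_real e) x))
        \<longlongrightarrow> (\<nu> - \<mu>) *\<^sub>C R \<nu> (Q x)) (at_right 0)" by simp
    then show "((\<lambda>e. of_real e ^ n *\<^sub>C R (\<mu> + of_real e) x) \<longlongrightarrow> (\<nu> - \<mu>) *\<^sub>C R \<nu> (Q x)) (at_right 0)"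
    proof (rule Lim_transform_eventually)
      show "\<forall>\<^sub>F e in at_right 0. of_real e ^ n *\<^sub>C R \<nu> x + (\<nu> - (\<mu> + of_real e)) *\<^sub>C R \<nu> (of_real e ^ n *\<^sub>C R (\<mu> + of_real e) x)
          = of_real e ^ n *\<^sub>C R (\<mu> + of_real e) x"
        using mem
      proof eventually_elim
        case (elim e)
        have "of_real e ^ n *\<^sub>C R (\<mu> + of_real e) x
            = of_real e ^ n *\<^sub>C (R \<nu> x + (\<nu> - (\<mu> + of_real e)) *\<^sub>C R \<nu> (R (\<mu> + of_real e) x))"
          by (rule arg_cong[OF resolvent_identity[OF \<nu> elim]])
        also have "\<dots> = of_real e ^ n *\<^sub>C R \<nu> x + (\<nu> - (\<mu> + of_real e)) *\<^sub>C R \<nu> (of_real e ^ n *\<^sub>C R (\<mu> + of_real e) x)"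
          by (simp only: scaleC_add_right resolvent_scaleC[OF \<nu>] scaleC_scaleC mult.commute)
        finally show ?case by (rule sym)
      qed
    qed
  qed simp
  obtain e where e: "e > 0" "\<mu> + complex_of_real e \<in> \<rho>"
    using eventually_happens[OF eventually_conj[OF mem eventually_at_right_less]] by auto
  show gen: "generates T (Q x) (\<mu> *\<^sub>C Q x)" for x
  proof -
    let ?\<nu> = "\<mu> + complex_of_real e"
    have "generates T ((?\<nu> - \<mu>) *\<^sub>C R ?\<nu> (Q x)) ((?\<nu> - \<mu>) *\<^sub>C (?\<nu> *\<^sub>C R ?\<nu> (Q x) - Q x))"
      by (intro generates_scaleC generates_resolvent e)
    moreover have "(?\<nu> - \<mu>) *\<^sub>C (?\<nu> *\<^sub>C R ?\<nu> (Q x) - Q x) = ?\<nu> *\<^sub>C ((?\<nu> - \<mu>) *\<^sub>C R ?\<nu> (Q x)) - (?\<nu> - \<mu>) *\<^sub>C Q x"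
      by (simp add: scaleC_diff_right scaleC_scaleC mult.commute)
    ultimately have "generates T (Q x) (?\<nu> *\<^sub>C Q x - (?\<nu> - \<mu>) *\<^sub>C Q x)"
      unfolding res[OF e(2), symmetric] by simp
    then show ?thesis by (simp add: scaleC_diff_left scaleC_add_left)
  qed
  show "Q (T t x) = T t (Q x)" if t: "t \<ge> 0"
  proof (rule tendsto_unique[OF _ lim])
    have "((\<lambda>e. T t (of_real e ^ n *\<^sub>C R (\<mu> + of_real e) x)) \<longlongrightarrow> T t (Q x)) (at_right 0)"
      by (intro tendsto_intros lim)
    then show "((\<lambda>e. of_real e ^ n *\<^sub>C R (\<mu> + of_real e) (T t x)) \<longlongrightarrow> T t (Q x)) (at_right 0)"
      by (rule Lim_transform_eventually)
        (use mem in eventually_elim, simp add: resolvent_T_commute t T_scaleC)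
  qed simp
  show "Q (Q x) = 0" if "n \<ge> 2"
  proof (rule tendsto_unique[OF _ lim])
    have "((\<lambda>e. of_real e ^ (n - 1) *\<^sub>C Q x) \<longlongrightarrow> 0 *\<^sub>C Q x) (at_right 0)"
      using that by (intro tendsto_intros of_real0) auto
    then have "((\<lambda>e. of_real e ^ (n - 1) *\<^sub>C Q x) \<longlongrightarrow> 0) (at_right 0)" by simp
    then show "((\<lambda>e. of_real e ^ n *\<^sub>C R (\<mu> + of_real e) (Q x)) \<longlongrightarrow> 0) (at_right 0)"
    proof (rule Lim_transform_eventually)
      show "\<forall>\<^sub>F e in at_right 0. of_real e ^ (n - 1) *\<^sub>C Q x = of_real e ^ n *\<^sub>C R (\<mu> + of_real e) (Q x)"
        using mem
      proof eventually_elim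
        case (elim e)
        have "of_real e ^ (n - 1) *\<^sub>C Q x = of_real e ^ (n - 1) *\<^sub>C of_real e *\<^sub>C R (\<mu> + of_real e) (Q x)"
          using arg_cong[OF res[OF elim, of x], of "scaleC (of_real e ^ (n - 1))"] by simp
        also have "of_real e ^ (n - 1) * complex_of_real e = of_real e ^ n"
          using n by (metis One_nat_def Suc_pred less_eq_Suc_le power_Suc2 zero_less_Suc)
        then have "of_real e ^ (n - 1) *\<^sub>C of_real e *\<^sub>C R (\<mu> + of_real e) (Q x) = of_real e ^ n *\<^sub>C R (\<mu> + of_real e) (Q x)"
          by (simp only: scaleC_scaleC)
        finally show ?case .
      qed
    qed
  qed simp
qed

end

text \<open>Discreteness makes the infimum of the positive elements a member of the group, and
  division with remainder by it does the rest. The trivial group has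
  \<open>\<alpha> = 0\<close>.\<close>

lemma discrete_additive_subgroup_cyclic:
  fixes E :: "real set"
  assumes zero: "0 \<in> E" and diff: "\<And>x y. x \<in> E \<Longrightarrow> y \<in> E \<Longrightarrow> x - y \<in> E"
    and r: "r > 0" and discrete: "\<And>x. x \<in> E \<Longrightarrow> \<bar>x\<bar> < r \<Longrightarrow> x = 0"
  shows "\<exists>\<alpha>\<ge>0. E = {\<alpha> * of_int k | k. True}"
proof (cases "E = {0}")
  case True
  then show ?thesis by (intro exI[of _ 0]) auto
next
  case False
  have neg: "- x \<in> E" if "x \<in> E" for x using diff[OF zero that] by simp
  have add: "x + y \<in> E" if "x \<in> E" "y \<in> E" for x y using diff[OF that(1) neg[OF that(2)]] by simp
  define C where "C = {x \<in> E. x > 0}"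
  obtain x where x: "x \<in> E" "x \<noteq> 0" using False zero by auto
  have Cne: "C \<noteq> {}"
    using x neg[OF x(1)] by (cases "x > 0") (auto simp: C_def)
  have Cr: "r \<le> x" if "x \<in> C" for x using that discrete[of x] by (force simp: C_def)
  have bdd: "bdd_below C" using Cr by (auto simp: bdd_below_def)
  define \<alpha> where "\<alpha> = Inf C"
  have \<alpha>r: "r \<le> \<alpha>" unfolding \<alpha>_def using Cne Cr by (rule cInf_greatest)
  \<comment> \<open>Two elements of \<open>C\<close> between \<open>\<alpha>\<close> and
    \<open>\<alpha> + r\<close> differ by less than \<open>r\<close>, so they coincide; hence the
    infimum is attained.\<close>
  obtain p where p: "p \<in> C" "p < \<alpha> + r"
    using cInf_less_iff[OF Cne bdd, of "\<alpha> + r"] r by (auto simp: \<alpha>_def)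
  have "p = \<alpha>"
  proof (rule ccontr)
    assume "p \<noteq> \<alpha>"
    then have "\<alpha> < p" using cInf_lower[OF p(1) bdd] by (simp add: \<alpha>_def)
    then obtain q where q: "q \<in> C" "q < p"
      using cInf_less_iff[OF Cne bdd, of p] by (auto simp: \<alpha>_def)
    have "\<alpha> \<le> q" using cInf_lower[OF q(1) bdd] by (simp add: \<alpha>_def)
    then have "p - q = 0" using p q by (intro discrete diff) (auto simp: C_def)
    then show False using q(2) by simp
  qed
  then have \<alpha>: "\<alpha> \<in> E" "\<alpha> > 0" using p(1) by (auto simp: C_def)
  have nat: "real n * \<alpha> \<in> E" for n
    by (induction n) (auto simp: zero algebra_simps intro: add \<alpha>)
  have int: "\<alpha> * of_int k \<in> E" for k
    using nat neg[OF nat] by (cases k rule: int_cases2) (simp_all add: mult.commute)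
  have "x \<in> {\<alpha> * of_int k | k. True}" if x: "x \<in> E" for x
  proof -
    define k where "k = \<lfloor>x / \<alpha>\<rfloor>"
    have "of_int k \<le> x / \<alpha>" "x / \<alpha> < of_int k + 1" unfolding k_def by linarith+
    then have k: "0 \<le> x - \<alpha> * of_int k" "x - \<alpha> * of_int k < \<alpha>"
      using \<alpha>(2) by (simp_all add: pos_le_divide_eq pos_divide_less_eq algebra_simps)
    have mem: "x - \<alpha> * of_int k \<in> E" by (intro diff x int)
    have "x - \<alpha> * of_int k = 0"
    proof (rule ccontr)
      assume "x - \<alpha> * of_int k \<noteq> 0"
      then have "x - \<alpha> * of_int k \<in> C" using mem k by (simp add: C_def)
      from cInf_lower[OF this bdd] show False using k(2) by (simp add: \<alpha>_def)
    qed
    then show ?thesis by auto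
  qed
  then show ?thesis using int \<alpha>(2) by (intro exI[of _ \<alpha>]) auto
qed

section \<open>The peripheral spectrum\<close>

locale irreducible_pole_semigroup = eventually_positive_semigroup T t\<^sub>0
  for T :: "real \<Rightarrow> 'a::banach_lattice complexification \<Rightarrow>\<^sub>L 'a complexification" and t\<^sub>0 +
  fixes s :: real and n :: nat and Q :: "'a complexification \<Rightarrow>\<^sub>L 'a complexification"
  assumes s: "s = spectral_bound (generator T)"
    and leading: "leading_coefficient (of_real s) n Q"
    and Q_nonzero: "Q \<noteq> 0"
    and irreducible: "persistently_irreducible T"
begin

text \<open>The semigroup on the real lattice, rescaled so that the eigenvalue \<open>s\<close>
  becomes 0.\<close>

definition G :: "real \<Rightarrow> 'a \<Rightarrow> 'a"
  where "G t f = exp (- s * t) *\<^sub>R re (T t (Cplx f 0))"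

definition P :: "'a \<Rightarrow> 'a"
  where "P f = re (Q (Cplx f 0))"

lemma T_eq_G:
  assumes "t \<ge> 0"
  shows "T t z = exp (s * t) *\<^sub>R Cplx (G t (re z)) (G t (im z))"
proof (rule complexification.expand, intro conjI)
  have e: "exp (s * t) * exp (- s * t) = 1" by (simp flip: exp_add)
  show "re (T t z) = re (exp (s * t) *\<^sub>R Cplx (G t (re z)) (G t (im z)))"
    using re_T[OF assms, of z] e by (simp add: G_def)
  show "im (T t z) = im (exp (s * t) *\<^sub>R Cplx (G t (re z)) (G t (im z)))"
    using im_T[OF assms, of z] e by (simp add: G_def)
qed

lemma T_Q: "t \<ge> 0 \<Longrightarrow> T t (Q x) = exp (s * t) *\<^sub>R Q x"
  using leading_coefficient_generates[OF leading, of x] eigenvector_iff_orbit[of "Q x" "of_real s"]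
  by (metis exp_of_real of_real_mult scaleC_of_real)

text \<open>As \<open>0 ^ 0 = 1\<close>, the bound is \<open>T t (Q g)\<close> for \<open>m = n\<close>, and it vanishes for \<open>m > n\<close>.\<close>

lemma leading_coefficient_dominated:
  assumes L: "leading_coefficient (Complex s \<beta>) m L" and m: "m \<ge> n" and t: "t \<ge> t\<^sub>0" and fg: "modulus f \<le> re g"
  shows "modulus (T t (L f)) \<le> re (0 ^ (m - n) *\<^sub>R T t (Q g))"
proof (rule modulus_tendsto_le[where F = "at_right 0"])
  show "((\<lambda>e. T t (of_real e ^ m *\<^sub>C R (Complex s \<beta> + of_real e) f)) \<longlongrightarrow> T t (L f)) (at_right 0)"
    using L unfolding leading_coefficient_def by (intro tendsto_intros) blast
  have "((\<lambda>e. e ^ (m - n) *\<^sub>R T t (of_real e ^ n *\<^sub>C R (of_real s + of_real e) g)) \<longlongrightarrow> 0 ^ (m - n) *\<^sub>R T t (Q g)) (at_right 0)"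
    using leading unfolding leading_coefficient_def by (intro tendsto_intros) blast
  then show "((\<lambda>e. e ^ (m - n) *\<^sub>R T t (of_real e ^ n *\<^sub>C R (of_real s + of_real e) g)) \<longlongrightarrow> 0 ^ (m - n) *\<^sub>R T t (Q g)) (at_right 0)" .
  show "\<forall>\<^sub>F e in at_right 0. modulus (T t (of_real e ^ m *\<^sub>C R (Complex s \<beta> + of_real e) f))
      \<le> re (e ^ (m - n) *\<^sub>R T t (of_real e ^ n *\<^sub>C R (of_real s + of_real e) g))"
  proof (rule eventually_at_rightI[of 0 1])
    fix e :: real assume "e \<in> {0<..<1}"
    then have e: "e > 0" by simp
    have c: "Complex s \<beta> + of_real e = Complex (s + e) \<beta>" "complex_of_real s + of_real e = of_real (s + e)"
      by (simp_all add: complex_eq_iff)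
    have "modulus (T t (R (Complex (s + e) \<beta>) f)) \<le> re (T t (R (of_real (s + e)) g))"
      using e s t fg by (intro modulus_T_resolvent_le) auto
    then have "e ^ m *\<^sub>R modulus (T t (R (Complex (s + e) \<beta>) f)) \<le> e ^ m *\<^sub>R re (T t (R (of_real (s + e)) g))"
      using e by (intro scaleR_left_mono) auto
    moreover have "e ^ m = e ^ (m - n) * e ^ n" using m by (simp flip: power_add)
    moreover have "of_real e ^ k *\<^sub>C v = e ^ k *\<^sub>R v" for k and v :: "'a complexification"
      by (metis of_real_power scaleC_of_real)
    ultimately show "modulus (T t (of_real e ^ m *\<^sub>C R (Complex s \<beta> + of_real e) f))
      \<le> re (e ^ (m - n) *\<^sub>R T t (of_real e ^ n *\<^sub>C R (of_real s + of_real e) g))"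
      unfolding c using e by (simp add: modulus_scaleR blinfun.bilinear_simps)
  qed simp
qed simp

text \<open>Domination with \<open>\<beta> = 0\<close> and \<open>m = n\<close> carries a factor
  \<open>T t\<^sub>0\<close>. On the range of \<open>Q\<close> this is the positive scalar
  \<open>exp (s * t\<^sub>0)\<close> and cancels, so eventual positivity of the semigroup becomes
  positivity of \<open>Q\<close>.\<close>

lemma modulus_Q_le:
  assumes "modulus f \<le> re g"
  shows "modulus (Q f) \<le> re (Q g)"
proof -
  have "Complex s 0 = of_real s" by (simp add: complex_eq_iff)
  then have "modulus (T t\<^sub>0 (Q f)) \<le> re (T t\<^sub>0 (Q g))"
    using leading_coefficient_dominated[of 0 n Q t\<^sub>0 f g] leading assms by simp
  then have "exp (s * t\<^sub>0) *\<^sub>R modulus (Q f) \<le> exp (s * t\<^sub>0) *\<^sub>R re (Q g)"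
    using t0 by (simp add: T_Q modulus_scaleR)
  then show ?thesis by (rule lattice_half_le) simp
qed

lemma P_nonneg: "0 \<le> f \<Longrightarrow> 0 \<le> P f"
  using modulus_Q_le[of "Cplx f 0" "Cplx f 0"] modulus_nonneg[of "Q (Cplx f 0)"]
  by (auto simp: P_def modulus_of_real intro: order_trans)

lemma modulus_Q_le_P: "modulus (Q z) \<le> P (modulus z)"
  unfolding P_def by (rule modulus_Q_le) simp

lemma bounded_linear_P: "bounded_linear P"
  unfolding P_def
  by (intro bounded_linear_compose[OF bounded_linear_re] bounded_linear_compose[OF blinfun.bounded_linear_right]
      bounded_linear_Cplx)

lemma bounded_linear_G: "bounded_linear (G t)"
  unfolding G_def
  by (intro bounded_linear_compose[OF bounded_linear_scaleR_right] bounded_linear_compose[OF bounded_linear_re]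
      bounded_linear_compose[OF blinfun.bounded_linear_right] bounded_linear_Cplx)

lemma Cplx_G: "t \<ge> 0 \<Longrightarrow> Cplx (G t f) 0 = exp (- s * t) *\<^sub>R T t (Cplx f 0)"
  using real[of t "Cplx f 0"] by (simp add: G_def scaleR_complexification_def)

lemma G_add:
  assumes "r \<ge> 0" "t \<ge> 0"
  shows "G (r + t) f = G r (G t f)"
proof -
  have "G r (G t f) = exp (- s * r) *\<^sub>R re (T r (exp (- s * t) *\<^sub>R T t (Cplx f 0)))"
    unfolding G_def[of r "G t f"] Cplx_G[OF assms(2)] ..
  also have "\<dots> = (exp (- s * r) * exp (- s * t)) *\<^sub>R re (T (r + t) (Cplx f 0))"
    by (simp add: blinfun.bilinear_simps T_add assms)
  also have "exp (- s * r) * exp (- s * t) = exp (- s * (r + t))"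
    by (simp add: algebra_simps flip: exp_add)
  finally show ?thesis by (simp add: G_def)
qed

lemma G_nonneg: "t \<ge> t\<^sub>0 \<Longrightarrow> 0 \<le> f \<Longrightarrow> 0 \<le> G t f"
  using positive[of t "Cplx f 0"]
  by (simp add: G_def less_eq_complexification_def scaleR_nonneg_nonneg)

lemma P_G: "t \<ge> 0 \<Longrightarrow> P (G t f) = P f"
proof -
  assume t: "t \<ge> 0"
  have "Q (Cplx (G t f) 0) = exp (- s * t) *\<^sub>R exp (s * t) *\<^sub>R Q (Cplx f 0)"
    by (simp add: Cplx_G t blinfun.bilinear_simps leading_coefficient_T[OF leading t] T_Q[OF t])
  then show ?thesis by (simp add: P_def flip: exp_add)
qed

text \<open>Carries irreducibility from the complex lattice to the real one, where the ideal
  arguments take place.\<close>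

lemma closed_ideal_trivial:
  assumes I: "closed I" "real_ideal I" and inv: "\<And>t x. t \<ge> t\<^sub>0 \<Longrightarrow> x \<in> I \<Longrightarrow> G t x \<in> I"
  shows "I = {0} \<or> I = UNIV"
proof -
  have solid: "y \<in> I" if "x \<in> I" "\<bar>y\<bar> \<le> \<bar>x\<bar>" for x y
    using I(2) that by (auto simp: real_ideal_def)
  \<comment> \<open>The complexification of \<open>I\<close>, described by the modulus so that it
    inherits solidity from \<open>I\<close>.\<close>
  define J where "J = {z. modulus z \<in> I}"
  have "closed J"
    unfolding closed_sequential_limits
  proof (intro allI impI, elim conjE)
    fix X z assume X: "\<forall>k. X k \<in> J" "X \<longlonglongrightarrow> z"
    have "modulus z \<in> I"
      by (rule closed_sequentially[OF I(1) _ tendsto_modulus[OF X(2)]]) (use X(1) in \<open>simp add: J_def\<close>)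
    then show "z \<in> J" by (simp add: J_def)
  qed
  moreover have "lattice_ideal J"
    unfolding lattice_ideal_def
  proof (intro conjI ballI allI impI)
    show "0 \<in> J" using I(2) by (simp add: J_def real_ideal_def)
    show "x + y \<in> J" if "x \<in> J" "y \<in> J" for x y
    proof -
      have "modulus x + modulus y \<in> I" using that I(2) by (simp add: J_def real_ideal_def)
      then show ?thesis
        using solid[of "modulus x + modulus y" "modulus (x + y)"] modulus_triangle[of x y]
        by (simp add: J_def modulus_nonneg)
    qed
    show "c *\<^sub>C x \<in> J" if "x \<in> J" for c x
      using that I(2) by (simp add: J_def real_ideal_def modulus_scaleC)
    show "y \<in> J" if "x \<in> J" "modulus y \<le> modulus x" for x y
      using solid[of "modulus x" "modulus y"] that by (simp add: J_def modulus_nonneg)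
  qed
  moreover have "T t ` J \<subseteq> J" if t: "t \<ge> t\<^sub>0" for t
  proof
    fix y assume "y \<in> T t ` J"
    then obtain z where z: "modulus z \<in> I" "y = T t z" by (auto simp: J_def)
    have t': "t \<ge> 0" using t t0 by simp
    have "modulus y \<le> re (T t (Cplx (modulus z) 0))"
      unfolding z(2) by (rule modulus_T_le[OF t]) simp
    also have "\<dots> = exp (s * t) *\<^sub>R G t (modulus z)" using T_eq_G[OF t', of "Cplx (modulus z) 0"] by simp
    finally have "modulus y \<le> exp (s * t) *\<^sub>R G t (modulus z)" .
    moreover have "exp (s * t) *\<^sub>R G t (modulus z) \<in> I" using inv[OF t z(1)] I(2) by (simp add: real_ideal_def)
    moreover have "0 \<le> exp (s * t) *\<^sub>R G t (modulus z)"
      by (intro scaleR_nonneg_nonneg G_nonneg t modulus_nonneg) simp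
    ultimately show "y \<in> J"
      using solid[of "exp (s * t) *\<^sub>R G t (modulus z)" "modulus y"] by (simp add: J_def modulus_nonneg)
  qed
  ultimately have "J = {0} \<or> J = UNIV"
    using irreducible t0 unfolding persistently_irreducible_def by blast
  then show ?thesis
  proof
    assume J: "J = {0}"
    have "x = 0" if "x \<in> I" for x
    proof -
      have "\<bar>x\<bar> \<in> I" using solid[OF that, of "\<bar>x\<bar>"] by simp
      then have "Cplx x 0 \<in> J" by (simp add: J_def modulus_of_real)
      then show ?thesis using J by (simp add: zero_complexification_def)
    qed
    then show ?thesis using I(2) by (auto simp: real_ideal_def)
  next
    assume J: "J = UNIV"
    have "x \<in> I" for x
    proof -
      have "Cplx x 0 \<in> J" using J by simp
      then have "\<bar>x\<bar> \<in> I" by (simp add: J_def modulus_of_real)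
      then show ?thesis using solid[of "\<bar>x\<bar>" x] by simp
    qed
    then show ?thesis by blast
  qed
qed

section \<open>Strict positivity of \<open>P\<close> and the order of the pole at
  \<open>s\<close>\<close>

lemma G_linear: "linear (G t)" and P_linear: "linear P"
  using bounded_linear_G bounded_linear_P bounded_linear.linear by blast+

lemma P_mono: "x \<le> y \<Longrightarrow> P x \<le> P y"
  using P_nonneg[of "y - x"] by (simp add: linear_diff[OF P_linear])

lemma P_strict:
  assumes f: "0 \<le> f" "P f = 0"
  shows "f = 0"
proof -
  define I where "I = {x. P \<bar>x\<bar> = 0}"
  have I_le: "x \<in> I" if "\<bar>x\<bar> \<le> y" "P y = 0" for x y
    using P_mono[OF that(1)] P_nonneg[of "\<bar>x\<bar>"] that(2) by (simp add: I_def)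
  have "closed I"
    unfolding closed_sequential_limits
  proof (intro allI impI, elim conjE)
    fix X z assume X: "\<forall>k. X k \<in> I" "X \<longlonglongrightarrow> z"
    have "(\<lambda>k. P \<bar>X k\<bar>) \<longlonglongrightarrow> P \<bar>z\<bar>"
      by (rule bounded_linear.tendsto[OF bounded_linear_P tendsto_lattice_abs[OF X(2)]])
    then show "z \<in> I" using X(1) by (simp add: I_def LIMSEQ_const_iff)
  qed
  moreover have "real_ideal I"
    unfolding real_ideal_def
  proof (intro conjI ballI allI impI)
    show "0 \<in> I" by (simp add: I_def linear_0[OF P_linear])
    show "x + y \<in> I" if "x \<in> I" "y \<in> I" for x y
      using that by (intro I_le[OF abs_triangle_ineq]) (simp add: I_def linear_add[OF P_linear])
    show "c *\<^sub>R x \<in> I" if "x \<in> I" for c x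
      using that by (simp add: I_def lattice_abs_scaleR linear_cmul[OF P_linear])
    show "y \<in> I" if "x \<in> I" "\<bar>y\<bar> \<le> \<bar>x\<bar>" for x y
      using that by (intro I_le[OF that(2)]) (simp add: I_def)
  qed
  moreover have "G t x \<in> I" if t: "t \<ge> t\<^sub>0" and x: "x \<in> I" for t x
  proof (rule I_le)
    have mono: "G t y \<le> G t z" if "y \<le> z" for y z
      using G_nonneg[OF t, of "z - y"] that by (simp add: linear_diff[OF G_linear])
    show "\<bar>G t x\<bar> \<le> G t \<bar>x\<bar>"
      using mono[OF abs_ge_self[of x]] mono[OF abs_ge_minus_self[of x]]
      by (intro abs_leI) (simp_all add: linear_neg[OF G_linear])
    show "P (G t \<bar>x\<bar>) = 0" using x t t0 by (simp add: P_G I_def)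
  qed
  ultimately have "I = {0} \<or> I = UNIV" by (rule closed_ideal_trivial)
  \<comment> \<open>As \<open>modulus (Q z) \<le> P (modulus z)\<close>, a null ideal equal to the
    whole space would force \<open>Q = 0\<close>.\<close>
  moreover have "I \<noteq> UNIV"
  proof
    assume UNIV: "I = UNIV"
    have "Q z = 0" for z
    proof -
      have "modulus z \<in> I" using UNIV by simp
      then have "modulus (Q z) \<le> 0" using modulus_Q_le_P[of z] by (simp add: I_def modulus_nonneg)
      then show ?thesis using modulus_nonneg[of "Q z"] modulus_eq_0[of "Q z"] by (metis antisym)
    qed
    then show False using Q_nonzero by (auto intro: blinfun_eqI)
  qed
  moreover have "f \<in> I" using f by (simp add: I_def)
  ultimately show ?thesis by auto
qed

text \<open>For order at least 2 the leading coefficient squares to zero, so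
  \<open>P (P f) = 0\<close> for \<open>0 \<le> f\<close>. Strictness, applied twice, gives
  \<open>f = 0\<close>; then all moduli vanish, contrary to \<open>Q \<noteq> 0\<close>.\<close>

lemma pole_order_one: "n = 1"
proof (rule ccontr)
  assume "n \<noteq> 1"
  then have n: "n \<ge> 2" using leading by (auto simp: leading_coefficient_def)
  have "P (P f) = 0" if f: "0 \<le> f" for f
  proof -
    \<comment> \<open>\<open>g\<close> serves as the majorant of \<open>P f\<close> because its
      image under \<open>Q\<close> is known to vanish.\<close>
    define g where "g = Q (Cplx f 0)"
    have "modulus (Cplx (P f) 0) \<le> re g"
      using P_nonneg[OF f] by (simp add: modulus_of_real P_def g_def)
    from modulus_Q_le[OF this] have "modulus (Q (Cplx (P f) 0)) \<le> 0"
      by (simp add: g_def leading_coefficient_nilpotent[OF leading n])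
    then have "Q (Cplx (P f) 0) = 0"
      using modulus_nonneg[of "Q (Cplx (P f) 0)"] modulus_eq_0 by (metis antisym)
    then show ?thesis by (simp add: P_def)
  qed
  then have P0: "P f = 0" if "0 \<le> f" for f using that P_strict P_nonneg by blast
  then have "modulus z = 0" for z :: "'a complexification" using P_strict modulus_nonneg by blast
  then have "Q z = 0" for z using modulus_eq_0 by blast
  then show False using Q_nonzero by (auto intro: blinfun_eqI)
qed

sublocale lat: irreducible_lattice_semigroup G P t\<^sub>0
proof (rule irreducible_lattice_semigroup.intro)
  show "bounded_linear (G t)" for t by (rule bounded_linear_G)
  show "bounded_linear P" by (rule bounded_linear_P)
  show "I = {0} \<or> I = UNIV"
    if "closed I" "real_ideal I" "\<And>t x. t \<ge> t\<^sub>0 \<Longrightarrow> x \<in> I \<Longrightarrow> G t x \<in> I" for I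
    using that by (rule closed_ideal_trivial)
qed (use t0 in \<open>auto intro: P_nonneg G_nonneg P_strict simp: G_add P_G\<close>)

text \<open>Links the rotation equations at times beyond \<open>t\<^sub>0\<close> with the
  generator, which depends on small times.\<close>

lemma peripheral_eigenvector_iff:
  "lat.eigenvector \<beta> z \<longleftrightarrow> generates T z (Complex s \<beta> *\<^sub>C z)"
proof -
  have rot: "exp (Complex s \<beta> * of_real t) *\<^sub>C z
      = exp (s * t) *\<^sub>R Cplx (cos (\<beta> * t) *\<^sub>R re z - sin (\<beta> * t) *\<^sub>R im z) (sin (\<beta> * t) *\<^sub>R re z + cos (\<beta> * t) *\<^sub>R im z)" for t
  proof -
    have "Complex s \<beta> * of_real t = Complex (s * t) (\<beta> * t)" by (simp add: complex_eq_iff)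
    then show ?thesis
      by (simp add: scaleC_complexification_def scaleR_complexification_def Re_exp Im_exp algebra_simps)
  qed
  have eq: "T t z = exp (Complex s \<beta> * of_real t) *\<^sub>C z \<longleftrightarrow>
      G t (re z) = cos (\<beta> * t) *\<^sub>R re z - sin (\<beta> * t) *\<^sub>R im z \<and>
      G t (im z) = sin (\<beta> * t) *\<^sub>R re z + cos (\<beta> * t) *\<^sub>R im z" if "t \<ge> 0" for t
    unfolding rot T_eq_G[OF that] by simp
  show ?thesis
  proof
    assume "lat.eigenvector \<beta> z"
    then have late: "T t z = exp (Complex s \<beta> * of_real t) *\<^sub>C z" if "t \<ge> t\<^sub>0" for t
      using that t0 eq[of t] by (simp add: lat.eigenvector_def)
    \<comment> \<open>Computing \<open>T t (T t\<^sub>0 z)\<close> in two ways leaves the nonzero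
      scalar \<open>?e t\<^sub>0\<close>, which cancels; so the late equations determine the early
      ones.\<close>
    have "T t z = exp (Complex s \<beta> * of_real t) *\<^sub>C z" if t: "t \<ge> 0" for t
    proof -
      let ?e = "\<lambda>r. exp (Complex s \<beta> * of_real r)"
      have "?e t\<^sub>0 *\<^sub>C T t z = T t (T t\<^sub>0 z)" by (simp add: late T_scaleC t)
      also have "\<dots> = ?e (t + t\<^sub>0) *\<^sub>C z" using late[of "t + t\<^sub>0"] t t0 by (simp add: T_add)
      also have "\<dots> = ?e t\<^sub>0 *\<^sub>C ?e t *\<^sub>C z"
        by (simp add: scaleC_scaleC algebra_simps flip: exp_add)
      finally have "inverse (?e t\<^sub>0) *\<^sub>C ?e t\<^sub>0 *\<^sub>C T t z = inverse (?e t\<^sub>0) *\<^sub>C ?e t\<^sub>0 *\<^sub>C ?e t *\<^sub>C z" by simp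
      then show ?thesis by (simp only: scaleC_cancel exp_not_eq_zero not_False_eq_True)
    qed
    then show "generates T z (Complex s \<beta> *\<^sub>C z)" using eigenvector_iff_orbit by blast
  next
    assume "generates T z (Complex s \<beta> *\<^sub>C z)"
    then show "lat.eigenvector \<beta> z"
      using eq t0 unfolding lat.eigenvector_def eigenvector_iff_orbit by (meson order_trans)
  qed
qed

section \<open>The group of peripheral eigenvalues and the remaining poles\<close>

lemma point_spectrum_subset: "point_spectrum (generator T) \<subseteq> spectrum (generator T)"
proof
  fix \<mu> assume "\<mu> \<in> point_spectrum (generator T)"
  then obtain x where x: "x \<in> dom (generator T)" "x \<noteq> 0" "act (generator T) x = \<mu> *\<^sub>C x"
    by (auto simp: point_spectrum_def)
  show "\<mu> \<in> spectrum (generator T)"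
  proof (rule ccontr)
    assume "\<mu> \<notin> spectrum (generator T)"
    then have "\<mu> \<in> \<rho>" by (simp add: spectrum_def)
    then have "R \<mu> (\<mu> *\<^sub>C x - \<mu> *\<^sub>C x) = x"
      using x by (intro resolvent_generates) (auto simp: generates_iff)
    then show False using x(2) by simp
  qed
qed

lemma peripheral_point_spectrum_eq:
  "peripheral_point_spectrum (generator T) = Complex s ` {\<beta>. \<exists>z. z \<noteq> 0 \<and> lat.eigenvector \<beta> z}"
proof -
  have pnt: "\<mu> \<in> point_spectrum (generator T) \<longleftrightarrow> (\<exists>z. z \<noteq> 0 \<and> generates T z (\<mu> *\<^sub>C z))" for \<mu>
    unfolding point_spectrum_def generates_iff by blast
  have iff: "\<mu> \<in> peripheral_point_spectrum (generator T) \<longleftrightarrow>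
      Re \<mu> = s \<and> (\<exists>z. z \<noteq> 0 \<and> generates T z (\<mu> *\<^sub>C z))" for \<mu>
    unfolding pnt[symmetric] peripheral_point_spectrum_def peripheral_spectrum_def s
    using point_spectrum_subset by blast
  show ?thesis
  proof (rule set_eqI, rule iffI)
    fix \<mu> assume "\<mu> \<in> peripheral_point_spectrum (generator T)"
    then obtain z where z: "Re \<mu> = s" "z \<noteq> 0" "generates T z (\<mu> *\<^sub>C z)" using iff by blast
    then have "\<mu> = Complex s (Im \<mu>)" by (simp add: complex_eq_iff)
    then show "\<mu> \<in> Complex s ` {\<beta>. \<exists>z. z \<noteq> 0 \<and> lat.eigenvector \<beta> z}"
      using z peripheral_eigenvector_iff[of "Im \<mu>" z] by (intro image_eqI[of _ _ "Im \<mu>"]) auto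
  next
    fix \<mu> assume "\<mu> \<in> Complex s ` {\<beta>. \<exists>z. z \<noteq> 0 \<and> lat.eigenvector \<beta> z}"
    then show "\<mu> \<in> peripheral_point_spectrum (generator T)"
      unfolding iff peripheral_eigenvector_iff by auto
  qed
qed

lemma peripheral_point_spectrum_cyclic:
  assumes r: "r > 0" "\<And>\<nu>. 0 < cmod (\<nu> - of_real s) \<Longrightarrow> cmod (\<nu> - of_real s) < r \<Longrightarrow> \<nu> \<in> \<rho>"
  shows "\<exists>\<alpha>\<ge>0. peripheral_point_spectrum (generator T) = {of_real s + \<i> * of_real \<alpha> * of_int k | k. True}"
proof -
  define E where "E = {\<beta>. \<exists>z. z \<noteq> 0 \<and> lat.eigenvector \<beta> z}"
  have "\<exists>\<alpha>\<ge>0. E = {\<alpha> * of_int k | k. True}"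
  proof (rule discrete_additive_subgroup_cyclic[OF _ _ r(1)])
    \<comment> \<open>A nonzero \<open>Q x\<close> is an eigenvector for \<open>s\<close>
      itself.\<close>
    obtain x where "Q x \<noteq> 0" using Q_nonzero blinfun_eqI[of Q 0] by auto
    moreover have "Complex s 0 = of_real s" by (simp add: complex_eq_iff)
    ultimately show "0 \<in> E"
      using leading_coefficient_generates[OF leading, of x] by (auto simp: E_def peripheral_eigenvector_iff)
    show "x - y \<in> E" if "x \<in> E" "y \<in> E" for x y
      using that lat.eigenvector_diff by (auto simp: E_def)
    fix \<beta> assume \<beta>: "\<beta> \<in> E" "\<bar>\<beta>\<bar> < r"
    \<comment> \<open>Otherwise the eigenvalue \<open>Complex s \<beta>\<close> would lie in the
      punctured disc around \<open>s\<close> that belongs to the resolvent set.\<close>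
    show "\<beta> = 0"
    proof (rule ccontr)
      assume "\<beta> \<noteq> 0"
      moreover have "Complex s \<beta> - of_real s = \<i> * of_real \<beta>" by (simp add: complex_eq_iff)
      ultimately have "Complex s \<beta> \<in> \<rho>" using \<beta>(2) by (intro r(2)) (simp_all add: norm_mult)
      moreover have "Complex s \<beta> \<in> spectrum (generator T)"
        using \<beta>(1) peripheral_point_spectrum_eq point_spectrum_subset by (auto simp: E_def peripheral_point_spectrum_def)
      ultimately show False by (simp add: spectrum_def)
    qed
  qed
  then obtain \<alpha> where \<alpha>: "\<alpha> \<ge> 0" "E = {\<alpha> * of_int k | k. True}" by blast
  have "Complex s (\<alpha> * of_int k) = of_real s + \<i> * of_real \<alpha> * of_int k" for k
    by (simp add: complex_eq_iff)
  then have "Complex s ` E = {of_real s + \<i> * of_real \<alpha> * of_int k | k. True}"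
    unfolding \<alpha>(2) by (auto simp: image_iff) metis
  then show ?thesis using \<alpha>(1) peripheral_point_spectrum_eq by (auto simp: E_def)
qed

text \<open>For \<open>m > 1 = n\<close> the dominating term carries the factor
  \<open>0 ^ (m - n) = 0\<close>, so \<open>T t\<^sub>0\<close> annihilates the range of
  \<open>L\<close>. But it acts there as a nonzero scalar.\<close>

lemma peripheral_pole_simple:
  assumes pole: "resolvent_pole_of_order (generator T) \<mu> m" and \<mu>: "Re \<mu> = s"
  shows "m = 1"
proof (rule ccontr)
  assume "m \<noteq> 1"
  obtain L r where L: "leading_coefficient \<mu> m L" "L \<noteq> 0"
    using pole_leading_coefficient[OF pole] by metis
  have \<mu>': "\<mu> = Complex s (Im \<mu>)" using \<mu> by (simp add: complex_eq_iff)
  have m: "m > 1" using L(1) \<open>m \<noteq> 1\<close> by (auto simp: leading_coefficient_def)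
  have "L z = 0" for z
  proof -
    have "modulus (T t\<^sub>0 (L z)) \<le> re (0 ^ (m - n) *\<^sub>R T t\<^sub>0 (Q (Cplx (modulus z) 0)))"
      using L(1) m \<mu>' pole_order_one
      by (intro leading_coefficient_dominated[where \<beta> = "Im \<mu>"]) auto
    then have "modulus (T t\<^sub>0 (L z)) \<le> 0" using m pole_order_one by (simp add: power_0_left)
    then have "T t\<^sub>0 (L z) = 0" using modulus_nonneg[of "T t\<^sub>0 (L z)"] modulus_eq_0 by (metis antisym)
    moreover have "T t\<^sub>0 (L z) = exp (\<mu> * of_real t\<^sub>0) *\<^sub>C L z"
      using leading_coefficient_generates[OF L(1), of z] eigenvector_iff_orbit t0 by blast
    ultimately have "cmod (exp (\<mu> * of_real t\<^sub>0)) * norm (L z) = 0" by (metis norm_scaleC norm_zero)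
    then show ?thesis by simp
  qed
  then show False using L(2) by (auto intro: blinfun_eqI)
qed

end

theorem theorem4p3:
  fixes T :: "real \<Rightarrow> 'a::banach_lattice complexification \<Rightarrow>\<^sub>L 'a complexification"
  assumes "C0_semigroup T"
    and "real_semigroup T"
    and "uniformly_eventually_positive T"
    and "persistently_irreducible T"
    and "spectrum (generator T) \<noteq> {}"
    and "resolvent_pole (generator T) (complex_of_real (spectral_bound (generator T)))"
  shows "(\<exists>\<alpha>::real. \<alpha> \<ge> 0 \<and>
      peripheral_point_spectrum (generator T) =
        {complex_of_real (spectral_bound (generator T)) + \<i> * complex_of_real \<alpha> * of_int k | k :: int. True})
    \<and> (\<forall>\<mu> \<in> peripheral_spectrum (generator T).
        resolvent_pole (generator T) \<mu> \<longrightarrow> simple_resolvent_pole (generator T) \<mu>)"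
proof -
  define s where "s = spectral_bound (generator T)"
  interpret c0_semigroup T by standard (rule assms(1))
  obtain n where "resolvent_pole_of_order (generator T) (of_real s) n"
    using assms(6) by (auto simp: resolvent_pole_def s_def)
  then obtain Q r where Q: "leading_coefficient (of_real s) n Q" "Q \<noteq> 0"
    and r: "r > 0" "\<And>\<nu>. 0 < cmod (\<nu> - of_real s) \<Longrightarrow> cmod (\<nu> - of_real s) < r \<Longrightarrow> \<nu> \<in> \<rho>"
    using pole_leading_coefficient by blast
  obtain t\<^sub>0 where t0: "t\<^sub>0 \<ge> 0" "\<And>t f. t \<ge> t\<^sub>0 \<Longrightarrow> f \<ge> 0 \<Longrightarrow> T t f \<ge> 0"
    using assms(3) by (auto simp: uniformly_eventually_positive_def)
  interpret irreducible_pole_semigroup T t\<^sub>0 s n Q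
  proof
    show "im (T t x) = 0" if "t \<ge> 0" "im x = 0" for t x
      using assms(2) that by (auto simp: real_semigroup_def real_part_def)
  qed (use t0 Q assms(4) s_def in auto)
  have "simple_resolvent_pole (generator T) \<mu>"
    if "\<mu> \<in> peripheral_spectrum (generator T)" "resolvent_pole (generator T) \<mu>" for \<mu>
    using that peripheral_pole_simple
    by (auto simp: peripheral_spectrum_def resolvent_pole_def simple_resolvent_pole_def s_def)
  then show ?thesis
    using peripheral_point_spectrum_cyclic[OF r] by (auto simp: s_def)
qed

end
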